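(* For every finite simplicial complex $K$, the pair $(K,\partial_{\mathrm{odd}}(K))$ has the $\epsilon$-surjection property for some $\epsilon>0$, hence has computable type.
   Context: A finite simplicial complex is identified with its geometric realization, a compact metrizable space. Let $K$ be a finite simplicial complex of dimension $m$. A simplex is maximal if it is not a proper face of another simplex of $K$. For $0\leq n<m$, the odd $n$-subcomplex $\partial^n_{\mathrm{odd}}(K)$ of $K$ is the collection of all $n$-simplices of $K$ that are contained in an odd number of maximal $(n+1)$-simplices of $K$ (viewed, together with their faces, as a subcomplex). The odd subcomplex is $\partial_{\mathrm{odd}}(K)=\bigcup_{0\leq n<m}\partial^n_{\mathrm{odd}}(K)$. For a compact metrizable space $X$ with a compatible metric $d$, a closed subset $A$ and $\epsilon>0$, the pair $(X,A)$ has the $\epsilon$-surjection property if every continuous $f:X\to X$ with $f|_A=\mathrm{id}_A$ and $d(f(x),x)<\epsilon$ for all $x\in X$ is surjective. (Whether this holds for some $\epsilon>0$ is independent of the compatible metric.) Computable type. Let $Q=[0,1]^{\mathbb{N}}$ be the Hilbert cube with metric $d(x,y)=\sum_{i}2^{-i}|x_i-y_i|$. A point of $Q$ is finitary if it is a sequence of rational numbers that is eventually $0$. Let $(B_i)_{i\in\mathbb{N}}$ be a standard computable enumeration of the metric balls of $Q$ centered at finitary points with positive rational radii. A compact set $L\subseteq Q$ is semicomputable if the set of finite sequences $(i_1,\dots,i_n)$ of natural numbers such that $L\subseteq B_{i_1}\cup\dots\cup B_{i_n}$ is computably enumerable; it is computable if it is semicomputable and moreover $\{i\in\mathbb{N}:L\cap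 B_i\neq\emptyset\}$ is computably enumerable. A copy of a pair $(X,A)$ in $Q$ is a pair $(X',A')$ with $A'\subseteq X'\subseteq Q$ for which there is a homeomorphism $f:X\to X'$ with $f(A)=A'$. A compact pair $(X,A)$ has computable type if for every copy $(X',A')$ of $(X,A)$ in $Q$, if $X'$ and $A'$ are semicomputable, then $X'$ is computable. *)

theory Defs
  imports "HOL-Analysis.Analysis" "HOL-Library.Nat_Bijection"
begin

section \<open>Odd subcomplexes\<close>

text \<open>
  A finite simplicial complex is a \<^const>\<open>simplicial_complex\<close> \<open>K\<close> in some Euclidean space, and its
  realization is \<open>\<Union>K\<close>. In the library the empty set is a \<open>(-1)\<close>-simplex and a face of every
  simplex, so it belongs to every nonempty complex; it affects none of the notions below.
\<close>

definition complex_dim :: "'a::euclidean_space set set \<Rightarrow> int" where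
  "complex_dim K = Max (insert (- 1) (aff_dim ` K))"

definition maximal_simplex :: "'a::euclidean_space set set \<Rightarrow> 'a set \<Rightarrow> bool" where
  "maximal_simplex K S \<longleftrightarrow> S \<in> K \<and> \<not> (\<exists>T\<in>K. S face_of T \<and> S \<noteq> T)"

definition odd_simplices :: "int \<Rightarrow> 'a::euclidean_space set set \<Rightarrow> 'a set set" where
  "odd_simplices n K =
     {S \<in> K. n simplex S \<and> odd (card {T. maximal_simplex K T \<and> (n + 1) simplex T \<and> S \<subseteq> T})}"

definition odd_n_subcomplex :: "int \<Rightarrow> 'a::euclidean_space set set \<Rightarrow> 'a set set" where
  "odd_n_subcomplex n K = {F. \<exists>S \<in> odd_simplices n K. F face_of S}"

definition odd_subcomplex :: "'a::euclidean_space set set \<Rightarrow> 'a set set" where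
  "odd_subcomplex K = (\<Union>n \<in> {0..<complex_dim K}. odd_n_subcomplex n K)"


section \<open>The surjection property\<close>

definition compatible_metric :: "'a::topological_space set \<Rightarrow> ('a \<Rightarrow> 'a \<Rightarrow> real) \<Rightarrow> bool" where
  "compatible_metric X d \<longleftrightarrow>
     Metric_space X d \<and> Metric_space.mtopology X d = top_of_set X"

definition eps_surjection_property ::
  "('a::topological_space \<Rightarrow> 'a \<Rightarrow> real) \<Rightarrow> real \<Rightarrow> 'a set \<Rightarrow> 'a set \<Rightarrow> bool" where
  "eps_surjection_property d \<epsilon> X A \<longleftrightarrow>
     (\<forall>f. continuous_on X f \<and> f ` X \<subseteq> X \<and> (\<forall>x\<in>A. f x = x) \<and> (\<forall>x\<in>X. d (f x) x < \<epsilon>)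
        \<longrightarrow> f ` X = X)"


section \<open>Computably enumerable sets\<close>

text \<open>
  \<open>recursive_fun n f\<close>: the total function \<open>f\<close> of \<open>n\<close> arguments, given as a list of length \<open>n\<close>, is
  (general) recursive. Only the values of \<open>f\<close> on lists of length \<open>n\<close> matter. Minimization is
  restricted to the regular case, so that all functions stay total.
\<close>

inductive recursive_fun :: "nat \<Rightarrow> (nat list \<Rightarrow> nat) \<Rightarrow> bool" where
  zero: "recursive_fun n (\<lambda>xs. 0)"
| succ: "recursive_fun 1 (\<lambda>xs. Suc (xs ! 0))"
| proj: "i < n \<Longrightarrow> recursive_fun n (\<lambda>xs. xs ! i)"
| comp: "recursive_fun (length gs) f \<Longrightarrow> (\<And>g. g \<in> set gs \<Longrightarrow> recursive_fun n g)
         \<Longrightarrow> recursive_fun n (\<lambda>xs. f (map (\<lambda>g. g xs) gs))"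
| prim_rec: "recursive_fun n f \<Longrightarrow> recursive_fun (n + 2) g
         \<Longrightarrow> recursive_fun (Suc n)
               (\<lambda>xs. rec_nat (f (tl xs)) (\<lambda>k r. g (k # r # tl xs)) (hd xs))"
| minimize: "recursive_fun (Suc n) f \<Longrightarrow> (\<And>xs. length xs = n \<Longrightarrow> \<exists>k. f (k # xs) = 0)
         \<Longrightarrow> recursive_fun n (\<lambda>xs. LEAST k. f (k # xs) = 0)"

definition computable_fun :: "(nat \<Rightarrow> nat) \<Rightarrow> bool" where
  "computable_fun f \<longleftrightarrow> (\<exists>g. recursive_fun 1 g \<and> (\<forall>x. f x = g [x]))"

definition comp_enumerable :: "nat set \<Rightarrow> bool" where
  "comp_enumerable A \<longleftrightarrow> A = {} \<or> (\<exists>f. computable_fun f \<and> A = range f)"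

text \<open>Finite sequences of numbers are coded by numbers through the computable bijection
  \<^const>\<open>list_encode\<close>.\<close>

definition comp_enumerable_seqs :: "nat list set \<Rightarrow> bool" where
  "comp_enumerable_seqs S \<longleftrightarrow> comp_enumerable (list_encode ` S)"


section \<open>The Hilbert cube\<close>

definition hilbert_cube :: "(nat \<Rightarrow> real) set" where
  "hilbert_cube = {x. \<forall>i. x i \<in> {0..1}}"

definition hdist :: "(nat \<Rightarrow> real) \<Rightarrow> (nat \<Rightarrow> real) \<Rightarrow> real" where
  "hdist x y = (\<Sum>i. (1 / 2) ^ i * \<bar>x i - y i\<bar>)"

definition hball :: "(nat \<Rightarrow> real) \<Rightarrow> real \<Rightarrow> (nat \<Rightarrow> real) set" where
  "hball c r = {y \<in> hilbert_cube. hdist c y < r}"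

definition finitary :: "(nat \<Rightarrow> real) \<Rightarrow> bool" where
  "finitary x \<longleftrightarrow> x \<in> hilbert_cube \<and> (\<forall>i. x i \<in> \<rat>) \<and> (\<exists>N. \<forall>i\<ge>N. x i = 0)"

definition unit_rat :: "nat \<Rightarrow> real" where
  "unit_rat n = (case prod_decode n of (a, b) \<Rightarrow> min 1 (real a / real (b + 1)))"

definition pos_rat :: "nat \<Rightarrow> real" where
  "pos_rat n = (case prod_decode n of (a, b) \<Rightarrow> real (a + 1) / real (b + 1))"

definition finitary_point :: "nat \<Rightarrow> nat \<Rightarrow> real" where
  "finitary_point n =
     (let cs = list_decode n in (\<lambda>i. if i < length cs then unit_rat (cs ! i) else 0))"

definition std_ball :: "nat \<Rightarrow> (nat \<Rightarrow> real) set" where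
  "std_ball n = (case prod_decode n of (c, r) \<Rightarrow> hball (finitary_point c) (pos_rat r))"


section \<open>Computable type\<close>

definition semicomputable :: "(nat \<Rightarrow> real) set \<Rightarrow> bool" where
  "semicomputable L \<longleftrightarrow>
     compact L \<and> L \<subseteq> hilbert_cube \<and> comp_enumerable_seqs {js. L \<subseteq> (\<Union>i\<in>set js. std_ball i)}"

definition computable_compact :: "(nat \<Rightarrow> real) set \<Rightarrow> bool" where
  "computable_compact L \<longleftrightarrow>
     semicomputable L \<and> comp_enumerable {i. L \<inter> std_ball i \<noteq> {}}"

text \<open>The topology on \<^typ>\<open>nat \<Rightarrow> real\<close> is the product topology; on the Hilbert cube it is the
  topology of \<^const>\<open>hdist\<close>, see \<open>openin_hilbert_cube_iff\<close> below.\<close>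

definition copy_in_cube ::
  "'a::topological_space set \<Rightarrow> 'a set \<Rightarrow> (nat \<Rightarrow> real) set \<Rightarrow> (nat \<Rightarrow> real) set \<Rightarrow> bool" where
  "copy_in_cube X A X' A' \<longleftrightarrow>
     A' \<subseteq> X' \<and> X' \<subseteq> hilbert_cube \<and> (\<exists>f g. homeomorphism X X' f g \<and> f ` A = A')"

definition computable_type :: "'a::topological_space set \<Rightarrow> 'a set \<Rightarrow> bool" where
  "computable_type X A \<longleftrightarrow>
     compact X \<and> compact A \<and> A \<subseteq> X \<and>
     (\<forall>X' A'. copy_in_cube X A X' A' \<and> semicomputable X' \<and> semicomputable A'
        \<longrightarrow> computable_compact X')"


section \<open>The enumeration of balls and the topology of the Hilbert cube\<close>

lemma range_unit_rat: "range unit_rat = \<rat> \<inter> {0..1}"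
proof (intro equalityI subsetI)
  fix x assume "x \<in> range unit_rat"
  then show "x \<in> \<rat> \<inter> {0..1}"
    by (auto simp: unit_rat_def min_def split: prod.splits)
next
  fix x :: real assume x: "x \<in> \<rat> \<inter> {0..1}"
  then obtain m n where mn: "n \<noteq> 0" "\<bar>x\<bar> = real m / real n"
    using Rats_abs_nat_div_natE by (metis IntD1)
  then have "x = unit_rat (prod_encode (m, n - 1))"
    using x by (auto simp: unit_rat_def)
  then show "x \<in> range unit_rat" by blast
qed

lemma range_pos_rat: "range pos_rat = \<rat> \<inter> {0<..}"
proof (intro equalityI subsetI)
  fix x assume "x \<in> range pos_rat"
  then show "x \<in> \<rat> \<inter> {0<..}"
    by (auto simp: pos_rat_def split: prod.splits)
next
  fix x :: real assume x: "x \<in> \<rat> \<inter> {0<..}"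
  then obtain m n where mn: "n \<noteq> 0" "\<bar>x\<bar> = real m / real n"
    using Rats_abs_nat_div_natE by (metis IntD1)
  then have "m \<noteq> 0" using x by (intro notI) auto
  then have "x = pos_rat (prod_encode (m - 1, n - 1))"
    using x mn by (auto simp: pos_rat_def)
  then show "x \<in> range pos_rat" by blast
qed

lemma unit_rat_props: "unit_rat n \<in> \<rat>" "0 \<le> unit_rat n" "unit_rat n \<le> 1"
  using range_unit_rat by auto

lemma range_finitary_point: "range finitary_point = Collect finitary"
proof (intro equalityI subsetI)
  fix x assume "x \<in> range finitary_point"
  then show "x \<in> Collect finitary"
    by (auto simp: finitary_point_def finitary_def hilbert_cube_def Let_def unit_rat_props)
      (meson not_less)
next
  fix x assume "x \<in> Collect finitary"
  then obtain N where N: "\<And>i. i \<ge> N \<Longrightarrow> x i = 0" and "\<And>i. x i \<in> \<rat> \<inter> {0..1}"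
    by (auto simp: finitary_def hilbert_cube_def)
  then have "\<forall>i. \<exists>k. x i = unit_rat k"
    using range_unit_rat by (metis imageE)
  then obtain k where k: "\<And>i. x i = unit_rat (k i)" by metis
  have "x = finitary_point (list_encode (map k [0..<N]))"
    using N by (auto simp: finitary_point_def fun_eq_iff simp flip: k)
  then show "x \<in> range finitary_point" by blast
qed

lemma range_std_ball: "range std_ball = {hball c r |c r. finitary c \<and> r \<in> \<rat> \<and> r > 0}"
proof (intro equalityI subsetI)
  fix B assume "B \<in> range std_ball"
  then show "B \<in> {hball c r |c r. finitary c \<and> r \<in> \<rat> \<and> r > 0}"
    using range_finitary_point range_pos_rat by (fastforce simp: std_ball_def split: prod.splits)
next
  fix B assume "B \<in> {hball c r |c r. finitary c \<and> r \<in> \<rat> \<and> r > 0}"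
  then obtain c r where B: "B = hball c r" "finitary c" "r \<in> \<rat> \<inter> {0<..}" by auto
  then obtain m n where "c = finitary_point m" "r = pos_rat n"
    using range_finitary_point range_pos_rat by (metis imageE mem_Collect_eq)
  then have "B = std_ball (prod_encode (m, n))" using B by (simp add: std_ball_def)
  then show "B \<in> range std_ball" by blast
qed

lemma hdist_term_le:
  assumes "x \<in> hilbert_cube" "y \<in> hilbert_cube"
  shows "norm ((1 / 2) ^ i * \<bar>x i - y i\<bar>) \<le> (1 / 2 :: real) ^ i"
proof -
  have "\<bar>x i - y i\<bar> \<le> 1" using assms by (auto simp: hilbert_cube_def abs_le_iff) (smt (verit))+
  then show ?thesis by (simp add: abs_mult mult_left_le)
qed

lemma hdist_summable:
  assumes "x \<in> hilbert_cube" "y \<in> hilbert_cube"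
  shows "summable (\<lambda>i. (1 / 2) ^ i * \<bar>x i - y i\<bar>)"
  by (rule summable_comparison_test'[where g = "\<lambda>i. (1/2)^i" and N = 0])
    (use hdist_term_le[OF assms] in \<open>auto intro: summable_geometric\<close>)

lemma hdist_eq_0_iff:
  assumes "x \<in> hilbert_cube" "y \<in> hilbert_cube"
  shows "hdist x y = 0 \<longleftrightarrow> x = y"
  using suminf_eq_zero_iff[OF hdist_summable[OF assms]] by (auto simp: hdist_def fun_eq_iff)

lemma hdist_nonneg:
  assumes "x \<in> hilbert_cube" "y \<in> hilbert_cube"
  shows "0 \<le> hdist x y"
  unfolding hdist_def by (rule suminf_nonneg[OF hdist_summable[OF assms]]) auto

lemma hdist_triangle:
  assumes "x \<in> hilbert_cube" "y \<in> hilbert_cube" "z \<in> hilbert_cube"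
  shows "hdist x z \<le> hdist x y + hdist y z"
proof -
  have "hdist x z \<le> (\<Sum>i. (1 / 2) ^ i * \<bar>x i - y i\<bar> + (1 / 2) ^ i * \<bar>y i - z i\<bar>)"
    unfolding hdist_def
  proof (rule suminf_le)
    show "(1 / 2) ^ i * \<bar>x i - z i\<bar> \<le> (1 / 2) ^ i * \<bar>x i - y i\<bar> + (1 / 2) ^ i * \<bar>y i - z i\<bar>" for i
      by (auto simp flip: distrib_left)
  qed (intro summable_add hdist_summable assms)+
  also have "\<dots> = hdist x y + hdist y z"
    unfolding hdist_def by (rule suminf_add[symmetric]) (auto intro!: hdist_summable assms)
  finally show ?thesis .
qed

lemma compact_hilbert_cube: "compact hilbert_cube"
proof -
  have "hilbert_cube = (\<Pi>\<^sub>E i\<in>UNIV. {0..1::real})"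
    by (auto simp: hilbert_cube_def PiE_def Pi_def)
  moreover have "compactin (product_topology (\<lambda>i::nat. euclidean) UNIV) (\<Pi>\<^sub>E i\<in>UNIV. {0..1::real})"
    by (simp add: compactin_PiE)
  ultimately show ?thesis
    by (simp add: euclidean_product_topology)
qed

lemma continuous_on_hdist:
  assumes "x \<in> hilbert_cube"
  shows "continuous_on hilbert_cube (hdist x)"
proof -
  have "uniform_limit hilbert_cube (\<lambda>n y. \<Sum>i<n. (1 / 2) ^ i * \<bar>x i - y i\<bar>)
          (\<lambda>y. \<Sum>i. (1 / 2) ^ i * \<bar>x i - y i\<bar>) sequentially"
    by (rule Weierstrass_m_test[where M = "\<lambda>i. (1/2)^i"])
      (use hdist_term_le[OF assms] in \<open>auto intro: summable_geometric\<close>)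
  moreover have "continuous_on hilbert_cube (\<lambda>y. \<Sum>i<n. (1 / 2) ^ i * \<bar>x i - y i\<bar>)" for n
    by (intro continuous_intros continuous_on_product_then_coordinatewise[of _ "\<lambda>y. y"])
  ultimately show ?thesis
    unfolding hdist_def by (intro uniform_limit_theorem) auto
qed

lemma openin_hilbert_cube_iff:
  "openin (top_of_set hilbert_cube) U \<longleftrightarrow>
     U \<subseteq> hilbert_cube \<and> (\<forall>x\<in>U. \<exists>r>0. hball x r \<subseteq> U)"
proof (intro iffI conjI ballI)
  assume U: "openin (top_of_set hilbert_cube) U"
  then show sub: "U \<subseteq> hilbert_cube" by (rule openin_imp_subset)
  fix x assume x: "x \<in> U"
  let ?C = "hilbert_cube - U"
  have "compact ?C"
    using U compact_hilbert_cube by (metis closedin_compact closedin_diff closedin_subtopology_refl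
        subset_UNIV topspace_euclidean)
  show "\<exists>r>0. hball x r \<subseteq> U"
  proof (cases "?C = {}")
    case True
    then show ?thesis by (intro exI[of _ 1]) (auto simp: hball_def)
  next
    case False
    have "continuous_on ?C (hdist x)"
      using continuous_on_hdist sub x by (meson Diff_subset continuous_on_subset subsetD)
    then obtain z where z: "z \<in> ?C" "\<And>y. y \<in> ?C \<Longrightarrow> hdist x z \<le> hdist x y"
      using continuous_attains_inf[OF \<open>compact ?C\<close> False] by blast
    have "hdist x z > 0"
      using hdist_nonneg[of x z] hdist_eq_0_iff[of x z] z x sub by (auto simp: less_le)
    moreover have "hball x (hdist x z) \<subseteq> U"
      using z(2) by (force simp: hball_def)
    ultimately show ?thesis by blast
  qed
next
  assume *: "U \<subseteq> hilbert_cube \<and> (\<forall>x\<in>U. \<exists>r>0. hball x r \<subseteq> U)"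
  have ball_open: "openin (top_of_set hilbert_cube) (hball x r)" if "x \<in> hilbert_cube" for x r
  proof -
    have "hball x r = hilbert_cube \<inter> hdist x -` {..<r}" by (auto simp: hball_def)
    then show ?thesis
      using continuous_openin_preimage_gen[OF continuous_on_hdist[OF that], of "{..<r}"] by simp
  qed
  show "openin (top_of_set hilbert_cube) U"
  proof (subst openin_subopen, intro ballI)
    fix x assume x: "x \<in> U"
    then obtain r where r: "r > 0" "hball x r \<subseteq> U" using * by blast
    have "x \<in> hball x r" using x * r hdist_eq_0_iff[of x x] by (auto simp: hball_def)
    then show "\<exists>T. openin (top_of_set hilbert_cube) T \<and> x \<in> T \<and> T \<subseteq> U"
      using ball_open x * r by blast
  qed
qed

end

theory Submission
  imports Defs "HOL-Library.Z2"
begin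

text \<open>
  The obstruction is a mod 2 cochain of Alexander--Spanier type, evaluated on tuples of points. For a
  maximal simplex \<open>T\<close>, a Sperner labelling of \<open>T\<close> gives the cochain that is \<open>1\<close> on the tuples in \<open>T\<close>
      carrying
  every label once. It is a cocycle on small tuples, it vanishes on small tuples that come near a point
  outside the interior of \<open>T\<close>, and by Sperner's lemma it is \<open>1\<close> on a fine subdivision of the sum of
  all maximal simplices of the dimension of \<open>T\<close>. The mod 2 boundary of this sum lies in the odd
  subcomplex, so the value does not change along a homotopy of the identity that keeps the odd
  subcomplex away from the interior of \<open>T\<close>. Hence the complex cannot be deformed off the interior of \<open>T\<close>.
  Everything happens at a positive scale, so neither the maps nor the homotopies need be continuous.

  A non-surjective map near the identity misses an interior point of some maximal simplex; projecting
  radially from that point would push the complex off the interior of this simplex. For a copy \<open>X'\<close> of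
  the complex in the Hilbert cube, a ball \<open>B\<close> meets \<open>X'\<close> if and only if, for some maximal simplex, such a
  push exists on \<open>X' - B\<close>. Up to a fixed finite precision a push is a finite cover of \<open>X' - B\<close> by
  labelled balls, and these covers can be enumerated.
\<close>

section \<open>Mod 2 cochains on tuples of points\<close>

text \<open>The embedding of K in the cube is an arbitrary homeomorphism onto \<open>X'\<close>, so
  neither points of \<open>X'\<close> nor values of a push can be computed from the available data,
  which are the finite covers of \<open>X'\<close> and \<open>A'\<close>. This shapes the proof. A
  finite family of labelled balls determines a map only after an arbitrary choice among the labels
  at each point, so the obstruction has to apply to maps controlled at one scale \<delta>; cochains
  on tuples of points can be evaluated on such maps. Coefficients mod 2 match the parity in the
  definition of the odd subcomplex and remove signs and orientations. All that depends on K and the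
  embedding (the scale, the labels, which labels are close, which balls a label must avoid) is
  finite and chosen by compactness before the ball is given; it is built into the enumeration, not
  computed. Both conclusions are derived from \<open>no_coarse_push\<close>: the surjection property
  applies it to a continuous composite, computable type to a map read off a cover.\<close>

declare add_bit_eq_xor [simp del] mult_bit_eq_and [simp del]

lemma bit_add_self [simp]: "b + b = (0::bit)" "b + (b + c) = (c::bit)"
  by (cases b; cases c; simp)+

text \<open>Chain operators are given through their duals, acting on cochains: the boundary, the prism operator
  of a pair of maps and, below, barycentric subdivision. The empty tuple counts as a \<open>(-1)\<close>-simplex.\<close>

fun cobd :: "('a list \<Rightarrow> bit) \<Rightarrow> 'a list \<Rightarrow> bit" where
  "cobd l [] = 0"
| "cobd l (x # xs) = l xs + cobd (\<lambda>ys. l (x # ys)) xs"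

fun prism :: "('a \<Rightarrow> 'b) \<Rightarrow> ('a \<Rightarrow> 'b) \<Rightarrow> ('b list \<Rightarrow> bit) \<Rightarrow> 'a list \<Rightarrow> bit" where
  "prism f g l [] = 0"
| "prism f g l (x # xs) = l (f x # g x # map g xs) + prism f g (\<lambda>ys. l (f x # ys)) xs"

lemma cobd_cong:
  assumes "\<And>\<sigma>. Suc (length \<sigma>) = length \<tau> \<Longrightarrow> set \<sigma> \<subseteq> set \<tau> \<Longrightarrow> l \<sigma> = l' \<sigma>"
  shows "cobd l \<tau> = cobd l' \<tau>"
  using assms
proof (induction \<tau> arbitrary: l l')
  case (Cons x xs)
  have "cobd (\<lambda>ys. l (x # ys)) xs = cobd (\<lambda>ys. l' (x # ys)) xs"
    by (rule Cons.IH, rule Cons.prems) auto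
  moreover have "l xs = l' xs" by (rule Cons.prems) auto
  ultimately show ?case by simp
qed simp

lemma cobd_add: "cobd (\<lambda>\<sigma>. l \<sigma> + l' \<sigma>) \<tau> = cobd l \<tau> + cobd l' \<tau>"
  by (induction \<tau> arbitrary: l l') (auto simp: algebra_simps)

lemma cobd_cobd: "cobd (cobd l) \<tau> = 0"
proof (induction \<tau> arbitrary: l)
  case (Cons x xs)
  then show ?case by (simp add: cobd_add)
qed simp

lemma cobd_map: "cobd l (map g \<tau>) = cobd (\<lambda>\<sigma>. l (map g \<sigma>)) \<tau>"
  by (induction \<tau> arbitrary: l) auto

lemma prism_add: "prism f g (\<lambda>\<sigma>. l \<sigma> + l' \<sigma>) \<tau> = prism f g l \<tau> + prism f g l' \<tau>"
  by (induction \<tau> arbitrary: l l') (auto simp: algebra_simps)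

text \<open>The chain homotopy identity over Z/2. The prism sums l over the tuples
  \<open>f x0, ..., f xi, g xi, ..., g xn\<close>; inner faces occur twice and cancel, and the two
  ends remain. The induction absorbs the leading entry \<open>f x\<close> into the cochain, which is
  why the cochain is generalized.\<close>

lemma prism_cobd:
  "prism f g (cobd l) \<tau> + cobd (prism f g l) \<tau> = l (map g \<tau>) + l (map f \<tau>)"
proof (induction \<tau> arbitrary: l)
  case (Cons x xs)
  have *: "cobd (\<lambda>ys. prism f g l (x # ys)) xs =
     cobd (\<lambda>\<sigma>. l (f x # g x # map g \<sigma>)) xs + cobd (prism f g (\<lambda>ys. l (f x # ys))) xs"
    by (simp add: cobd_add)
  show ?case
    using Cons[of "\<lambda>ys. l (f x # ys)"]
    by (simp add: cobd_add prism_add cobd_map * ac_simps)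
qed simp

lemma prism_cong:
  assumes "\<And>\<sigma>. length \<sigma> = Suc (length \<tau>) \<Longrightarrow> set \<sigma> \<subseteq> f ` set \<tau> \<union> g ` set \<tau> \<Longrightarrow> l \<sigma> = l' \<sigma>"
  shows "prism f g l \<tau> = prism f g l' \<tau>"
  using assms
proof (induction \<tau> arbitrary: l l')
  case (Cons x xs)
  have "prism f g (\<lambda>ys. l (f x # ys)) xs = prism f g (\<lambda>ys. l' (f x # ys)) xs"
    by (rule Cons.IH, rule Cons.prems) auto
  moreover have "l (f x # g x # map g xs) = l' (f x # g x # map g xs)" by (rule Cons.prems) auto
  ultimately show ?case by simp
qed simp

lemma cobd_zero [simp]: "cobd (\<lambda>_. 0) \<tau> = 0" by (induction \<tau>) auto
lemma prism_zero [simp]: "prism f g (\<lambda>_. 0) \<tau> = 0" by (induction \<tau>) auto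

section \<open>Barycentric subdivision on cochains\<close>

definition barycentre :: "'a::real_vector list \<Rightarrow> 'a" where
  "barycentre \<tau> = (1 / real (length \<tau>)) *\<^sub>R sum_list \<tau>"

text \<open>Dual to coning off the subdivided boundary from the barycentre; \<open>n\<close> is the length of the tuple.\<close>

primrec subdiv :: "nat \<Rightarrow> ('a::real_vector list \<Rightarrow> bit) \<Rightarrow> 'a list \<Rightarrow> bit" where
  "subdiv 0 l \<tau> = l \<tau>"
| "subdiv (Suc n) l \<tau> = cobd (subdiv n (\<lambda>\<sigma>. l (barycentre \<tau> # \<sigma>))) \<tau>"

lemma subdiv_add: "subdiv n (\<lambda>\<sigma>. l \<sigma> + l' \<sigma>) = (\<lambda>\<tau>. subdiv n l \<tau> + subdiv n l' \<tau>)"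
proof (induction n arbitrary: l l')
  case (Suc n)
  show ?case by (rule ext) (simp add: Suc cobd_add)
qed (simp add: fun_eq_iff)

lemma subdiv_zero [simp]: "subdiv n (\<lambda>_. 0) = (\<lambda>_. 0)"
proof (induction n)
  case (Suc n)
  show ?case by (rule ext) (simp add: Suc)
qed simp

text \<open>Expanding the coboundary at the apex of the cone leaves l on the opposite face plus a
  coboundary term; by induction the latter becomes \<open>cobd (cobd _)\<close> and
  vanishes.\<close>

lemma subdiv_cobd:
  assumes "length \<tau> = Suc n"
  shows "subdiv (Suc n) (cobd l) \<tau> = cobd (subdiv n l) \<tau>"
  using assms
proof (induction n arbitrary: l \<tau>)
  case 0
  have "cobd (subdiv 0 (\<lambda>\<sigma>. cobd l (barycentre \<tau> # \<sigma>))) \<tau> = cobd (subdiv 0 l) \<tau>"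
    by (rule cobd_cong) (use 0 in auto)
  then show ?case by (simp only: subdiv.simps(2))
next
  case (Suc n)
  let ?l = "\<lambda>ys. l (barycentre \<tau> # ys)"
  have "subdiv (Suc (Suc n)) (cobd l) \<tau> = cobd (subdiv (Suc n) l) \<tau> + cobd (subdiv (Suc n) (cobd ?l)) \<tau>"
    unfolding subdiv.simps(2)[of "Suc n" "cobd l"] cobd.simps(2) subdiv_add cobd_add ..
  also have "cobd (subdiv (Suc n) (cobd ?l)) \<tau> = cobd (cobd (subdiv n ?l)) \<tau>"
    by (rule cobd_cong, rule Suc.IH) (use Suc.prems in auto)
  finally show ?case by (simp only: cobd_cobd add_0_right)
qed

definition small :: "real \<Rightarrow> 'a::metric_space set \<Rightarrow> bool" where
  "small D S \<longleftrightarrow> (\<forall>x\<in>S. \<forall>y\<in>S. dist x y \<le> D)"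

lemma barycentre_mem:
  assumes "\<tau> \<noteq> []"
  shows "barycentre \<tau> \<in> convex hull (set \<tau>)"
proof -
  have "(\<Sum>i\<in>{..<length \<tau>}. (1 / real (length \<tau>)) *\<^sub>R (\<tau> ! i)) \<in> convex hull (set \<tau>)"
    by (rule convex_sum) (use assms in \<open>auto simp: hull_inc\<close>)
  then show ?thesis
    by (simp add: barycentre_def sum_list_sum_nth scaleR_sum_right atLeast0LessThan)
qed

text \<open>The classical contraction factor of barycentric subdivision. It is stated with an upper
  bound N on the length so that one factor serves a simplex and all of its faces.\<close>

lemma barycentre_dist:
  fixes \<tau> :: "'a::real_normed_vector list"
  assumes "small D (set \<tau>)" "length \<tau> \<le> N" "x \<in> convex hull (set \<tau>)"
  shows "dist (barycentre \<tau>) x \<le> (1 - 1 / real N) * D"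
proof -
  have ne: "\<tau> \<noteq> []" using assms(3) by auto
  let ?n = "length \<tau>"
  have D: "D \<ge> 0" using assms(1) ne unfolding small_def
    by (metis dist_self last_in_set)
  have "set \<tau> \<subseteq> cball (barycentre \<tau>) ((1 - 1 / real N) * D)"
  proof
    fix y assume y: "y \<in> set \<tau>"
    then obtain j where j: "j < ?n" "\<tau> ! j = y" by (auto simp: in_set_conv_nth)
    have "real ?n *\<^sub>R (barycentre \<tau> - y) = (\<Sum>i<?n. (\<tau> ! i - y))"
      using ne by (simp add: barycentre_def sum_list_sum_nth atLeast0LessThan sum_subtractf
          algebra_simps sum_constant_scaleR)
    \<comment> \<open>The summand at j is zero, so only n - 1 of the n differences contribute; this
      is the origin of 1 - 1/n.\<close>
    also have "\<dots> = (\<Sum>i\<in>{..<?n}-{j}. (\<tau> ! i - y))"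
      by (rule sum.mono_neutral_right) (use j in auto)
    finally have "real ?n * norm (barycentre \<tau> - y) = norm (\<Sum>i\<in>{..<?n}-{j}. (\<tau> ! i - y))"
      by (metis abs_of_nat norm_scaleR)
    also have "\<dots> \<le> (\<Sum>i\<in>{..<?n}-{j}. D)"
      by (rule order_trans[OF norm_sum], rule sum_mono)
        (use assms(1) y in \<open>auto simp: small_def dist_norm\<close>)
    also have "\<dots> = (real ?n - 1) * D" using j by (simp add: of_nat_diff)
    finally have "norm (barycentre \<tau> - y) \<le> (1 - 1 / real ?n) * D"
      using ne by (simp add: field_simps)
    also have "\<dots> \<le> (1 - 1 / real N) * D"
      using assms(2) ne D by (intro mult_right_mono) (auto simp: frac_le)
    finally show "y \<in> cball (barycentre \<tau>) ((1 - 1 / real N) * D)" by (simp add: dist_norm)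
  qed
  then have "convex hull (set \<tau>) \<subseteq> cball (barycentre \<tau>) ((1 - 1 / real N) * D)"
    by (rule hull_minimal) auto
  then show ?thesis using assms(3) by auto
qed

text \<open>Justifies working with cochains that are controlled on small tuples only: after enough
  subdivisions no other tuple is evaluated. Adding the barycentre of a tuple to a subdivided face
  keeps the result small by \<open>barycentre_dist\<close>.\<close>

lemma subdiv_cong:
  fixes \<tau> :: "'a::real_normed_vector list"
  assumes "length \<tau> = n" "small D (set \<tau>)" "n \<le> N"
    and "\<And>\<sigma>. length \<sigma> = n \<Longrightarrow> set \<sigma> \<subseteq> convex hull (set \<tau>) \<Longrightarrow> small ((1 - 1 / real N) * D) (set \<sigma>) \<Longrightarrow> l \<sigma>
        = l' \<sigma>"
  shows "subdiv n l \<tau> = subdiv n l' \<tau>"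
  using assms
proof (induction n arbitrary: \<tau> l l')
  case 0
  then show ?case by (auto simp: small_def)
next
  case (Suc n)
  have ne: "\<tau> \<noteq> []" using Suc.prems by auto
  have "cobd (subdiv n (\<lambda>\<sigma>. l (barycentre \<tau> # \<sigma>))) \<tau> = cobd (subdiv n (\<lambda>\<sigma>. l' (barycentre \<tau> # \<sigma>))) \<tau>"
  proof (rule cobd_cong)
    fix \<rho> :: "'a list" assume r: "Suc (length \<rho>) = length \<tau>" "set \<rho> \<subseteq> set \<tau>"
    show "subdiv n (\<lambda>\<sigma>. l (barycentre \<tau> # \<sigma>)) \<rho> = subdiv n (\<lambda>\<sigma>. l' (barycentre \<tau> # \<sigma>)) \<rho>"
    proof (rule Suc.IH)
      show "length \<rho> = n" "n \<le> N" using r Suc.prems by auto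
      show "small D (set \<rho>)" using r Suc.prems(2) by (auto simp: small_def)
      fix \<sigma> :: "'a list" assume s: "length \<sigma> = n" "set \<sigma> \<subseteq> convex hull set \<rho>"
        "small ((1 - 1 / real N) * D) (set \<sigma>)"
      have s2: "set \<sigma> \<subseteq> convex hull set \<tau>" using s(2) r(2) by (meson hull_mono order_trans)
      have d: "dist (barycentre \<tau>) x \<le> (1 - 1 / real N) * D" if "x \<in> convex hull (set \<tau>)" for x
        using barycentre_dist Suc.prems that by metis
      show "l (barycentre \<tau> # \<sigma>) = l' (barycentre \<tau> # \<sigma>)"
      proof (rule Suc.prems)
        show "small ((1 - 1 / real N) * D) (set (barycentre \<tau> # \<sigma>))"
          using s(3) d s2 d[OF barycentre_mem[OF ne]] by (auto simp: small_def dist_commute)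
      qed (use s s2 barycentre_mem[OF ne] in auto)
    qed
  qed
  then show ?case by simp
qed

lemma subdiv_iter_cong:
  fixes \<tau> :: "'a::real_normed_vector list"
  assumes "length \<tau> = n" "small D (set \<tau>)" "n \<le> N"
    and "\<And>\<sigma>. length \<sigma> = n \<Longrightarrow> set \<sigma> \<subseteq> convex hull (set \<tau>) \<Longrightarrow> small ((1 - 1 / real N) ^ s * D) (set \<sigma>) \<Longrightarrow>
        l \<sigma> = l' \<sigma>"
  shows "(subdiv n ^^ s) l \<tau> = (subdiv n ^^ s) l' \<tau>"
  using assms
proof (induction s arbitrary: \<tau> D)
  case (Suc s)
  have "subdiv n ((subdiv n ^^ s) l) \<tau> = subdiv n ((subdiv n ^^ s) l') \<tau>"
  proof (rule subdiv_cong[OF Suc.prems(1-3)])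
    fix \<rho> :: "'a list"
    assume r: "length \<rho> = n" "set \<rho> \<subseteq> convex hull (set \<tau>)" "small ((1 - 1 / real N) * D) (set \<rho>)"
    show "(subdiv n ^^ s) l \<rho> = (subdiv n ^^ s) l' \<rho>"
    proof (rule Suc.IH[OF r(1) r(3) Suc.prems(3)])
      fix \<sigma> :: "'a list"
      assume s: "length \<sigma> = n" "set \<sigma> \<subseteq> convex hull (set \<rho>)" "small ((1 - 1 / real N)^s * ((1 - 1 /
          real N) * D)) (set \<sigma>)"
      show "l \<sigma> = l' \<sigma>"
      proof (rule Suc.prems(4))
        show "set \<sigma> \<subseteq> convex hull set \<tau>"
          using s(2) r(2) by (metis hull_minimal convex_convex_hull order_trans)
      qed (use s in \<open>auto simp: ac_simps\<close>)
    qed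
  qed
  then show ?case by simp
next
  case 0
  then show ?case by (auto simp: hull_subset)
qed

lemma subdiv_iter_cobd:
  fixes \<tau> :: "'a::real_normed_vector list"
  assumes "length \<tau> = Suc n"
  shows "(subdiv (Suc n) ^^ s) (cobd l) \<tau> = cobd ((subdiv n ^^ s) l) \<tau>"
  using assms
proof (induction s arbitrary: \<tau>)
  case (Suc s)
  \<comment> \<open>The congruence serves here to restrict the induction hypothesis to tuples of the
    right length, so any bound D will do.\<close>
  obtain D where D: "small D (set \<tau>)"
    using bounded_two_points[of "set \<tau>"] finite_imp_bounded[of "set \<tau>"] by (auto simp: small_def)
  have "subdiv (Suc n) ((subdiv (Suc n) ^^ s) (cobd l)) \<tau> = subdiv (Suc n) (cobd ((subdiv n ^^ s) l)) \<tau>"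
    by (rule subdiv_cong[OF Suc.prems D order_refl], rule Suc.IH)
  then show ?case using subdiv_cobd[OF Suc.prems] by (simp only: funpow.simps comp_apply)
qed simp

lemma subdiv_iter_add: "(subdiv n ^^ s) (\<lambda>\<sigma>. l \<sigma> + l' \<sigma>) = (\<lambda>\<tau>. (subdiv n ^^ s) l \<tau> + (subdiv n ^^
    s) l' \<tau>)"
  by (induction s) (simp_all add: subdiv_add)

lemma subdiv_iter_zero: "(subdiv n ^^ s) (\<lambda>_. 0) = (\<lambda>\<tau>. 0)"
  by (induction s) simp_all

section \<open>Sperner's lemma mod 2\<close>

definition full :: "'a set \<Rightarrow> 'a list \<Rightarrow> bit" where
  "full W l = of_bool (distinct l \<and> set l = W)"

text \<open>The door-counting argument: if l lists W with one entry repeated, the two deletions of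
  that entry both leave a full tuple and cancel mod 2. A tuple with one entry outside W has exactly
  one door.\<close>

lemma cobd_full:
  "cobd (full W) l = of_bool (distinct l \<and> (\<exists>y. y \<notin> W \<and> set l = insert y W))"
proof (induction l arbitrary: W)
  case (Cons x xs)
  have "(\<lambda>ys. full W (x # ys)) = (if x \<in> W then full (W - {x}) else (\<lambda>_. 0))"
    by (auto simp: full_def fun_eq_iff)
  then have *: "cobd (full W) (x # xs) = full W xs +
      (if x \<in> W then of_bool (distinct xs \<and> (\<exists>y. y \<notin> W - {x} \<and> set xs = insert y (W - {x}))) else 0)"
    using Cons[of "W - {x}"] by simp
  show ?case
  proof (cases "x \<in> W")
    case False
    have "distinct (x # xs) \<and> (\<exists>y. y \<notin> W \<and> set (x # xs) = insert y W) \<longleftrightarrow> distinct xs \<and> set xs = W"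
      using False by (auto simp: insert_ident) (metis insertE insertI1 insert_ident)+
    then show ?thesis using False unfolding * unfolding full_def by simp
  next
    case True
    \<comment> \<open>The additional entry y is either x or outside W. The case y = x is the
      repetition, whose contribution cancels against \<open>full W xs\<close>.\<close>
    have 1: "(\<exists>y. y \<notin> W - {x} \<and> set xs = insert y (W - {x})) \<longleftrightarrow>
      set xs = W \<or> (\<exists>y. y \<notin> W \<and> set xs = insert y (W - {x}))"
      using True by (metis Diff_iff insertCI insert_Diff singletonD)
    have 2: "distinct (x # xs) \<and> (\<exists>y. y \<notin> W \<and> set (x # xs) = insert y W) \<longleftrightarrow>
       distinct xs \<and> (\<exists>y. y \<notin> W \<and> set xs = insert y (W - {x}))" (is "?L \<longleftrightarrow> ?R")
    proof
      assume ?L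
      then obtain y where y: "distinct (x # xs)" "y \<notin> W" "set (x # xs) = insert y W" by blast
      then have "set xs = insert y (W - {x})" using True by auto
      then show ?R using y by auto
    next
      assume ?R
      then obtain y where y: "distinct xs" "y \<notin> W" "set xs = insert y (W - {x})" by blast
      then have "x \<notin> set xs" "set (x # xs) = insert y W" using True by auto
      then show ?L using y by auto
    qed
    have 3: "\<not> (set xs = W \<and> (\<exists>y. y \<notin> W \<and> set xs = insert y (W - {x})))"
      by auto
    show ?thesis using True 3 unfolding * 1 2 unfolding full_def by auto
  qed
qed auto

lemma small_mono: "small r S \<Longrightarrow> r \<le> r' \<Longrightarrow> S' \<subseteq> S \<Longrightarrow> small r' S'"
  unfolding small_def by (meson order_trans subsetD)

lemma small_exists:
  assumes "finite S" obtains D where "small D S"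
  using bounded_two_points[of S] finite_imp_bounded[OF assms] by (auto simp: small_def)

lemma subdiv_iter_cong_hull:
  fixes \<tau> :: "'a::real_normed_vector list"
  assumes "length \<tau> = n"
    and "\<And>\<sigma>. length \<sigma> = n \<Longrightarrow> set \<sigma> \<subseteq> convex hull (set \<tau>) \<Longrightarrow> l \<sigma> = l' \<sigma>"
  shows "(subdiv n ^^ s) l \<tau> = (subdiv n ^^ s) l' \<tau>"
proof -
  obtain D where "small D (set \<tau>)" using small_exists[of "set \<tau>"] by auto
  then show ?thesis using subdiv_iter_cong[OF assms(1) _ order_refl] assms(2) by blast
qed

lemma subdiv_iter_nil: "(subdiv 0 ^^ s) l = l"
  by (induction s) (auto simp: fun_eq_iff)

text \<open>On tuples in the hull of \<open>x # \<tau>\<close> the only label beyond those of \<tau>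
  is x, so fullness for \<open>x # \<tau>\<close> is the coboundary of fullness for \<tau>.
  Commuting this with subdivision moves the count to the facets: \<tau> contributes 1 by induction,
  and a facet through x lacks a label of \<tau>. The empty tuple starts the induction with value
  1.\<close>

lemma sperner:
  fixes V :: "'a::real_normed_vector set"
  assumes proper: "\<And>c z. c \<subseteq> V \<Longrightarrow> z \<in> convex hull c \<Longrightarrow> lab z \<in> c"
    and "distinct \<tau>" "set \<tau> \<subseteq> V"
  shows "(subdiv (length \<tau>) ^^ s) (\<lambda>\<sigma>. full (set \<tau>) (map lab \<sigma>)) \<tau> = 1"
  using assms(2,3)
proof (induction \<tau>)
  case Nil
  show ?case by (simp only: list.size subdiv_iter_nil) (simp add: full_def)
next
  case (Cons x \<tau>)
  let ?n = "length \<tau>"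
  let ?f = "\<lambda>\<sigma>. full (set \<tau>) (map lab \<sigma>)"
  have lab: "set (map lab \<sigma>) \<subseteq> c" if "set \<sigma> \<subseteq> convex hull c" "c \<subseteq> V" for \<sigma> c
    using that proper by auto
  have "(subdiv (Suc ?n) ^^ s) (\<lambda>\<sigma>. full (set (x # \<tau>)) (map lab \<sigma>)) (x # \<tau>) =
        (subdiv (Suc ?n) ^^ s) (cobd ?f) (x # \<tau>)"
  proof (rule subdiv_iter_cong_hull)
    fix \<sigma> assume s: "set \<sigma> \<subseteq> convex hull set (x # \<tau>)"
    have "set (map lab \<sigma>) \<subseteq> set (x # \<tau>)" by (rule lab[OF s]) (use Cons.prems in auto)
    then have "(\<exists>y. y \<notin> set \<tau> \<and> set (map lab \<sigma>) = insert y (set \<tau>)) \<longleftrightarrow> set (map lab \<sigma>) = set (x # \<tau>)"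
      using Cons.prems by (metis distinct.simps(2) insertE insertI1 list.simps(15) subsetD)
    then show "full (set (x # \<tau>)) (map lab \<sigma>) = cobd ?f \<sigma>"
      by (simp add: cobd_map[symmetric] cobd_full) (simp add: full_def)
  qed simp
  also have "\<dots> = cobd ((subdiv ?n ^^ s) ?f) (x # \<tau>)"
    by (rule subdiv_iter_cobd) simp
  also have "\<dots> = (subdiv ?n ^^ s) ?f \<tau> + cobd (\<lambda>ys. (subdiv ?n ^^ s) ?f (x # ys)) \<tau>"
    by simp
  also have "cobd (\<lambda>ys. (subdiv ?n ^^ s) ?f (x # ys)) \<tau> = cobd (\<lambda>_. 0) \<tau>"
  proof (rule cobd_cong)
    fix ys assume ys: "Suc (length ys) = length \<tau>" "set ys \<subseteq> set \<tau>"
    have "card (set ys) < card (set \<tau>)"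
      using ys card_length[of ys] Cons.prems by (simp add: distinct_card)
    then obtain y where y: "y \<in> set \<tau>" "y \<notin> set ys" using ys by (metis less_irrefl subsetI
        subset_antisym)
    have "(subdiv ?n ^^ s) ?f (x # ys) = (subdiv ?n ^^ s) (\<lambda>_. 0) (x # ys)"
    proof (rule subdiv_iter_cong_hull)
      fix \<sigma> assume s: "set \<sigma> \<subseteq> convex hull set (x # ys)"
      have "set (map lab \<sigma>) \<subseteq> set (x # ys)" by (rule lab[OF s]) (use Cons.prems ys in auto)
      then show "?f \<sigma> = 0" using y Cons.prems by (auto simp: full_def)
    qed (use ys in simp)
    then show "(subdiv ?n ^^ s) ?f (x # ys) = 0" by (simp add: subdiv_iter_zero)
  qed
  also have "(subdiv ?n ^^ s) ?f \<tau> = 1" using Cons by simp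
  finally show ?case by simp
qed

section \<open>Boundaries of sums of simplices\<close>

lemma cobd_filter:
  assumes "distinct vs" "U \<subseteq> set vs"
  shows "cobd l (filter (\<lambda>v. v \<in> U) vs) = (\<Sum>v\<in>U. l (filter (\<lambda>w. w \<in> U - {v}) vs))"
proof -
  have "cobd l (filter (\<lambda>v. v \<in> U) vs) = (\<Sum>v\<in>U \<inter> set vs. l (filter (\<lambda>w. w \<in> U - {v}) vs))"
    using assms(1)
  proof (induction vs arbitrary: l)
    case (Cons x vs)
    show ?case
    proof (cases "x \<in> U")
      case True
      have 1: "filter (\<lambda>w. w \<in> U - {x}) (x # vs) = filter (\<lambda>w. w \<in> U) vs"
        using Cons.prems by (auto intro!: filter_cong)
      have 2: "(\<Sum>v\<in>U \<inter> set vs. l (filter (\<lambda>w. w \<in> U - {v}) (x # vs))) =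
            (\<Sum>v\<in>U \<inter> set vs. l (x # filter (\<lambda>w. w \<in> U - {v}) vs))"
        using True Cons.prems by (auto intro!: sum.cong)
      have 3: "U \<inter> set (x # vs) = insert x (U \<inter> set vs)" "x \<notin> U \<inter> set vs"
        using True Cons.prems by auto
      show ?thesis
        unfolding 3(1) sum.insert[OF finite_Int[OF disjI2[OF finite_set]] 3(2)] 1 2
        using True Cons by simp
    next
      case False
      then show ?thesis using Cons by (auto intro!: sum.cong)
    qed
  qed simp
  then show ?thesis using assms(2) by (simp add: Int_absorb2)
qed

text \<open>Exchanging the sums over simplices and faces produces incidence numbers. All vertex
  tuples are sublists of one list vs, so a common face is literally the same tuple in each simplex
  that contains it.\<close>

lemma sum_cobd_filter:
  assumes "distinct vs" "finite \<F>" "\<And>U. U \<in> \<F> \<Longrightarrow> U \<subseteq> set vs \<and> card U = Suc k"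
  shows "(\<Sum>U\<in>\<F>. cobd l (filter (\<lambda>v. v \<in> U) vs)) =
    (\<Sum>U' | U' \<subseteq> set vs \<and> card U' = k. of_nat (card {U \<in> \<F>. U' \<subseteq> U}) * l (filter (\<lambda>v. v \<in> U') vs))"
proof -
  define P where "P = {U'. U' \<subseteq> set vs \<and> card U' = k}"
  have fP: "finite P" unfolding P_def by simp
  have 1: "cobd l (filter (\<lambda>v. v \<in> U) vs) = (\<Sum>U'\<in>P. of_bool (U' \<subseteq> U) * l (filter (\<lambda>v. v \<in> U') vs))"
    if U: "U \<in> \<F>" for U
  proof -
    have fU: "finite U" "U \<subseteq> set vs" "card U = Suc k"
      using assms(3)[OF U] by (auto intro: finite_subset)
    have im: "(\<lambda>v. U - {v}) ` U = {U'\<in>P. U' \<subseteq> U}"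
    proof (intro equalityI subsetI)
      fix U' assume "U' \<in> {U'\<in>P. U' \<subseteq> U}"
      then have U': "U' \<subseteq> U" "card U' = k" by (auto simp: P_def)
      then have "card (U - U') = 1" using fU by (simp add: card_Diff_subset finite_subset)
      then obtain v where "U - U' = {v}" by (auto simp: card_1_singleton_iff)
      then have "U' = U - {v}" "v \<in> U" using U' by auto
      then show "U' \<in> (\<lambda>v. U - {v}) ` U" by blast
    qed (use fU in \<open>auto simp: P_def\<close>)
    have "cobd l (filter (\<lambda>v. v \<in> U) vs) = (\<Sum>v\<in>U. l (filter (\<lambda>w. w \<in> U - {v}) vs))"
      by (rule cobd_filter[OF assms(1) fU(2)])
    also have "\<dots> = (\<Sum>U'\<in>(\<lambda>v. U - {v}) ` U. l (filter (\<lambda>w. w \<in> U') vs))"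
      by (subst sum.reindex) (auto simp: inj_on_def)
    also have "\<dots> = (\<Sum>U'\<in>P. of_bool (U' \<subseteq> U) * l (filter (\<lambda>v. v \<in> U') vs))"
      unfolding im by (rule sum.mono_neutral_cong_left) (use fP in auto)
    finally show ?thesis .
  qed
  have "(\<Sum>U\<in>\<F>. cobd l (filter (\<lambda>v. v \<in> U) vs)) =
      (\<Sum>U\<in>\<F>. \<Sum>U'\<in>P. of_bool (U' \<subseteq> U) * l (filter (\<lambda>v. v \<in> U') vs))"
    by (rule sum.cong) (use 1 in auto)
  also have "\<dots> = (\<Sum>U'\<in>P. (\<Sum>U\<in>\<F>. of_bool (U' \<subseteq> U)) * l (filter (\<lambda>v. v \<in> U') vs))"
    by (subst sum.swap) (simp add: sum_distrib_right)
  also have "\<dots> = (\<Sum>U'\<in>P. of_nat (card {U \<in> \<F>. U' \<subseteq> U}) * l (filter (\<lambda>v. v \<in> U') vs))"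
    using assms(2) by (intro sum.cong) (auto simp: sum.If_cases of_bool_def Int_def)
  finally show ?thesis unfolding P_def .
qed

section \<open>The mod 2 boundary of the sum of the maximal simplices\<close>

definition verts :: "'a::euclidean_space set \<Rightarrow> 'a set" where
  "verts S = {x. x extreme_point_of S}"

lemma simplex_verts:
  assumes "n simplex S"
  shows "\<not> affine_dependent (verts S)" "int (card (verts S)) = n + 1" "S = convex hull (verts S)"
    "finite (verts S)"
proof -
  obtain C where C: "\<not> affine_dependent C" "int (card C) = n + 1" "S = convex hull C"
    using assms by (auto simp: simplex_def)
  have "verts S = C"
    using C extreme_point_of_convex_hull_affine_independent[OF C(1)] by (auto simp: verts_def)
  then show "\<not> affine_dependent (verts S)" "int (card (verts S)) = n + 1" "S = convex hull (verts S)"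
    "finite (verts S)"
    using C aff_independent_finite by auto
qed

lemma verts_convex_hull: "\<not> affine_dependent C \<Longrightarrow> verts (convex hull C) = C"
  using extreme_point_of_convex_hull_affine_independent by (auto simp: verts_def)

context
  fixes K :: "'a::euclidean_space set set"
  assumes K: "simplicial_complex K"
begin

lemma complex_finite: "finite K" using K by (simp add: simplicial_complex_def)

lemma complex_simplex: "S \<in> K \<Longrightarrow> \<exists>n. n simplex S" using K by (simp add: simplicial_complex_def)

lemma complex_face: "S \<in> K \<Longrightarrow> F face_of S \<Longrightarrow> F \<in> K"
  using K unfolding simplicial_complex_def by blast

lemma complex_Int: "S \<in> K \<Longrightarrow> S' \<in> K \<Longrightarrow> (S \<inter> S') face_of S"
  using K by (simp add: simplicial_complex_def)

lemma complex_subset_face: "S \<in> K \<Longrightarrow> S' \<in> K \<Longrightarrow> S \<subseteq> S' \<Longrightarrow> S face_of S'"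
  using complex_Int[of S' S] by (simp add: Int_absorb1)

lemma complex_verts:
  assumes "S \<in> K"
  shows "\<not> affine_dependent (verts S)" "S = convex hull (verts S)" "finite (verts S)"
    "(int (card (verts S)) - 1) simplex S"
  using complex_simplex[OF assms] simplex_verts[of _ S] by auto

lemma complex_simplex_iff: "S \<in> K \<Longrightarrow> n simplex S \<longleftrightarrow> n = int (card (verts S)) - 1"
  using complex_verts(4) simplex_verts(2) by fastforce

lemma complex_face_iff:
  assumes "S \<in> K" shows "F face_of S \<longleftrightarrow> (\<exists>c\<subseteq>verts S. F = convex hull c)"
  using face_of_convex_hull_affine_independent[OF complex_verts(1)[OF assms], of F]
    complex_verts(2)[OF assms] by auto

lemma complex_subset_iff:
  assumes "S \<in> K" "S' \<in> K" shows "S \<subseteq> S' \<longleftrightarrow> verts S \<subseteq> verts S'"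
proof
  assume "S \<subseteq> S'"
  then obtain c where c: "c \<subseteq> verts S'" "S = convex hull c"
    using complex_subset_face assms complex_face_iff by metis
  then have "verts S = c"
    using verts_convex_hull affine_dependent_subset complex_verts(1)[OF assms(2)] by metis
  then show "verts S \<subseteq> verts S'" using c by simp
next
  assume "verts S \<subseteq> verts S'"
  then show "S \<subseteq> S'" using complex_verts(2) assms hull_mono by metis
qed

lemma complex_compact: "S \<in> K \<Longrightarrow> compact S"
  using complex_simplex compact_simplex by blast

lemma complex_convex: "S \<in> K \<Longrightarrow> convex S"
  using complex_simplex convex_simplex by blast

lemma compact_Union_subset: "L \<subseteq> K \<Longrightarrow> compact (\<Union>L)"
  using complex_finite complex_compact by (intro compact_Union) (auto intro: finite_subset)

lemma maximal_simplex_eq: "maximal_simplex K T \<Longrightarrow> S \<in> K \<Longrightarrow> T \<subseteq> S \<Longrightarrow> S = T"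
  using complex_subset_face unfolding maximal_simplex_def by metis

text \<open>The proper face \<open>T \<inter> S\<close> omits a vertex i. In this form the fact
  combines with a labelling of T: points of S in T never get label i.\<close>

lemma maximal_Int:
  assumes T: "maximal_simplex K T" and S: "S \<in> K" "S \<noteq> T"
  obtains i where "i \<in> verts T" "S \<inter> T \<subseteq> convex hull (verts T - {i})"
proof -
  have TK: "T \<in> K" using T by (simp add: maximal_simplex_def)
  obtain c where c: "c \<subseteq> verts T" "T \<inter> S = convex hull c"
    using complex_Int[OF TK S(1)] complex_face_iff[OF TK] by auto
  have "c \<noteq> verts T"
    using c complex_verts(2)[OF TK] maximal_simplex_eq[OF T S(1)] S(2) by auto
  then obtain i where "i \<in> verts T" "c \<subseteq> verts T - {i}" using c(1) by auto
  then show thesis using that c(2) hull_mono by (metis Int_commute)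
qed

lemma odd_subcomplex_subset: "F \<in> odd_subcomplex K \<Longrightarrow> F \<in> K"
  using complex_face by (auto simp: odd_subcomplex_def odd_n_subcomplex_def odd_simplices_def)

text \<open>An odd simplex lies in a maximal simplex of one dimension more. A maximal face of it
  would have to equal both, which their dimensions forbid. Consequently the odd subcomplex avoids
  the interior of every maximal simplex.\<close>

lemma odd_subcomplex_not_maximal:
  assumes "F \<in> odd_subcomplex K" shows "\<not> maximal_simplex K F"
proof
  assume mF: "maximal_simplex K F"
  obtain n S where S: "S \<in> odd_simplices n K" "F face_of S"
    using assms by (auto simp: odd_subcomplex_def odd_n_subcomplex_def)
  then have "F = S" using mF by (auto simp: maximal_simplex_def odd_simplices_def)
  have "{T. maximal_simplex K T \<and> (n + 1) simplex T \<and> S \<subseteq> T} \<noteq> {}"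
  proof
    assume e: "{T. maximal_simplex K T \<and> (n + 1) simplex T \<and> S \<subseteq> T} = {}"
    have "odd (card {T. maximal_simplex K T \<and> (n + 1) simplex T \<and> S \<subseteq> T})"
      using S(1) by (simp add: odd_simplices_def)
    then show False unfolding e by simp
  qed
  then obtain T where T: "maximal_simplex K T" "(n + 1) simplex T" "S \<subseteq> T" by auto
  then have "T = S"
    using maximal_simplex_eq[OF mF] \<open>F = S\<close> by (auto simp: maximal_simplex_def)
  then have "n simplex T" using S(1) by (simp add: odd_simplices_def)
  then show False using T(2) simplex_verts(2)[of n T] simplex_verts(2)[of "n + 1" T] by simp
qed

text \<open>Translates the parity condition from dimensions and inclusions to vertex sets, where
  \<open>sum_cobd_filter\<close> counts. The bound by \<open>complex_dim\<close> comes from any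
  simplex counted: an odd count is not zero.\<close>

lemma odd_n_mem:
  assumes F: "F \<in> K" "F \<noteq> {}"
    and odd: "odd (card {M. maximal_simplex K M \<and> card (verts M) = Suc (card (verts F)) \<and> verts F \<subseteq>
        verts M})"
  shows "F \<in> odd_subcomplex K"
proof -
  let ?n = "int (card (verts F)) - 1"
  have "{T. maximal_simplex K T \<and> (?n + 1) simplex T \<and> F \<subseteq> T} =
      {M. maximal_simplex K M \<and> card (verts M) = Suc (card (verts F)) \<and> verts F \<subseteq> verts M}"
    using complex_simplex_iff complex_subset_iff[OF F(1)] by (auto simp: maximal_simplex_def)
  then have Fo: "F \<in> odd_simplices ?n K"
    using F odd complex_verts(4)[OF F(1)] by (simp add: odd_simplices_def)
  have "verts F \<noteq> {}" using complex_verts(2)[OF F(1)] F(2) by auto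
  then have "?n \<ge> 0" using complex_verts(3)[OF F(1)]
    by (simp add: Suc_leI card_gt_0_iff)
  moreover have "?n < complex_dim K"
  proof -
    have "{M. maximal_simplex K M \<and> card (verts M) = Suc (card (verts F)) \<and> verts F \<subseteq> verts M} \<noteq> {}"
      using odd by (metis card.empty even_zero)
    then obtain M where M: "M \<in> K" "card (verts M) = Suc (card (verts F))"
      by (auto simp: maximal_simplex_def)
    have "aff_dim M = ?n + 1"
      using aff_dim_simplex[OF complex_verts(4)[OF M(1)]] M(2) by simp
    moreover have "aff_dim M \<le> complex_dim K"
      unfolding complex_dim_def using M(1) complex_finite by (intro Max_ge) auto
    ultimately show ?thesis by simp
  qed
  moreover have "F face_of F" using complex_convex[OF F(1)] by (simp add: face_of_refl)
  ultimately show ?thesis using Fo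
    unfolding odd_subcomplex_def odd_n_subcomplex_def by (auto intro!: bexI[of _ ?n])
qed

text \<open>Once subdivision is commuted with the coboundary, each face is weighted by the number of
  maximal simplices of the given dimension containing it. Even weights are 0 in \<open>bit\<close>;
  a nonempty face of odd weight belongs to the odd subcomplex, where l vanishes on all small pieces.
  The assumption \<open>nil\<close> treats k = 0, whose only face is the empty simplex: the odd
  subcomplex is generated from dimension 0 on.\<close>

lemma mod2_boundary:
  fixes l :: "'a list \<Rightarrow> bit" and k :: nat
  assumes vs: "distinct vs" "\<Union>(verts ` K) \<subseteq> set vs"
    and D: "small D (\<Union>K)" "(1 - 1 / real (Suc k)) ^ s * D \<le> r"
    and nil: "l [] = 0"
    and van: "\<And>\<sigma>. set \<sigma> \<subseteq> \<Union>(odd_subcomplex K) \<Longrightarrow> small r (set \<sigma>) \<Longrightarrow> length \<sigma> = k \<Longrightarrow> l \<sigma> = 0"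
  shows "(\<Sum>M | maximal_simplex K M \<and> card (verts M) = Suc k.
            (subdiv (Suc k) ^^ s) (cobd l) (filter (\<lambda>v. v \<in> verts M) vs)) = 0"
proof -
  define MM where "MM = {M. maximal_simplex K M \<and> card (verts M) = Suc k}"
  define tau where "tau = (\<lambda>U. filter (\<lambda>v. v \<in> U) vs)"
  have MK: "M \<in> K" if "M \<in> MM" for M using that by (simp add: MM_def maximal_simplex_def)
  have fM: "finite MM" using MK complex_finite by (meson finite_subset subsetI)
  have inj: "inj_on verts MM"
    using MK complex_verts(2) unfolding inj_on_def by metis
  have set_tau: "set (tau U) = U" "length (tau U) = card U" if "U \<subseteq> set vs" for U
    using that vs(1) by (auto simp: tau_def distinct_card[symmetric] Int_absorb1 intro:
        arg_cong[where f = card])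
  let ?\<mu> = "(subdiv k ^^ s) l"
  have "(\<Sum>M\<in>MM. (subdiv (Suc k) ^^ s) (cobd l) (tau (verts M))) = (\<Sum>M\<in>MM. cobd ?\<mu> (tau (verts M)))"
  proof (rule sum.cong[OF refl])
    fix M assume M: "M \<in> MM"
    have "verts M \<subseteq> set vs" using vs(2) MK[OF M] by auto
    then have "length (tau (verts M)) = Suc k" using set_tau M by (simp add: MM_def)
    then show "(subdiv (Suc k) ^^ s) (cobd l) (tau (verts M)) = cobd ?\<mu> (tau (verts M))"
      by (rule subdiv_iter_cobd)
  qed
  also have "\<dots> = (\<Sum>U\<in>verts ` MM. cobd ?\<mu> (tau U))"
    using inj by (simp add: sum.reindex)
  also have "\<dots> = (\<Sum>U' | U' \<subseteq> set vs \<and> card U' = k. of_nat (card {U \<in> verts ` MM. U' \<subseteq> U}) * ?\<mu> (tau U'))"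
    unfolding tau_def
    by (rule sum_cobd_filter) (use vs fM MK in \<open>auto simp: MM_def\<close>)
  also have "\<dots> = 0"
  proof (rule sum.neutral, rule ballI)
    fix U' assume "U' \<in> {U'. U' \<subseteq> set vs \<and> card U' = k}"
    then have U': "U' \<subseteq> set vs" and k: "k = card U'" by auto
    show "of_nat (card {U \<in> verts ` MM. U' \<subseteq> U}) * ?\<mu> (tau U') = 0"
    proof (cases "odd (card {U \<in> verts ` MM. U' \<subseteq> U})")
      case False
      then have "of_nat (card {U \<in> verts ` MM. U' \<subseteq> U}) = (0::bit)"
        by (metis even_of_nat_iff bit_not_one_iff odd_one)
      then show ?thesis by simp
    next
      case True
      have "{U \<in> verts ` MM. U' \<subseteq> U} = verts ` {M \<in> MM. U' \<subseteq> verts M}" by auto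
      then have odd: "odd (card {M \<in> MM. U' \<subseteq> verts M})"
        using True inj by (metis (no_types, lifting) card_image inj_on_subset mem_Collect_eq subsetI)
      then obtain M where M: "M \<in> MM" "U' \<subseteq> verts M"
        by (metis (no_types, lifting) card.empty empty_Collect_eq even_zero)
      have "?\<mu> (tau U') = 0"
      proof (cases "U' = {}")
        case True
        then show ?thesis using k nil by (simp add: tau_def subdiv_iter_nil)
      next
        case False
        define F where "F = convex hull U'"
        have "F face_of M" using complex_face_iff[OF MK[OF M(1)]] M(2) F_def by auto
        then have FK: "F \<in> K" using complex_face MK[OF M(1)] by blast
        have vF: "verts F = U'" unfolding F_def
          by (meson M affine_dependent_subset complex_verts(1) MK verts_convex_hull)
        have Fo: "F \<in> odd_subcomplex K"
        proof (rule odd_n_mem[OF FK])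
          show "F \<noteq> {}" using False by (simp add: F_def)
          show "odd (card {M. maximal_simplex K M \<and> card (verts M) = Suc (card (verts F)) \<and> verts F
              \<subseteq> verts M})"
            using odd unfolding vF k MM_def by (simp add: conj_assoc)
        qed
        have "?\<mu> (tau U') = (subdiv k ^^ s) (\<lambda>_. 0) (tau U')"
        proof (rule subdiv_iter_cong[where D = D and N = "Suc k"])
          show "length (tau U') = k" using set_tau U' k by simp
          show "small D (set (tau U'))"
            using small_mono[OF D(1) order_refl] set_tau[OF U'] hull_subset[of U' convex] FK
            unfolding F_def by blast
          fix \<sigma> :: "'a list" assume s: "length \<sigma> = k" "set \<sigma> \<subseteq> convex hull set (tau U')"
            "small ((1 - 1 / real (Suc k)) ^ s * D) (set \<sigma>)"
          show "l \<sigma> = 0"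
          proof (rule van)
            show "set \<sigma> \<subseteq> \<Union>(odd_subcomplex K)"
              using s(2) set_tau[OF U'] Fo F_def by auto
            show "small r (set \<sigma>)" using s(3) D(2) small_mono by blast
          qed (use s in simp)
        qed simp
        then show ?thesis by (simp add: subdiv_iter_zero)
      qed
      then show ?thesis by simp
    qed
  qed
  finally show ?thesis unfolding MM_def tau_def .
qed

end

section \<open>The obstruction to pushing a complex off a maximal simplex\<close>

text \<open>The function \<open>u i\<close> is the distance to the facet opposite \<open>i\<close>, except for a point \<open>{i}\<close>, whose facet
  is empty.\<close>

lemma simplex_cells:
  fixes V :: "'a::euclidean_space set"
  assumes V: "\<not> affine_dependent V" "V \<noteq> {}"
  obtains u :: "'a \<Rightarrow> 'a \<Rightarrow> real" and e :: real where "e > 0"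
    "\<And>i z. z \<in> convex hull (V - {i}) \<Longrightarrow> u i z = 0"
    "\<And>i z z'. \<bar>u i z - u i z'\<bar> \<le> dist z z'"
    "\<And>z. z \<in> convex hull V \<Longrightarrow> \<exists>i\<in>V. u i z \<ge> e"
proof -
  \<comment> \<open>\<open>infdist\<close> to the empty set is 0, which would leave a one-point
    simplex without a positive u; hence the value 1 there.\<close>
  define u where "u = (\<lambda>i z. if V = {i} then 1 else infdist z (convex hull (V - {i})))"
  have fV: "finite V" using V aff_independent_finite by blast
  have lip: "\<bar>u i z - u i z'\<bar> \<le> dist z z'" for i z z'
    by (simp add: u_def infdist_triangle_abs)
  have cont: "continuous_on S (u i)" for i S
    unfolding u_def by (cases "V = {i}") (auto intro!: continuous_intros)
  have pos: "0 < (\<Sum>i\<in>V. u i z)" if z: "z \<in> convex hull V" for z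
  proof (rule ccontr)
    assume "\<not> ?thesis"
    moreover have nn: "0 \<le> u i z" for i by (simp add: u_def infdist_nonneg)
    ultimately have "(\<Sum>i\<in>V. u i z) = 0" using sum_nonneg[of V "\<lambda>i. u i z"] by fastforce
    then have 0: "u i z = 0" if "i \<in> V" for i
      using fV nn that by (simp add: sum_nonneg_eq_0_iff)
    have mem: "z \<in> convex hull (V - {i})" if "i \<in> V" for i
    proof -
      have ne: "V \<noteq> {i}" using 0[OF that] by (auto simp: u_def)
      then have "convex hull (V - {i}) \<noteq> {}" using that by auto
      moreover have "closed (convex hull (V - {i}))"
        using fV by (simp add: compact_imp_closed finite_imp_compact_convex_hull)
      ultimately show ?thesis
        using 0[OF that] ne in_closed_iff_infdist_zero unfolding u_def by metis
    qed
    \<comment> \<open>The facets of a simplex have no common point, so the functions u cannot vanish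
      simultaneously.\<close>
    have "z \<in> (\<Inter>i\<in>V. convex hull (V - {i}))" using mem by auto
    also have "\<dots> = convex hull (\<Inter>((\<lambda>i. V - {i}) ` V))"
    proof -
      have "\<Union>((\<lambda>i. V - {i}) ` V) \<subseteq> V" by auto
      then have "\<not> affine_dependent (\<Union>((\<lambda>i. V - {i}) ` V))" using V(1) affine_dependent_subset by blast
      from convex_hull_Inter[OF this] show ?thesis by (simp add: image_image)
    qed
    also have "\<Inter>((\<lambda>i. V - {i}) ` V) = {}" using V(2) by auto
    finally show False by simp
  qed
  have "compact (convex hull V)" using fV by (simp add: finite_imp_compact_convex_hull)
  moreover have "convex hull V \<noteq> {}" using V by simp
  moreover have "continuous_on (convex hull V) (\<lambda>z. \<Sum>i\<in>V. u i z)"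
    by (intro continuous_intros cont)
  ultimately obtain z0 where z0: "z0 \<in> convex hull V"
      "\<And>z. z \<in> convex hull V \<Longrightarrow> (\<Sum>i\<in>V. u i z0) \<le> (\<Sum>i\<in>V. u i z)"
    using continuous_attains_inf[of "convex hull V" "\<lambda>z. \<Sum>i\<in>V. u i z"] by blast
  \<comment> \<open>The positive minimum of the sum, divided among its \<open>card V\<close> terms:
    at each point some term is at least the average.\<close>
  define e where "e = (\<Sum>i\<in>V. u i z0) / card V"
  have cV: "card V > 0" using V fV by (simp add: card_gt_0_iff)
  have "e > 0" using pos[OF z0(1)] cV by (simp add: e_def)
  moreover have "\<exists>i\<in>V. u i z \<ge> e" if z: "z \<in> convex hull V" for z
  proof (rule ccontr)
    assume "\<not> ?thesis"
    then have "(\<Sum>i\<in>V. u i z) < (\<Sum>i\<in>V. e)" using fV V by (intro sum_strict_mono) auto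
    also have "\<dots> = (\<Sum>i\<in>V. u i z0)" using cV by (simp add: e_def)
    finally show False using z0(2)[OF z] by simp
  qed
  moreover have "u i z = 0" if "z \<in> convex hull (V - {i})" for i z
    using that by (auto simp: u_def)
  ultimately show thesis using that lip by blast
qed

text \<open>A coarse push need not be continuous; it only has to respect closeness at one scale.\<close>

definition coarse_push :: "'a::euclidean_space set set \<Rightarrow> 'a set \<Rightarrow> real \<Rightarrow> ('a \<Rightarrow> 'a) \<Rightarrow> bool" where
  "coarse_push K T \<delta> g \<longleftrightarrow>
     (\<forall>x\<in>\<Union>K. g x \<in> \<Union>(K - {T})) \<and>
     (\<exists>\<eta>>0. \<forall>x\<in>\<Union>K. \<forall>y\<in>\<Union>K. dist x y < \<eta> \<longrightarrow> dist (g x) (g y) \<le> \<delta>) \<and>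
     (\<forall>x\<in>\<Union>K. \<exists>y. dist x y \<le> \<delta> \<and> (\<exists>S\<in>K. y \<in> S \<and> g x \<in> S)) \<and>
     (\<forall>x\<in>\<Union>(odd_subcomplex K). dist (g x) x \<le> \<delta>)"

text \<open>The number \<open>L lam\<close>, the cochain \<open>lam\<close> evaluated on the
  subdivided sum of maximal simplices, is 1. Replacing points by their images under a discretized
  homotopy from the identity to g does not change it, while at g every tuple touches W and the
  number is 0.\<close>

theorem no_coarse_push:
  fixes K :: "'a::euclidean_space set set"
  assumes K: "simplicial_complex K" and T: "maximal_simplex K T" "T \<noteq> {}"
  obtains \<delta> where "\<delta> > 0" "\<And>g. \<not> coarse_push K T \<delta> g"
proof -
  define V where "V = verts T"
  define W where "W = \<Union>(K - {T})"
  have TK: "T \<in> K" using T by (simp add: maximal_simplex_def)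
  note Tv = complex_verts[OF K TK, folded V_def]
  have V: "\<not> affine_dependent V" "V \<noteq> {}" "finite V" "T = convex hull V" using Tv T(2) by auto
  obtain k where k: "card V = Suc k" using V by (metis card_eq_0_iff not0_implies_Suc)
  obtain u :: "'a \<Rightarrow> 'a \<Rightarrow> real" and e where e: "e > 0"
    and u0: "\<And>i z. z \<in> convex hull (V - {i}) \<Longrightarrow> u i z = 0"
    and ulip: "\<And>i z z'. \<bar>u i z - u i z'\<bar> \<le> dist z z'"
    and ucov: "\<And>z. z \<in> T \<Longrightarrow> \<exists>i\<in>V. u i z \<ge> e"
    using simplex_cells[OF V(1,2)] V(4) by metis
  \<comment> \<open>A core of T. A small tuple carrying all labels lies in it: each i is the label
    of some entry, where \<open>u i\<close> is at least e, and the Lipschitz bound loses at most e /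
    2 on the way to any other entry.\<close>
  define D where "D = {z \<in> T. \<forall>i\<in>V. e / 2 \<le> u i z}"
  have ucont: "continuous_on S (u i)" for i S
    unfolding continuous_on_iff dist_real_def using ulip by (meson le_less_trans)
  have DW: "D \<inter> W = {}"
  proof (rule ccontr)
    assume "D \<inter> W \<noteq> {}"
    then obtain z S where z: "z \<in> D" "S \<in> K" "S \<noteq> T" "z \<in> S" by (auto simp: W_def)
    then obtain i where "i \<in> V" "z \<in> convex hull (V - {i})"
      using maximal_Int[OF K T(1) z(2,3)] unfolding V_def D_def by blast
    then have "e / 2 \<le> 0" using u0 z(1) by (fastforce simp: D_def)
    then show False using e by simp
  qed
  have cD: "compact D"
  proof -
    have "D = T \<inter> (\<Inter>i\<in>V. u i -` {e/2..})" by (auto simp: D_def)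
    moreover have "closed (\<Inter>i\<in>V. u i -` {e/2..})"
      using ucont by (intro closed_INT ballI closed_vimage) auto
    ultimately show ?thesis using complex_compact[OF K TK] by (simp add: compact_Int_closed)
  qed
  have cW: "compact W" unfolding W_def by (rule compact_Union_subset[OF K]) auto
  obtain e2 where e2: "e2 > 0" "\<And>x y. x \<in> D \<Longrightarrow> y \<in> W \<Longrightarrow> e2 \<le> dist x y"
    using separate_compact_closed[OF cD compact_imp_closed[OF cW] DW] by metis
  \<comment> \<open>The prism tuples below have diameter at most 4 * \<delta>: 3 * \<delta> within a
    stage and \<delta> between consecutive stages. This has to be at most e / 2, so that full tuples
    lie in D, and less than e2, so that such tuples miss W.\<close>
  define \<delta> where "\<delta> = min e e2 / 16"
  have \<delta>: "\<delta> > 0" "4 * \<delta> \<le> e / 2" "4 * \<delta> < e2" using e e2 by (auto simp: \<delta>_def)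
  define lab where "lab = (\<lambda>z. SOME i. i \<in> V \<and> u i z \<ge> e)"
  have lab: "lab z \<in> V" "u (lab z) z \<ge> e" if "z \<in> T" for z
    using someI_ex[OF ucov[OF that, unfolded Bex_def]] by (auto simp: lab_def)
  have proper: "lab z \<in> c" if "c \<subseteq> V" "z \<in> convex hull c" for c z
  proof (rule ccontr)
    assume "lab z \<notin> c"
    then have "convex hull c \<subseteq> convex hull (V - {lab z})" using that by (intro hull_mono) auto
    then have "u (lab z) z = 0" using u0 that by blast
    moreover have "z \<in> T" using that V(4) hull_mono by blast
    ultimately show False using lab e by force
  qed
  \<comment> \<open>Outside T the choice in \<open>lab\<close> is arbitrary, so the first factor
    cuts the cochain off there.\<close>
  define lam where "lam = (\<lambda>\<sigma>. of_bool (set \<sigma> \<subseteq> T) * full V (map lab \<sigma>))"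
  have lam_nil: "lam [] = 0" using V(2) by (auto simp: lam_def full_def)
  have fullD: "set \<sigma> \<subseteq> D" if "lam \<sigma> \<noteq> 0" "small r (set \<sigma>)" "r \<le> e / 2" for \<sigma> r
  proof
    fix x assume x: "x \<in> set \<sigma>"
    have s: "set \<sigma> \<subseteq> T" "lab ` set \<sigma> = V"
      using that(1) by (auto simp: lam_def full_def split: if_splits)
    have "e / 2 \<le> u i x" if "i \<in> V" for i
    proof -
      obtain y where y: "y \<in> set \<sigma>" "lab y = i" using s \<open>i \<in> V\<close> by auto
      have "u i y \<ge> e" using lab(2) y s(1) by auto
      moreover have "dist y x \<le> e / 2" using \<open>small r (set \<sigma>)\<close> \<open>r \<le> e / 2\<close> x y by (force simp: small_def)
      ultimately show ?thesis using ulip[of i y x] by linarith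
    qed
    then show "x \<in> D" using x s by (auto simp: D_def)
  qed
  have far: "lam \<sigma> = 0" if "small r (set \<sigma>)" "r \<le> e / 2" "x \<in> set \<sigma>" "y \<in> W" "dist x y < e2" for \<sigma> r x y
    using fullD[of \<sigma> r] that e2(2)[of x y] by fastforce
  \<comment> \<open>Inside T all labels are in V, so none can be the extra label required by
    \<open>cobd_full\<close>. A small tuple leaving T has a point in W, and then each of its
    nonempty faces is too near W to be full.\<close>
  have cocycle: "cobd lam \<sigma> = 0" if s: "set \<sigma> \<subseteq> \<Union>K" "small r (set \<sigma>)" "r \<le> e / 2" "r < e2" for \<sigma> r
  proof (cases "set \<sigma> \<subseteq> T")
    case True
    have "cobd lam \<sigma> = cobd (\<lambda>\<rho>. full V (map lab \<rho>)) \<sigma>"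
      by (rule cobd_cong) (use True in \<open>auto simp: lam_def\<close>)
    also have "\<dots> = cobd (full V) (map lab \<sigma>)" by (simp add: cobd_map)
    also have "set (map lab \<sigma>) \<subseteq> V" using lab(1) True by auto
    then have "cobd (full V) (map lab \<sigma>) = 0" unfolding cobd_full by auto
    finally show ?thesis .
  next
    case False
    then obtain z where z: "z \<in> set \<sigma>" "z \<notin> T" by auto
    then have zW: "z \<in> W" using s(1) by (auto simp: W_def)
    have "cobd lam \<sigma> = cobd (\<lambda>_. 0) \<sigma>"
    proof (rule cobd_cong)
      fix \<rho> assume r: "set \<rho> \<subseteq> set \<sigma>"
      show "lam \<rho> = 0"
      proof (cases "\<rho> = []")
        case False
        then obtain x where x: "x \<in> set \<rho>" by (cases \<rho>) auto
        have "dist x z < e2" using s x z r by (force simp: small_def)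
        then show ?thesis using far[OF small_mono[OF s(2) order_refl r] s(3) x zW] by simp
      qed (simp add: lam_nil)
    qed
    then show ?thesis by simp
  qed
  obtain vs where vs: "distinct vs" "set vs = \<Union>(verts ` K)"
    using finite_distinct_list[of "\<Union>(verts ` K)"] complex_finite[OF K] complex_verts(3)[OF K] by auto
  have "bounded (\<Union>K)" using compact_Union_subset[OF K order_refl] compact_imp_bounded by blast
  then have "\<exists>B. small B (\<Union>K)" unfolding bounded_two_points small_def .
  then obtain B where B: "small B (\<Union>K)" by blast
  show thesis
  proof (rule that[OF \<delta>(1)], rule notI)
    fix g assume g: "coarse_push K T \<delta> g"
    have gW: "\<And>x. x \<in> \<Union>K \<Longrightarrow> g x \<in> \<Union>(K - {T})"
      and gA: "\<And>x. x \<in> \<Union>(odd_subcomplex K) \<Longrightarrow> dist (g x) x \<le> \<delta>"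
      and ex: "\<forall>x\<in>\<Union>K. \<exists>y. dist x y \<le> \<delta> \<and> (\<exists>S\<in>K. y \<in> S \<and> g x \<in> S)"
      using g unfolding coarse_push_def by blast+
    obtain \<xi> where "\<forall>x\<in>\<Union>K. dist x (\<xi> x) \<le> \<delta> \<and> (\<exists>S\<in>K. \<xi> x \<in> S \<and> g x \<in> S)"
      using bchoice[OF ex] ..
    then have \<xi>: "\<And>x. x \<in> \<Union>K \<Longrightarrow> dist x (\<xi> x) \<le> \<delta>"
        and \<xi>S: "\<And>x. x \<in> \<Union>K \<Longrightarrow> \<exists>S\<in>K. \<xi> x \<in> S \<and> g x \<in> S"
      by blast+
    obtain \<eta> where \<eta>: "\<eta> > 0"
      and gc: "\<And>x x'. x \<in> \<Union>K \<Longrightarrow> x' \<in> \<Union>K \<Longrightarrow> dist x x' < \<eta> \<Longrightarrow> dist (g x) (g x') \<le> \<delta>"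
      using g unfolding coarse_push_def by blast
    \<comment> \<open>The target scale of subdivision: below the modulus of g, and at most \<delta>
      so that passing from \<open>\<xi> x\<close> over x and y to \<open>\<xi> y\<close> costs at
      most 3 * \<delta>.\<close>
    define r0 where "r0 = min (\<eta> / 2) \<delta>"
    have r0: "r0 > 0" "r0 < \<eta>" "r0 \<le> \<delta>" using \<eta> \<delta> by (auto simp: r0_def)
    obtain s where s: "(1 - 1 / real (Suc k)) ^ s * B \<le> r0"
    proof -
      have "(\<lambda>s. (1 - 1 / real (Suc k)) ^ s * B) \<longlonglongrightarrow> 0 * B"
        by (intro tendsto_mult LIMSEQ_realpow_zero tendsto_const) auto
      then have "\<forall>\<^sub>F s in sequentially. (1 - 1 / real (Suc k)) ^ s * B < r0"
        using r0(1) by (intro order_tendstoD) auto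
      then show thesis using that eventually_happens[of _ sequentially]
        by (metis less_eq_real_def trivial_limit_sequentially)
    qed
    \<comment> \<open>The complex has diameter at most B, so m equal steps along any segment in it
      are shorter than \<delta>.\<close>
    obtain m :: nat where m: "B / \<delta> < real m" using reals_Archimedean2 by blast
    \<comment> \<open>Stage 0 is the identity, stage 1 is \<xi>, and the later stages follow the
      segment from \<open>\<xi> x\<close> to \<open>g x\<close>, which lies in one simplex. The move
      from x to \<open>\<xi> x\<close> is a single jump, since the segment between them may leave
      the complex.\<close>
    define H where "H = (\<lambda>j x. case j of 0 \<Rightarrow> x | Suc i \<Rightarrow>
        (1 - real i / real m) *\<^sub>R \<xi> x + (real i / real m) *\<^sub>R g x)"
    have H0: "H 0 = id" by (auto simp: H_def)
    have HK: "H j x \<in> \<Union>K" if x: "x \<in> \<Union>K" "j \<le> Suc m" for j x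
    proof (cases j)
      case 0
      then show ?thesis using x by (simp add: H_def)
    next
      case (Suc i)
      obtain S where S: "S \<in> K" "\<xi> x \<in> S" "g x \<in> S" using \<xi>S[OF x(1)] by blast
      have "H j x \<in> S"
        unfolding H_def Suc nat.case
        by (rule convexD[OF complex_convex[OF K S(1)]]) (use S Suc x in \<open>auto simp: divide_le_eq_1\<close>)
      then show ?thesis using S by auto
    qed
    have Hd: "dist (H j x) (H j y) \<le> 3 * \<delta>" if "x \<in> \<Union>K" "y \<in> \<Union>K" "dist x y \<le> r0" "j \<le> Suc m" for j x y
    proof (cases j)
      case 0
      then show ?thesis using that r0 \<delta> by (simp add: H_def)
    next
      case (Suc i)
      define t where "t = real i / real m"
      have t: "0 \<le> t" "t \<le> 1" using that Suc by (auto simp: t_def divide_le_eq_1)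
      have 1: "dist (\<xi> x) (\<xi> y) \<le> 3 * \<delta>"
        using \<xi>[OF that(1)] \<xi>[OF that(2)] that(3) r0
          dist_triangle[of "\<xi> x" "\<xi> y" x] dist_triangle[of x "\<xi> y" y] by (simp add: dist_commute)
      have 2: "dist (g x) (g y) \<le> 3 * \<delta>"
        using gc[OF that(1,2)] that r0 \<delta> by fastforce
      have "dist (H j x) (H j y) = norm ((1 - t) *\<^sub>R (\<xi> x - \<xi> y) + t *\<^sub>R (g x - g y))"
        by (simp add: H_def Suc dist_norm t_def algebra_simps)
      also have "\<dots> \<le> (1 - t) * dist (\<xi> x) (\<xi> y) + t * dist (g x) (g y)"
        using t by (intro order_trans[OF norm_triangle_ineq]) (simp add: dist_norm)
      also have "\<dots> \<le> (1 - t) * (3 * \<delta>) + t * (3 * \<delta>)"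
        using t 1 2 by (intro add_mono mult_left_mono) auto
      finally show ?thesis by (simp add: algebra_simps)
    qed
    have Hs: "dist (H j x) (H (Suc j) x) \<le> \<delta>" if x: "x \<in> \<Union>K" "j \<le> m" for j x
    proof (cases j)
      case 0
      then show ?thesis using \<xi>[OF x(1)] by (simp add: H_def)
    next
      case (Suc i)
      then have m0: "m > 0" using x by simp
      obtain S where S: "S \<in> K" "\<xi> x \<in> S" "g x \<in> S" using \<xi>S[OF x(1)] by blast
      have "dist (H j x) (H (Suc j) x) = norm ((1 / real m) *\<^sub>R (\<xi> x - g x))"
        by (simp add: H_def Suc dist_norm algebra_simps add_divide_distrib)
      also have "\<dots> \<le> B / real m"
        using B S m0 by (auto simp: small_def dist_norm divide_right_mono)
      also have "\<dots> \<le> \<delta>" using m m0 \<delta>(1) by (simp add: field_simps)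
      finally show ?thesis .
    qed
    have HA: "dist (H j x) x \<le> \<delta>" if x: "x \<in> \<Union>K" "dist (g x) x \<le> \<delta>" "j \<le> Suc m" for j x
    proof (cases j)
      case 0
      then show ?thesis using \<delta>(1) by (simp add: H_def)
    next
      case (Suc i)
      have "H j x \<in> cball x \<delta>"
        unfolding H_def Suc nat.case
        by (rule convexD[OF convex_cball]) (use x Suc \<xi>[OF x(1)] in \<open>auto simp: divide_le_eq_1
            dist_commute\<close>)
      then show ?thesis by (simp add: dist_commute)
    qed
    define MM where "MM = {M. maximal_simplex K M \<and> card (verts M) = Suc k}"
    define tau where "tau = (\<lambda>M. filter (\<lambda>v. v \<in> verts M) vs)"
    define L where "L = (\<lambda>l. \<Sum>M\<in>MM. (subdiv (Suc k) ^^ s) l (tau M))"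
    have MK: "M \<in> K" if "M \<in> MM" for M using that by (simp add: MM_def maximal_simplex_def)
    have fM: "finite MM" using MK complex_finite[OF K] by (meson finite_subset subsetI)
    have tau: "distinct (tau M)" "set (tau M) = verts M" "length (tau M) = Suc k" if "M \<in> MM" for M
    proof -
      show 1: "distinct (tau M)" "set (tau M) = verts M"
        using vs MK[OF that] by (auto simp: tau_def)
      show "length (tau M) = Suc k"
        using distinct_card[OF 1(1)] 1(2) that by (simp add: MM_def)
    qed
    have local: "(subdiv (Suc k) ^^ s) l (tau M) = (subdiv (Suc k) ^^ s) l' (tau M)"
      if M: "M \<in> MM" and ll: "\<And>\<sigma>. length \<sigma> = Suc k \<Longrightarrow> set \<sigma> \<subseteq> M \<Longrightarrow> small r0 (set \<sigma>) \<Longrightarrow> l \<sigma> = l' \<sigma>" for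
          M l l'
    proof (rule subdiv_iter_cong[where D = B and N = "Suc k"])
      have Mh: "M = convex hull (set (tau M))" using tau[OF M] complex_verts(2)[OF K MK[OF M]] by simp
      then show "small B (set (tau M))"
        using small_mono[OF B order_refl] hull_subset[of "set (tau M)" convex] MK[OF M] by blast
      show "l \<sigma> = l' \<sigma>" if "length \<sigma> = Suc k" "set \<sigma> \<subseteq> convex hull set (tau M)"
        "small ((1 - 1 / real (Suc k)) ^ s * B) (set \<sigma>)" for \<sigma>
        using ll[of \<sigma>] that Mh small_mono[OF that(3) s] by auto
    qed (use tau[OF M] in auto)
    \<comment> \<open>The change between two stages is given by \<open>prism_cobd\<close>. The prism
      of \<open>cobd lam\<close> vanishes because its tuples are small; the coboundary of the prism
      is covered by \<open>mod2_boundary\<close>, as all stages keep the odd subcomplex within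
      \<delta> of W.\<close>
    have step: "L (\<lambda>\<sigma>. lam (map (H (Suc j)) \<sigma>)) = L (\<lambda>\<sigma>. lam (map (H j) \<sigma>))" if j: "j \<le> m" for j
    proof -
      let ?P = "prism (H j) (H (Suc j))"
      let ?I = "\<lambda>\<sigma>. H j ` set \<sigma> \<union> H (Suc j) ` set \<sigma>"
      have I: "small (4 * \<delta>) (?I \<sigma>)" "?I \<sigma> \<subseteq> \<Union>K" if s: "set \<sigma> \<subseteq> \<Union>K" "small r0 (set \<sigma>)" for \<sigma>
      proof -
        have "dist (H j x) (H (Suc j) y) \<le> 4 * \<delta>" if "x \<in> set \<sigma>" "y \<in> set \<sigma>" for x y
        proof -
          have "x \<in> \<Union>K" "y \<in> \<Union>K" "dist x y \<le> r0" using that s by (auto simp: small_def)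
          then show ?thesis
            using Hd[of x y j] Hs[of y j] j dist_triangle[of "H j x" "H (Suc j) y" "H j y"] by force
        qed
        moreover have "dist (H i x) (H i y) \<le> 4 * \<delta>" if xy: "x \<in> set \<sigma>" "y \<in> set \<sigma>" and i: "i \<le> Suc
            m" for i x y
        proof -
          have "x \<in> \<Union>K" "y \<in> \<Union>K" "dist x y \<le> r0" using xy s by (auto simp: small_def)
          from Hd[OF this i] show ?thesis using \<delta>(1) by linarith
        qed
        ultimately show "small (4 * \<delta>) (?I \<sigma>)"
          using j unfolding small_def
          by (auto simp: dist_commute)
        have "H j x \<in> \<Union>K" "H (Suc j) x \<in> \<Union>K" if "x \<in> set \<sigma>" for x
          using HK[OF subsetD[OF s(1) that]] j by simp_all
        then show "?I \<sigma> \<subseteq> \<Union>K" by blast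
      qed
      have "L (\<lambda>\<sigma>. lam (map (H (Suc j)) \<sigma>)) + L (\<lambda>\<sigma>. lam (map (H j) \<sigma>)) =
          L (\<lambda>\<sigma>. lam (map (H (Suc j)) \<sigma>) + lam (map (H j) \<sigma>))"
        by (simp add: L_def subdiv_iter_add sum.distrib)
      also have "\<dots> = L (\<lambda>\<sigma>. ?P (cobd lam) \<sigma> + cobd (?P lam) \<sigma>)"
        by (simp add: prism_cobd)
      also have "\<dots> = L (\<lambda>\<sigma>. ?P (cobd lam) \<sigma>) + L (cobd (?P lam))"
        by (simp add: L_def subdiv_iter_add sum.distrib)
      also have "L (\<lambda>\<sigma>. ?P (cobd lam) \<sigma>) = L (\<lambda>_. 0)"
        unfolding L_def
      proof (rule sum.cong[OF refl], rule local)
        fix M and \<sigma> :: "'a list" assume M: "M \<in> MM" and s: "set \<sigma> \<subseteq> M" "small r0 (set \<sigma>)"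
        have sK: "set \<sigma> \<subseteq> \<Union>K" using s MK[OF M] by auto
        have "?P (cobd lam) \<sigma> = ?P (\<lambda>_. 0) \<sigma>"
          by (rule prism_cong, rule cocycle[where r = "4 * \<delta>"])
            (use I[OF sK s(2)] small_mono \<delta> in \<open>blast+\<close>)
        then show "?P (cobd lam) \<sigma> = 0" by simp
      qed
      also have "\<dots> = 0" by (simp add: L_def subdiv_iter_zero)
      also have "L (cobd (?P lam)) = 0"
        unfolding L_def MM_def tau_def
      proof (rule mod2_boundary[OF K vs(1) _ B s])
        fix \<sigma> :: "'a list" assume s: "set \<sigma> \<subseteq> \<Union>(odd_subcomplex K)" "small r0 (set \<sigma>)"
        have sK: "set \<sigma> \<subseteq> \<Union>K" using s odd_subcomplex_subset[OF K] by blast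
        have "?P lam \<sigma> = ?P (\<lambda>_. 0) \<sigma>"
        proof (rule prism_cong)
          fix \<rho> :: "'a list" assume r: "length \<rho> = Suc (length \<sigma>)" "set \<rho> \<subseteq> ?I \<sigma>"
          then obtain y where y: "y \<in> set \<rho>" by (cases \<rho>) auto
          then obtain x i where x: "x \<in> set \<sigma>" "y = H i x" "i \<le> Suc m" using r j by force
          obtain F where F: "x \<in> F" "F \<in> odd_subcomplex K" using x s by auto
          then have xW: "x \<in> W"
            using odd_subcomplex_subset[OF K] odd_subcomplex_not_maximal[OF K] T(1) unfolding W_def
                by blast
          have "x \<in> \<Union>K" "x \<in> \<Union>(odd_subcomplex K)" using x(1) sK s(1) by auto
          then have "dist y x \<le> \<delta>" using HA[OF _ gA x(3)] x(2) by simp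
          then have "dist y x < e2" using \<delta>(1,3) by linarith
          then show "lam \<rho> = 0"
            using far[OF small_mono[OF I(1)[OF sK s(2)] order_refl r(2)] \<delta>(2) y xW] by simp
        qed
        then show "?P lam \<sigma> = 0" by simp
      qed (use vs in auto)
      finally have "L (\<lambda>\<sigma>. lam (map (H (Suc j)) \<sigma>)) + L (\<lambda>\<sigma>. lam (map (H j) \<sigma>)) = 0" by simp
      then show ?thesis
        by (cases "L (\<lambda>\<sigma>. lam (map (H (Suc j)) \<sigma>))"; cases "L (\<lambda>\<sigma>. lam (map (H j) \<sigma>))") auto
    qed
    have "L (\<lambda>\<sigma>. lam (map (H j) \<sigma>)) = L lam" if "j \<le> Suc m" for j
      using that
    proof (induction j)
      case (Suc j)
      then show ?case using step[of j] by simp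
    qed (simp add: H0)
    then have eq: "L (\<lambda>\<sigma>. lam (map (H (Suc m)) \<sigma>)) = L lam" by simp
    have "L (\<lambda>\<sigma>. lam (map (H (Suc m)) \<sigma>)) = L (\<lambda>_. 0)"
      unfolding L_def
    proof (rule sum.cong[OF refl], rule local)
      fix M and \<sigma> :: "'a list" assume M: "M \<in> MM" and s: "length \<sigma> = Suc k" "set \<sigma> \<subseteq> M" "small r0
          (set \<sigma>)"
      have sK: "set \<sigma> \<subseteq> \<Union>K" using s MK[OF M] by auto
      obtain x where x: "x \<in> set \<sigma>" using s by (cases \<sigma>) auto
      have "H (Suc m) x = g x"
      \<comment> \<open>For m = 0 the quotient 0 / 0 = 0 would make the last stage \<xi> instead of
        g. This is impossible: B bounds \<open>dist x x\<close>, hence is nonnegative.\<close>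
      proof (cases "m = 0")
        case True
        have "dist x x \<le> B" using B x sK unfolding small_def by blast
        then show ?thesis using m True \<delta>(1) by (simp add: divide_less_0_iff)
      qed (simp add: H_def)
      then have "H (Suc m) x \<in> W" using gW[OF subsetD[OF sK x]] unfolding W_def by simp
      moreover have "small (3 * \<delta>) (set (map (H (Suc m)) \<sigma>))"
        unfolding small_def set_map
      proof (intro ballI, elim imageE, hypsubst)
        fix x y assume xy: "x \<in> set \<sigma>" "y \<in> set \<sigma>"
        then have "dist x y \<le> r0" using s(3) by (simp add: small_def)
        then show "dist (H (Suc m) x) (H (Suc m) y) \<le> 3 * \<delta>"
          using Hd[OF subsetD[OF sK xy(1)] subsetD[OF sK xy(2)]] by simp
      qed
      ultimately show "lam (map (H (Suc m)) \<sigma>) = 0"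
        using x \<delta> e2(1) by (intro far[of "3 * \<delta>" _ "H (Suc m) x" "H (Suc m) x"]) auto
    qed
    also have "\<dots> = 0" by (simp add: L_def subdiv_iter_zero)
    finally have L0: "L lam = 0" using eq by simp
    have TM: "T \<in> MM" using T k by (simp add: MM_def V_def)
    have "L lam = (\<Sum>M\<in>MM. of_bool (M = T))"
      unfolding L_def
    proof (rule sum.cong[OF refl])
      fix M assume M: "M \<in> MM"
      show "(subdiv (Suc k) ^^ s) lam (tau M) = of_bool (M = T)"
      proof (cases "M = T")
        case True
        have "(subdiv (Suc k) ^^ s) lam (tau M) = (subdiv (Suc k) ^^ s) (\<lambda>\<sigma>. full (set (tau M)) (map
            lab \<sigma>)) (tau M)"
          by (rule local[OF M]) (use True tau[OF M] in \<open>auto simp: lam_def V_def\<close>)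
        also have "\<dots> = 1"
        proof -
          have "set (tau M) = V" using tau(2)[OF M] True V_def by simp
          then show ?thesis
            using sperner[OF proper tau(1)[OF M], where s = s] tau(3)[OF M] by simp
        qed
        finally show ?thesis using True by simp
      next
        case False
        have "(subdiv (Suc k) ^^ s) lam (tau M) = (subdiv (Suc k) ^^ s) (\<lambda>_. 0) (tau M)"
        proof (rule local[OF M])
          fix \<sigma> assume s: "set \<sigma> \<subseteq> M"
          \<comment> \<open>Another simplex M meets T inside the facet opposite some i, where label
            i does not occur; so only T itself contributes to \<open>L lam\<close>.\<close>
          obtain i where i: "i \<in> V" "M \<inter> T \<subseteq> convex hull (V - {i})"
            using maximal_Int[OF K T(1) MK[OF M] False] unfolding V_def by blast
          show "lam \<sigma> = 0"
          proof (rule ccontr)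
            assume "lam \<sigma> \<noteq> 0"
            then have "set \<sigma> \<subseteq> T" "lab ` set \<sigma> = V"
              by (auto simp: lam_def full_def split: if_splits)
            then have "lab ` set \<sigma> \<subseteq> V - {i}" using proper[of "V - {i}"] i(2) s by blast
            then show False using \<open>lab ` set \<sigma> = V\<close> i(1) by auto
          qed
        qed
        then show ?thesis using False by (simp add: subdiv_iter_zero)
      qed
    qed
    also have "\<dots> = 1" using fM TM by simp
    finally show False using L0 by simp
  qed
qed

section \<open>The surjection property\<close>

lemma maximal_simplex_exists:
  assumes K: "simplicial_complex K" and S: "S \<in> K"
  obtains T where "maximal_simplex K T" "S \<subseteq> T"
proof -
  let ?F = "{T \<in> K. S \<subseteq> T}"
  have fin: "finite ?F" "?F \<noteq> {}" using complex_finite[OF K] S by auto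
  obtain T where T: "T \<in> ?F" "\<And>T'. T' \<in> ?F \<Longrightarrow> aff_dim T' \<le> aff_dim T"
  proof -
    have "Max (aff_dim ` ?F) \<in> aff_dim ` ?F" by (rule Max_in) (use fin in blast)+
    then obtain T where "T \<in> ?F" "aff_dim T = Max (aff_dim ` ?F)" by force
    moreover have "aff_dim T' \<le> Max (aff_dim ` ?F)" if "T' \<in> ?F" for T'
      by (rule Max_ge) (use fin that in blast)+
    ultimately show thesis using that by metis
  qed
  have "maximal_simplex K T"
    unfolding maximal_simplex_def
  proof (intro conjI notI)
    assume "\<exists>T'\<in>K. T face_of T' \<and> T \<noteq> T'"
    then obtain T' where T': "T' \<in> K" "T face_of T'" "T \<noteq> T'" by blast
    then have "aff_dim T < aff_dim T'" using face_of_aff_dim_lt complex_convex[OF K] by blast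
    moreover have "T' \<in> ?F" using T' T(1) face_of_imp_subset by blast
    ultimately show False using T(2) by force
  qed (use T in simp)
  then show thesis using that T(1) by blast
qed

text \<open>Lets every nonempty open part of the complex be tested at an interior point of a maximal
  simplex, also when maximal simplices have different dimensions.\<close>

lemma rel_interior_maximal_dense:
  fixes K :: "'a::euclidean_space set set"
  assumes K: "simplicial_complex K" and x: "x \<in> \<Union>K" and e: "e > 0"
  obtains T q where "maximal_simplex K T" "q \<in> rel_interior T" "dist q x < e"
proof -
  obtain S T where T: "x \<in> S" "maximal_simplex K T" "S \<subseteq> T"
    using x maximal_simplex_exists[OF K] by (metis UnionE)
  have TK: "T \<in> K" using T by (simp add: maximal_simplex_def)
  have "closure (rel_interior T) = T"
    using convex_closure_rel_interior[OF complex_convex[OF K TK]] complex_compact[OF K TK]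
    by (simp add: compact_imp_closed)
  then have "x \<in> closure (rel_interior T)" using T by auto
  then show thesis using that[OF T(2)] e by (meson closure_approachable)
qed

text \<open>Radial projection away from a point in the interior of a maximal simplex.\<close>

lemma maximal_simplex_push:
  fixes K :: "'a::euclidean_space set set"
  assumes K: "simplicial_complex K" and T: "maximal_simplex K T" and q: "q \<in> rel_interior T"
  obtains p where "continuous_on (\<Union>K - {q}) p" "p ` (\<Union>K - {q}) \<subseteq> \<Union>(K - {T})"
    "\<And>x. x \<in> \<Union>(K - {T}) \<Longrightarrow> p x = x"
    "\<And>x. x \<in> \<Union>K \<Longrightarrow> x \<noteq> q \<Longrightarrow> \<exists>S\<in>K. x \<in> S \<and> p x \<in> S"
    "q \<notin> \<Union>(K - {T})"
proof -
  define W where "W = \<Union>(K - {T})"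
  have TK: "T \<in> K" using T by (simp add: maximal_simplex_def)
  have KW: "\<Union>K = T \<union> W" using TK by (auto simp: W_def)
  have TW: "x \<in> rel_frontier T" if "x \<in> T" "x \<in> W" for x
  proof -
    obtain S where S: "S \<in> K" "S \<noteq> T" "x \<in> S" using \<open>x \<in> W\<close> by (auto simp: W_def)
    have "T \<inter> S \<noteq> T" using maximal_simplex_eq[OF K T S(1)] S(2) by auto
    then have "(T \<inter> S) \<inter> rel_interior T = {}"
      using face_of_disjoint_rel_interior complex_Int[OF K TK S(1)] by blast
    then show ?thesis
      using S(3) \<open>x \<in> T\<close> closure_subset[of T] by (auto simp: rel_frontier_def)
  qed
  have front: "rel_frontier T \<subseteq> W"
  proof -
    have "polyhedron T" using complex_simplex[OF K TK] simplex_imp_polyhedron by blast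
    then show ?thesis
      using rel_frontier_of_polyhedron_alt[of T] complex_face[OF K TK] by (auto simp: W_def)
  qed
  have qW: "q \<notin> W"
    using TW q rel_interior_subset[of T] by (auto simp: rel_frontier_def)
  have cvx: "convex T" and bd: "bounded T"
    using complex_convex[OF K TK] complex_compact[OF K TK] compact_imp_bounded by auto
  obtain r where r: "continuous_on (affine hull T - {q}) r" "r \<in> (affine hull T - {q}) \<rightarrow> rel_frontier T"
      "\<And>x. x \<in> rel_frontier T \<Longrightarrow> r x = x"
    using rel_frontier_retract_of_punctured_affine_hull[OF bd cvx q]
    unfolding retract_of_def retraction_def by blast
  have sub: "T - {q} \<subseteq> affine hull T - {q}" using hull_subset[of T affine] by blast
  define p where "p = (\<lambda>x. if x \<in> T then r x else x)"
  have KE: "\<Union>K - {q} = (T - {q}) \<union> W" using KW qW by auto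
  have "closed T" "closed W"
    using complex_compact[OF K TK] compact_Union_subset[OF K, of "K - {T}"]
    by (auto simp: W_def compact_imp_closed)
  \<comment> \<open>Since q is not in W, the set T cuts exactly T - {q} out of the union. The two
    closed pieces overlap in the frontier of T, which r fixes, so the maps can be pasted.\<close>
  then have cl: "closedin (top_of_set ((T - {q}) \<union> W)) (T - {q})" "closedin (top_of_set ((T - {q}) \<union>
      W)) W"
    using qW unfolding closedin_closed by (blast intro: exI[of _ T] exI[of _ W])+
  have "continuous_on ((T - {q}) \<union> W) p"
    unfolding p_def
    by (rule continuous_on_cases_local[OF cl continuous_on_subset[OF r(1) sub]])
      (use TW r(3) in auto)
  moreover have "p ` (\<Union>K - {q}) \<subseteq> W"
    using r(2) sub front KW by (auto simp: p_def Pi_iff)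
  moreover have "p x = x" if "x \<in> W" for x using that TW r(3) by (auto simp: p_def)
  moreover have "\<exists>S\<in>K. x \<in> S \<and> p x \<in> S" if "x \<in> \<Union>K" "x \<noteq> q" for x
  proof (cases "x \<in> T")
    case True
    then have "p x \<in> rel_frontier T" using r(2) sub that by (auto simp: p_def)
    also have "rel_frontier T \<subseteq> T"
      using \<open>closed T\<close> by (auto simp: rel_frontier_def)
    finally show ?thesis using True TK by blast
  qed (use that in \<open>auto simp: p_def\<close>)
  ultimately show thesis
    using that[of p] qW unfolding KE W_def[symmetric] by blast
qed

lemma odd_subcomplex_subset_Union:
  assumes K: "simplicial_complex K" and T: "maximal_simplex K T"
  shows "\<Union>(odd_subcomplex K) \<subseteq> \<Union>(K - {T})"
  using odd_subcomplex_subset[OF K] odd_subcomplex_not_maximal[OF K] T by blast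

lemma coarse_push_mono:
  assumes "coarse_push K T \<delta> g" "\<delta> \<le> \<delta>'"
  shows "coarse_push K T \<delta>' g"
proof -
  have 1: "\<And>a. a \<le> \<delta> \<Longrightarrow> a \<le> \<delta>'" using assms(2) by simp
  show ?thesis using assms(1) unfolding coarse_push_def by (blast intro: 1)
qed

lemma uniform_no_coarse_push:
  fixes K :: "'a::euclidean_space set set"
  assumes K: "simplicial_complex K"
  obtains \<delta> where "\<delta> > 0" "\<And>T g. maximal_simplex K T \<Longrightarrow> T \<noteq> {} \<Longrightarrow> \<not> coarse_push K T \<delta> g"
proof -
  let ?M = "{T. maximal_simplex K T \<and> T \<noteq> {}}"
  have "\<forall>T\<in>?M. \<exists>\<delta>. \<delta> > 0 \<and> (\<forall>g. \<not> coarse_push K T \<delta> g)"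
    using no_coarse_push[OF K] by (metis (mono_tags, lifting) mem_Collect_eq)
  from bchoice[OF this] obtain D where D: "\<forall>T\<in>?M. D T > 0 \<and> (\<forall>g. \<not> coarse_push K T (D T) g)" ..
  have fin: "finite ?M" using complex_finite[OF K] by (rule finite_subset[rotated]) (auto simp:
      maximal_simplex_def)
  \<comment> \<open>The 1 keeps \<open>Min\<close> defined when there is no nonempty maximal
    simplex.\<close>
  define \<delta> where "\<delta> = Min (insert 1 (D ` ?M))"
  have pos: "\<delta> > 0" using fin D by (auto simp: \<delta>_def)
  have le: "\<delta> \<le> D T" if "T \<in> ?M" for T unfolding \<delta>_def by (rule Min_le) (use fin that in auto)
  show thesis
  proof (rule that[OF pos])
    fix T g assume "maximal_simplex K T" "T \<noteq> {}"
    then have "T \<in> ?M" by simp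
    then show "\<not> coarse_push K T \<delta> g" using D le coarse_push_mono by blast
  qed
qed

lemma surjective_if_near_identity:
  fixes K :: "'a::euclidean_space set set"
  assumes K: "simplicial_complex K"
  obtains \<delta> where "\<delta> > 0"
    "\<And>f. \<lbrakk>continuous_on (\<Union>K) f; f ` \<Union>K \<subseteq> \<Union>K; \<And>x. x \<in> \<Union>(odd_subcomplex K) \<Longrightarrow> f x = x;
      \<And>x. x \<in> \<Union>K \<Longrightarrow> dist (f x) x \<le> \<delta>\<rbrakk> \<Longrightarrow> f ` \<Union>K = \<Union>K"
proof -
  obtain \<delta> where \<delta>: "\<delta> > 0" and no:
    "\<And>T g. maximal_simplex K T \<Longrightarrow> T \<noteq> {} \<Longrightarrow> \<not> coarse_push K T \<delta> g"
    by (rule uniform_no_coarse_push[OF K]) blast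
  show thesis
  proof (rule that[OF \<delta>], rule ccontr)
    fix f assume f: "continuous_on (\<Union>K) f" "f ` \<Union>K \<subseteq> \<Union>K" "\<And>x. x \<in> \<Union>(odd_subcomplex K) \<Longrightarrow> f x = x"
      "\<And>x. x \<in> \<Union>K \<Longrightarrow> dist (f x) x \<le> \<delta>" and "f ` \<Union>K \<noteq> \<Union>K"
    then obtain x where x: "x \<in> \<Union>K" "x \<notin> f ` \<Union>K" by blast
    have cK: "compact (\<Union>K)" by (rule compact_Union_subset[OF K order_refl])
    have "closed (f ` \<Union>K)"
      using compact_continuous_image[OF f(1) cK] by (rule compact_imp_closed)
    then have "open (- (f ` \<Union>K))" by (rule open_Compl)
    then obtain e where e: "e > 0" "ball x e \<subseteq> - (f ` \<Union>K)"
      using x(2) by (meson ComplI openE)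
    obtain T q where T: "maximal_simplex K T" "q \<in> rel_interior T" "dist q x < e"
      by (rule rel_interior_maximal_dense[OF K x(1) e(1)])
    have "q \<in> ball x e" using T(3) by (simp add: dist_commute)
    then have q: "q \<notin> f ` \<Union>K" using e(2) by blast
    obtain p where p: "continuous_on (\<Union>K - {q}) p" "p ` (\<Union>K - {q}) \<subseteq> \<Union>(K - {T})"
      "\<And>x. x \<in> \<Union>(K - {T}) \<Longrightarrow> p x = x"
      "\<And>x. x \<in> \<Union>K \<Longrightarrow> x \<noteq> q \<Longrightarrow> \<exists>S\<in>K. x \<in> S \<and> p x \<in> S"
      by (rule maximal_simplex_push[OF K T(1,2)]) blast
    have fK: "f y \<in> \<Union>K - {q}" if "y \<in> \<Union>K" for y using f(2) q that by blast
    have "f ` \<Union>K \<subseteq> \<Union>K - {q}" using fK by blast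
    then have "continuous_on (\<Union>K) (\<lambda>x. p (f x))"
      using continuous_on_compose2[OF p(1) f(1)] by blast
    \<comment> \<open>Uniform continuity supplies the scale \<eta> in the second clause of
      \<open>coarse_push\<close>.\<close>
    then have "uniformly_continuous_on (\<Union>K) (\<lambda>x. p (f x))"
      using cK by (rule compact_uniformly_continuous)
    from uniformly_continuous_onE[OF this \<delta>]
    obtain \<eta> where \<eta>: "\<eta> > 0" "\<And>x x'. x \<in> \<Union>K \<Longrightarrow> x' \<in> \<Union>K \<Longrightarrow> dist x' x < \<eta> \<Longrightarrow> dist (p (f x')) (p (f x)) < \<delta>"
      by metis
    have "coarse_push K T \<delta> (\<lambda>x. p (f x))"
      unfolding coarse_push_def
    proof (intro conjI ballI exI[of _ \<eta>] \<eta>(1) impI)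
      show "p (f y) \<in> \<Union>(K - {T})" if "y \<in> \<Union>K" for y using p(2) fK[OF that] by blast
      show "dist (p (f y)) (p (f z)) \<le> \<delta>" if "y \<in> \<Union>K" "z \<in> \<Union>K" "dist y z < \<eta>" for y z
        using \<eta>(2)[OF that(2,1,3)] by simp
      \<comment> \<open>The point near y is \<open>f y\<close>: the projection moves it only within
        a simplex.\<close>
      show "\<exists>z. dist y z \<le> \<delta> \<and> (\<exists>S\<in>K. z \<in> S \<and> p (f y) \<in> S)" if "y \<in> \<Union>K" for y
        using f(4)[OF that] p(4)[of "f y"] fK[OF that] by (intro exI[of _ "f y"]) (simp add:
            dist_commute)
      show "dist (p (f y)) y \<le> \<delta>" if "y \<in> \<Union>(odd_subcomplex K)" for y
        using f(3)[OF that] p(3)[OF subsetD[OF odd_subcomplex_subset_Union[OF K T(1)] that]] \<delta> by simp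
    qed
    moreover have "T \<noteq> {}" using T(2) by auto
    ultimately show False using no[OF T(1)] by blast
  qed
qed

text \<open>The identity from d to \<open>dist\<close> is continuous on a compact space, hence
  uniformly so. This transfers the obstruction, which is scaled in \<open>dist\<close>, to an
  arbitrary compatible metric. Radii are doubled so that a point d-close to the ball around c is
  still controlled from c.\<close>

lemma compatible_metric_uniform:
  fixes X :: "'a::metric_space set"
  assumes d: "compatible_metric X d" and X: "compact X" and \<delta>: "\<delta> > 0"
  obtains \<epsilon> where "\<epsilon> > 0" "\<And>x y. x \<in> X \<Longrightarrow> y \<in> X \<Longrightarrow> d x y < \<epsilon> \<Longrightarrow> dist x y < \<delta>"
proof -
  interpret M: Metric_space X d using d by (simp add: compatible_metric_def)
  have top: "M.mtopology = top_of_set X" using d by (simp add: compatible_metric_def)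
  have "\<exists>r>0. M.mball x (2 * r) \<subseteq> ball x (\<delta> / 2)" if "x \<in> X" for x
  proof -
    have "openin M.mtopology (X \<inter> ball x (\<delta> / 2))" unfolding top by (simp add: openin_open_Int)
    moreover have "x \<in> X \<inter> ball x (\<delta> / 2)" using that \<delta> by simp
    ultimately obtain r where "r > 0" "M.mball x r \<subseteq> X \<inter> ball x (\<delta> / 2)"
      by (meson M.openin_mtopology)
    then show ?thesis by (intro exI[of _ "r / 2"]) auto
  qed
  then obtain r where r: "\<And>x. x \<in> X \<Longrightarrow> r x > 0 \<and> M.mball x (2 * r x) \<subseteq> ball x (\<delta> / 2)" by metis
  have cX: "compactin M.mtopology X" unfolding top using X by (simp add: compactin_subtopology)
  have op: "openin M.mtopology U" if "U \<in> (\<lambda>x. M.mball x (r x)) ` X" for U using that by auto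
  have cov: "X \<subseteq> \<Union>((\<lambda>x. M.mball x (r x)) ` X)" using r by auto
  from compactinD[OF cX op cov]
  obtain F where F: "finite F" "F \<subseteq> (\<lambda>x. M.mball x (r x)) ` X" "X \<subseteq> \<Union>F"
    by blast
  from finite_subset_image[OF F(1,2)] obtain C where "C \<subseteq> X" "finite C" "F = (\<lambda>x. M.mball x (r x)) ` C"
    by blast
  then have C: "C \<subseteq> X" "finite C" "X \<subseteq> (\<Union>x\<in>C. M.mball x (r x))" using F(3) by simp_all
  define \<epsilon> where "\<epsilon> = Min (insert 1 (r ` C))"
  have "\<epsilon> > 0" using C r by (auto simp: \<epsilon>_def)
  moreover have "dist x y < \<delta>" if xy: "x \<in> X" "y \<in> X" "d x y < \<epsilon>" for x y
  proof -
    obtain c where c: "c \<in> C" "x \<in> M.mball c (r c)" using C xy by auto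
    have "\<epsilon> \<le> r c" using C c by (simp add: \<epsilon>_def)
    then have "d c y < 2 * r c" using M.triangle[of c x y] c C xy by auto
    moreover have "r c > 0" using r c C by blast
    ultimately have "x \<in> M.mball c (2 * r c)" "y \<in> M.mball c (2 * r c)" using c C xy by auto
    then have "dist c x < \<delta> / 2" "dist c y < \<delta> / 2" using r[of c] c C by (auto simp: subset_iff)
    then show ?thesis using dist_triangle[of x y c] by (simp add: dist_commute)
  qed
  ultimately show thesis using that by blast
qed

theorem odd_subcomplex_eps_surjection:
  fixes K :: "'a::euclidean_space set set"
  assumes K: "simplicial_complex K" and d: "compatible_metric (\<Union>K) d"
  shows "\<exists>\<epsilon>>0. eps_surjection_property d \<epsilon> (\<Union>K) (\<Union>(odd_subcomplex K))"
proof -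
  obtain \<delta> where \<delta>: "\<delta> > 0" and surj:
    "\<And>f. \<lbrakk>continuous_on (\<Union>K) f; f ` \<Union>K \<subseteq> \<Union>K; \<And>x. x \<in> \<Union>(odd_subcomplex K) \<Longrightarrow> f x = x;
      \<And>x. x \<in> \<Union>K \<Longrightarrow> dist (f x) x \<le> \<delta>\<rbrakk> \<Longrightarrow> f ` \<Union>K = \<Union>K"
    by (rule surjective_if_near_identity[OF K]) blast
  obtain \<epsilon> where e: "\<epsilon> > 0" "\<And>x y. x \<in> \<Union>K \<Longrightarrow> y \<in> \<Union>K \<Longrightarrow> d x y < \<epsilon> \<Longrightarrow> dist x y < \<delta>"
    by (rule compatible_metric_uniform[OF d compact_Union_subset[OF K order_refl] \<delta>]) blast
  have "eps_surjection_property d \<epsilon> (\<Union>K) (\<Union>(odd_subcomplex K))"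
    unfolding eps_surjection_property_def
  proof (intro allI impI, elim conjE)
    fix f assume f: "continuous_on (\<Union>K) f" "f ` \<Union>K \<subseteq> \<Union>K" "\<forall>x\<in>\<Union>(odd_subcomplex K). f x = x"
      "\<forall>x\<in>\<Union>K. d (f x) x < \<epsilon>"
    show "f ` \<Union>K = \<Union>K"
    proof (rule surj[OF f(1,2)])
      show "dist (f x) x \<le> \<delta>" if "x \<in> \<Union>K" for x
        using e(2)[of "f x" x] f(2,4) that by (meson image_subset_iff less_imp_le)
    qed (use f(3) in blast)
  qed
  then show ?thesis using e(1) by blast
qed

section \<open>Computably enumerable predicates\<close>

text \<open>Recursiveness up to the irrelevant values on lists of other lengths.\<close>

definition recursive_ext :: "nat \<Rightarrow> (nat list \<Rightarrow> nat) \<Rightarrow> bool" where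
  "recursive_ext n F \<longleftrightarrow> (\<exists>g. recursive_fun n g \<and> (\<forall>xs. length xs = n \<longrightarrow> F xs = g xs))"

lemma recursive_extI: "recursive_fun n g \<Longrightarrow> (\<And>xs. length xs = n \<Longrightarrow> F xs = g xs) \<Longrightarrow> recursive_ext n F"
  unfolding recursive_ext_def by blast

lemma recursive_ext_cong:
  "recursive_ext m F \<Longrightarrow> m = n \<Longrightarrow> (\<And>xs. length xs = n \<Longrightarrow> F xs = G xs) \<Longrightarrow> recursive_ext n G"
  unfolding recursive_ext_def by metis

lemma recursive_ext_comp:
  assumes F: "recursive_ext (length Gs) F" and G: "\<And>G. G \<in> set Gs \<Longrightarrow> recursive_ext n G"
  shows "recursive_ext n (\<lambda>xs. F (map (\<lambda>G. G xs) Gs))"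
proof -
  obtain f where f: "recursive_fun (length Gs) f" "\<And>xs. length xs = length Gs \<Longrightarrow> F xs = f xs"
    using F by (auto simp: recursive_ext_def)
  have "\<forall>G\<in>set Gs. \<exists>g. recursive_fun n g \<and> (\<forall>xs. length xs = n \<longrightarrow> G xs = g xs)"
    using G by (simp add: recursive_ext_def)
  from bchoice[OF this] obtain h where
    h: "\<forall>G\<in>set Gs. recursive_fun n (h G) \<and> (\<forall>xs. length xs = n \<longrightarrow> G xs = h G xs)" ..
  have "recursive_fun n (\<lambda>xs. f (map (\<lambda>g. g xs) (map h Gs)))"
    by (rule recursive_fun.comp) (use f h in auto)
  then show ?thesis
  proof (rule recursive_extI)
    fix xs :: "nat list" assume "length xs = n"
    then have "map (\<lambda>G. G xs) Gs = map (\<lambda>g. g xs) (map h Gs)" using h by simp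
    then show "F (map (\<lambda>G. G xs) Gs) = f (map (\<lambda>g. g xs) (map h Gs))"
      using f(2)[of "map (\<lambda>G. G xs) Gs"] by (simp del: map_map)
  qed
qed

lemma recursive_ext_comp1:
  "recursive_ext 1 F \<Longrightarrow> recursive_ext n G \<Longrightarrow> recursive_ext n (\<lambda>xs. F [G xs])"
  using recursive_ext_comp[of "[G]" F n] by simp

lemma recursive_ext_comp2:
  "recursive_ext 2 F \<Longrightarrow> recursive_ext n G \<Longrightarrow> recursive_ext n H \<Longrightarrow> recursive_ext n (\<lambda>xs. F [G xs, H xs])"
  using recursive_ext_comp[of "[G, H]" F n] by (auto simp: numeral_2_eq_2)

lemma recursive_ext_proj: "i < n \<Longrightarrow> recursive_ext n (\<lambda>xs. xs ! i)"
  by (rule recursive_extI[OF recursive_fun.proj]) auto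

lemma recursive_ext_Suc: "recursive_ext n G \<Longrightarrow> recursive_ext n (\<lambda>xs. Suc (G xs))"
  using recursive_ext_comp1[OF recursive_extI[OF recursive_fun.succ]] by force

lemma recursive_ext_zero: "recursive_ext n (\<lambda>xs. 0)"
  by (rule recursive_extI[OF recursive_fun.zero]) auto

lemma recursive_ext_rec:
  assumes "recursive_ext n F" "recursive_ext (n + 2) G"
  shows "recursive_ext (Suc n) (\<lambda>xs. rec_nat (F (tl xs)) (\<lambda>k r. G (k # r # tl xs)) (hd xs))"
proof -
  obtain f g where f: "recursive_fun n f" "\<And>xs. length xs = n \<Longrightarrow> F xs = f xs"
    and g: "recursive_fun (n + 2) g" "\<And>xs. length xs = n + 2 \<Longrightarrow> G xs = g xs"
    using assms by (auto simp: recursive_ext_def)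
  show ?thesis
    by (rule recursive_extI[OF recursive_fun.prim_rec[OF f(1) g(1)]]) (simp add: f(2) g(2))
qed

lemma recursive_ext_Least:
  assumes "recursive_ext (Suc n) F" "\<And>xs. length xs = n \<Longrightarrow> \<exists>k. F (k # xs) = 0"
  shows "recursive_ext n (\<lambda>xs. LEAST k. F (k # xs) = 0)"
proof -
  obtain f where f: "recursive_fun (Suc n) f" "\<And>xs. length xs = Suc n \<Longrightarrow> F xs = f xs"
    using assms(1) by (auto simp: recursive_ext_def)
  have "recursive_fun n (\<lambda>xs. LEAST k. f (k # xs) = 0)"
    by (rule recursive_fun.minimize[OF f(1)]) (metis assms(2) f(2) length_Cons)
  then show ?thesis
    by (rule recursive_extI) (simp add: f(2))
qed

lemma computable_fun_iff: "computable_fun f \<longleftrightarrow> recursive_ext 1 (\<lambda>xs. f (hd xs))"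
proof
  assume "recursive_ext 1 (\<lambda>xs. f (hd xs))"
  then obtain g where "recursive_fun 1 g" "\<And>xs. length xs = 1 \<Longrightarrow> f (hd xs) = g xs"
    by (auto simp: recursive_ext_def)
  then show "computable_fun f" unfolding computable_fun_def by (metis One_nat_def length_Cons
      list.sel(1) list.size(3))
next
  assume "computable_fun f"
  then obtain g where "recursive_fun 1 g" "\<And>x. f x = g [x]" by (auto simp: computable_fun_def)
  then show "recursive_ext 1 (\<lambda>xs. f (hd xs))"
  proof (intro recursive_extI)
    fix xs :: "nat list" assume "length xs = 1"
    then show "f (hd xs) = g xs" using \<open>\<And>x. f x = g [x]\<close> by (cases xs) auto
  qed
qed

lemma recursive_ext_computable: "computable_fun f \<Longrightarrow> recursive_ext n G \<Longrightarrow> recursive_ext n (\<lambda>xs. f (G xs))"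
  using recursive_ext_comp1[of "\<lambda>xs. f (hd xs)" n G] by (simp add: computable_fun_iff)

section \<open>Arithmetic, pairing and recursion\<close>

lemma recursive_ext_add: "recursive_ext 2 (\<lambda>xs. xs ! 0 + xs ! 1)"
proof -
  have "recursive_ext (1 + 2) (\<lambda>xs. Suc (xs ! 1))"
    by (intro recursive_ext_Suc recursive_ext_proj) simp
  from recursive_ext_rec[OF recursive_ext_proj[of 0 1] this]
  have *: "recursive_ext (Suc 1) (\<lambda>xs. rec_nat (tl xs ! 0) (\<lambda>k r. Suc r) (hd xs))" by simp
  have "rec_nat a (\<lambda>k r. Suc r) n = n + a" for a n :: nat by (induction n) auto
  then show ?thesis
    by (intro recursive_ext_cong[OF *]) (auto simp: length_Suc_conv numeral_2_eq_2)
qed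

lemma recursive_ext_diff: "recursive_ext 2 (\<lambda>xs. xs ! 0 - xs ! 1)"
proof -
  have "recursive_ext (Suc 0) (\<lambda>xs. rec_nat 0 (\<lambda>k r. (k # r # tl xs) ! 0) (hd xs))"
    by (rule recursive_ext_rec) (auto intro!: recursive_ext_zero recursive_ext_proj)
  moreover have "rec_nat 0 (\<lambda>k r. k) n = n - 1" for n :: nat by (cases n) auto
  ultimately have pred: "computable_fun (\<lambda>n. n - 1)" by (simp add: computable_fun_iff)
  have "recursive_ext (1 + 2) (\<lambda>xs. xs ! 1 - 1)"
    by (rule recursive_ext_computable[OF pred recursive_ext_proj]) simp
  from recursive_ext_rec[OF recursive_ext_proj[of 0 1] this]
  have *: "recursive_ext (Suc 1) (\<lambda>xs. rec_nat (tl xs ! 0) (\<lambda>k r. r - 1) (hd xs))" by simp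
  have "rec_nat a (\<lambda>k r. r - 1) n = a - n" for a n :: nat by (induction n) auto
  then have sub: "recursive_ext 2 (\<lambda>xs. xs ! 1 - xs ! 0)"
    by (intro recursive_ext_cong[OF *]) (auto simp: length_Suc_conv numeral_2_eq_2)
  show ?thesis
    using recursive_ext_comp2[OF sub recursive_ext_proj[of 1 2] recursive_ext_proj[of 0 2]] by simp
qed

lemma computable_add:
  assumes "computable_fun f" "computable_fun g" shows "computable_fun (\<lambda>x. f x + g x)"
  using recursive_ext_comp2[OF recursive_ext_add, of 1 "\<lambda>xs. f (hd xs)" "\<lambda>xs. g (hd xs)"] assms
  by (simp add: computable_fun_iff)

lemma computable_diff:
  assumes "computable_fun f" "computable_fun g" shows "computable_fun (\<lambda>x. f x - g x)"
  using recursive_ext_comp2[OF recursive_ext_diff, of 1 "\<lambda>xs. f (hd xs)" "\<lambda>xs. g (hd xs)"] assms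
  by (simp add: computable_fun_iff)

lemma computable_comp:
  assumes "computable_fun f" "computable_fun g" shows "computable_fun (\<lambda>x. f (g x))"
  using recursive_ext_computable[OF assms(1), of 1 "\<lambda>xs. g (hd xs)"] assms(2)
  by (simp add: computable_fun_iff)

lemma computable_id: "computable_fun (\<lambda>x. x)"
  unfolding computable_fun_iff
  by (rule recursive_ext_cong[OF recursive_ext_proj[of 0 1]]) (auto simp: length_Suc_conv)

lemma computable_Suc: "computable_fun f \<Longrightarrow> computable_fun (\<lambda>x. Suc (f x))"
  by (simp add: computable_fun_iff recursive_ext_Suc)

lemma computable_const: "computable_fun (\<lambda>x. c)"
  by (induction c) (auto simp: computable_fun_iff recursive_ext_zero recursive_ext_Suc)

lemma computable_triangle: "computable_fun triangle"
proof -
  have "recursive_ext (0 + 2) (\<lambda>xs. xs ! 1 + Suc (xs ! 0))"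
    using recursive_ext_comp2[OF recursive_ext_add recursive_ext_proj[of 1 2] recursive_ext_Suc[OF
        recursive_ext_proj[of 0 2]]]
    by (simp add: numeral_2_eq_2)
  from recursive_ext_rec[OF recursive_ext_zero this]
  have "recursive_ext 1 (\<lambda>xs. rec_nat 0 (\<lambda>k r. r + Suc k) (hd xs))" by simp
  moreover have "rec_nat 0 (\<lambda>k r. r + Suc k) n = triangle n" for n by (induction n) auto
  ultimately show ?thesis by (simp add: computable_fun_iff)
qed

lemma recursive_ext_prod_encode:
  assumes "recursive_ext n G" "recursive_ext n H"
  shows "recursive_ext n (\<lambda>xs. prod_encode (G xs, H xs))"
proof -
  have "recursive_ext n (\<lambda>xs. G xs + H xs)"
    using recursive_ext_comp2[OF recursive_ext_add assms] by simp
  then have "recursive_ext n (\<lambda>xs. triangle (G xs + H xs))"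
    by (rule recursive_ext_computable[OF computable_triangle])
  from recursive_ext_comp2[OF recursive_ext_add this assms(1)]
  show ?thesis by (simp add: prod_encode_def)
qed

lemma computable_pair:
  "computable_fun f \<Longrightarrow> computable_fun g \<Longrightarrow> computable_fun (\<lambda>x. prod_encode (f x, g x))"
  using recursive_ext_prod_encode by (simp add: computable_fun_iff)

definition pfst :: "nat \<Rightarrow> nat" where "pfst z = fst (prod_decode z)"
definition psnd :: "nat \<Rightarrow> nat" where "psnd z = snd (prod_decode z)"

lemma pfst_pair [simp]: "pfst (prod_encode (x, y)) = x" by (simp add: pfst_def)
lemma psnd_pair [simp]: "psnd (prod_encode (x, y)) = y" by (simp add: psnd_def)
lemma pair_pfst_psnd [simp]: "prod_encode (pfst z, psnd z) = z" by (simp add: pfst_def psnd_def)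

lemma triangle_mono: "m \<le> n \<Longrightarrow> triangle m \<le> triangle n"
  by (induction n) (auto simp: le_Suc_eq)

text \<open>The code of (a, b) is \<open>triangle (a + b) + a\<close>, so a + b is the least k whose
  next triangular number exceeds the code. Minimization finds it, and subtraction then recovers a
  and b.\<close>

lemma computable_pfst_psnd: "computable_fun pfst" "computable_fun psnd"
proof -
  let ?F = "\<lambda>xs. Suc (xs ! 1) - triangle (Suc (xs ! 0))"
  have F: "recursive_ext (Suc 1) ?F"
    using recursive_ext_comp2[OF recursive_ext_diff recursive_ext_Suc[OF recursive_ext_proj[of 1 2]]
        recursive_ext_computable[OF computable_triangle recursive_ext_Suc[OF recursive_ext_proj[of 0
            2]]]]
    by (simp add: numeral_2_eq_2)
  have Least: "(LEAST k. Suc z \<le> triangle (Suc k)) = pfst z + psnd z" for z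
  proof (rule Least_equality)
    have z: "z = triangle (pfst z + psnd z) + pfst z"
      using pair_pfst_psnd[of z] unfolding prod_encode_def by simp
    then show "Suc z \<le> triangle (Suc (pfst z + psnd z))"
      using triangle_Suc[of "pfst z + psnd z"] by linarith
    fix k assume k: "Suc z \<le> triangle (Suc k)"
    show "pfst z + psnd z \<le> k"
    proof (rule ccontr)
      assume "\<not> ?thesis"
      then have "triangle (Suc k) \<le> triangle (pfst z + psnd z)" by (intro triangle_mono) simp
      then show False using z k by linarith
    qed
  qed
  have "recursive_ext 1 (\<lambda>xs. LEAST k. ?F (k # xs) = 0)"
  proof (rule recursive_ext_Least[OF F])
    fix xs :: "nat list" assume "length xs = 1"
    have "n \<le> triangle n" for n by (induction n) auto
    then show "\<exists>k. Suc ((k # xs) ! 1) - triangle (Suc ((k # xs) ! 0)) = 0"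
      by (intro exI[of _ "xs ! 0"]) (simp del: triangle_Suc)
  qed
  then have "recursive_ext 1 (\<lambda>xs. pfst (hd xs) + psnd (hd xs))"
    by (rule recursive_ext_cong) (auto simp: length_Suc_conv Least simp del: triangle_Suc)
  then have s: "computable_fun (\<lambda>z. pfst z + psnd z)" by (simp add: computable_fun_iff)
  have "pfst z = z - triangle (pfst z + psnd z)" for z
    using pair_pfst_psnd[of z] unfolding prod_encode_def by simp
  moreover have "computable_fun (\<lambda>z. z - triangle (pfst z + psnd z))"
    by (intro computable_diff computable_id computable_comp[OF computable_triangle] s)
  ultimately show 1: "computable_fun pfst" by presburger
  have "computable_fun (\<lambda>z. pfst z + psnd z - pfst z)"
    by (intro computable_diff s 1)
  then show "computable_fun psnd" by simp
qed

lemma computable_pfst: "computable_fun f \<Longrightarrow> computable_fun (\<lambda>x. pfst (f x))"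
  and computable_psnd: "computable_fun f \<Longrightarrow> computable_fun (\<lambda>x. psnd (f x))"
  using computable_comp computable_pfst_psnd by blast+

text \<open>Counter, accumulator and parameter are packed into one number, so that all later
  recursions stay among unary functions.\<close>

lemma computable_rec:
  assumes f: "computable_fun f" and n: "computable_fun n"
    and g: "computable_fun (\<lambda>z. g (pfst z) (pfst (psnd z)) (psnd (psnd z)))"
  shows "computable_fun (\<lambda>x. rec_nat (f x) (\<lambda>k r. g k r x) (n x))"
proof -
  have "recursive_ext 1 (\<lambda>xs. f (hd xs))" using f by (simp add: computable_fun_iff)
  moreover have "recursive_ext 3 (\<lambda>xs. prod_encode (xs ! 0, prod_encode (xs ! 1, xs ! 2)))"
    by (intro recursive_ext_prod_encode recursive_ext_proj) auto
  from recursive_ext_computable[OF g this]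
  have "recursive_ext (1 + 2) (\<lambda>xs. g (xs ! 0) (xs ! 1) (xs ! 2))" by (simp add: numeral_3_eq_3)
  ultimately have "recursive_ext (Suc 1)
      (\<lambda>xs. rec_nat (f (hd (tl xs))) (\<lambda>k r. g ((k # r # tl xs) ! 0) ((k # r # tl xs) ! 1) ((k # r #
          tl xs) ! 2)) (hd xs))"
    by (rule recursive_ext_rec)
  then have *: "recursive_ext 2 (\<lambda>xs. rec_nat (f (xs ! 1)) (\<lambda>k r. g k r (xs ! 1)) (xs ! 0))"
    unfolding numeral_2_eq_2 One_nat_def
    by (rule recursive_ext_cong) (auto simp: length_Suc_conv)
  have "recursive_ext 1 (\<lambda>xs. n (hd xs))" "recursive_ext 1 (\<lambda>xs. hd xs)"
    using n computable_id by (simp_all add: computable_fun_iff)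
  from recursive_ext_comp2[OF * this] show ?thesis by (simp add: computable_fun_iff)
qed

lemma computable_sum:
  assumes "computable_fun n" "computable_fun (\<lambda>z. g (pfst z) (psnd z))"
  shows "computable_fun (\<lambda>x. \<Sum>i<n x. g i x)"
proof -
  have "computable_fun (\<lambda>z. pfst (psnd z) + g (pfst (prod_encode (pfst z, psnd (psnd z)))) (psnd
      (prod_encode (pfst z, psnd (psnd z)))))"
    by (intro computable_add computable_pfst computable_psnd computable_id
        computable_comp[OF assms(2)] computable_pair)
  then have "computable_fun (\<lambda>z. pfst (psnd z) + g (pfst z) (psnd (psnd z)))" by simp
  from computable_rec[of "\<lambda>_. 0" n "\<lambda>k r x. r + g k x", OF computable_const assms(1) this]
  have "computable_fun (\<lambda>x. rec_nat 0 (\<lambda>k r. r + g k x) (n x))" .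
  moreover have "rec_nat 0 (\<lambda>k r. r + g k x) m = (\<Sum>i<m. g i x)" for m x by (induction m) auto
  ultimately show ?thesis by simp
qed

lemma computable_mult:
  assumes "computable_fun f" "computable_fun g" shows "computable_fun (\<lambda>x. f x * g x)"
  using computable_sum[of f "\<lambda>i x. g x", OF assms(1) computable_comp[OF assms(2)
      computable_pfst_psnd(2)]]
  by simp

lemma computable_prod:
  assumes "computable_fun n" "computable_fun (\<lambda>z. g (pfst z) (psnd z))"
  shows "computable_fun (\<lambda>x. \<Prod>i<n x. g i x)"
proof -
  have "computable_fun (\<lambda>z. pfst (psnd z) * g (pfst (prod_encode (pfst z, psnd (psnd z)))) (psnd
      (prod_encode (pfst z, psnd (psnd z)))))"
    by (intro computable_mult computable_pfst computable_psnd computable_id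
        computable_comp[OF assms(2)] computable_pair)
  then have "computable_fun (\<lambda>z. pfst (psnd z) * g (pfst z) (psnd (psnd z)))" by simp
  from computable_rec[of "\<lambda>_. 1" n "\<lambda>k r x. r * g k x", OF computable_const assms(1) this]
  have "computable_fun (\<lambda>x. rec_nat 1 (\<lambda>k r. r * g k x) (n x))" .
  moreover have "rec_nat 1 (\<lambda>k r. r * g k x) m = (\<Prod>i<m. g i x)" for m x by (induction m) auto
  ultimately show ?thesis by simp
qed

lemma computable_power:
  assumes "computable_fun f" "computable_fun g" shows "computable_fun (\<lambda>x. f x ^ g x)"
  using computable_prod[of g "\<lambda>i x. f x", OF assms(2) computable_comp[OF assms(1)
      computable_pfst_psnd(2)]]
  by simp

lemmas computable_intros = computable_const computable_id computable_Suc computable_add computable_diff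
  computable_mult computable_power computable_pair computable_pfst computable_psnd

section \<open>Closure properties of computably enumerable predicates\<close>

definition ce :: "(nat \<Rightarrow> bool) \<Rightarrow> bool" where
  "ce P \<longleftrightarrow> comp_enumerable {x. P x}"

text \<open>The normal form as an unbounded search with a computable test; it makes the closure
  properties below manipulations of R.\<close>

lemma ce_iff:
  "ce P \<longleftrightarrow> (\<exists>R. computable_fun R \<and> (\<forall>x. P x \<longleftrightarrow> (\<exists>y. R (prod_encode (x, y)) = 0)))"
proof
  assume "ce P"
  then consider "\<And>x. \<not> P x" | f where "computable_fun f" "{x. P x} = range f"
    by (auto simp: ce_def comp_enumerable_def)
  then show "\<exists>R. computable_fun R \<and> (\<forall>x. P x \<longleftrightarrow> (\<exists>y. R (prod_encode (x, y)) = 0))"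
  proof cases
    case 1
    then show ?thesis by (intro exI[of _ "\<lambda>_. 1"]) (simp add: computable_const)
  next
    case 2
    have "computable_fun (\<lambda>z. (f (psnd z) - pfst z) + (pfst z - f (psnd z)))"
      by (intro computable_intros computable_comp[OF 2(1)])
    moreover have "P x \<longleftrightarrow> (\<exists>y. (f y - x) + (x - f y) = 0)" for x
    proof -
      have "P x \<longleftrightarrow> (\<exists>y. f y = x)" using 2(2) by (metis mem_Collect_eq rangeE rangeI)
      also have "\<dots> \<longleftrightarrow> (\<exists>y. (f y - x) + (x - f y) = 0)" by (rule arg_cong[where f = Ex]) (auto simp:
          fun_eq_iff)
      finally show ?thesis .
    qed
    ultimately show ?thesis by (intro exI[of _ "\<lambda>z. (f (psnd z) - pfst z) + (pfst z - f (psnd z))"]) simp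
  qed
next
  assume "\<exists>R. computable_fun R \<and> (\<forall>x. P x \<longleftrightarrow> (\<exists>y. R (prod_encode (x, y)) = 0))"
  then obtain R where R: "computable_fun R" "\<And>x. P x \<longleftrightarrow> (\<exists>y. R (prod_encode (x, y)) = 0)" by blast
  show "ce P"
  proof (cases "\<exists>a. P a")
    case False
    then show ?thesis by (simp add: ce_def comp_enumerable_def)
  next
    case True
    then obtain a where a: "P a" by blast
    \<comment> \<open>With truncated subtraction, \<open>1 - R z\<close> is the indicator of
      \<open>R z = 0\<close>. Failing pairs are sent to the known element a, which keeps e
      total.\<close>
    define e where "e = (\<lambda>z. (1 - R z) * pfst z + (1 - (1 - R z)) * a)"
    have "computable_fun e" unfolding e_def by (intro computable_intros R(1))
    moreover have "{x. P x} = range e"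
    proof (intro equalityI subsetI)
      fix x assume "x \<in> {x. P x}"
      then obtain y where "R (prod_encode (x, y)) = 0" using R(2) by auto
      then have "x = e (prod_encode (x, y))" by (simp add: e_def)
      then show "x \<in> range e" by blast
    next
      fix x assume "x \<in> range e"
      then obtain z where z: "x = e z" by blast
      show "x \<in> {x. P x}"
      proof (cases "R z = 0")
        case True
        then have "R (prod_encode (x, psnd z)) = 0" using z by (simp add: e_def)
        then show ?thesis using R(2) by blast
      next
        case False
        then have "1 - R z = 0" by simp
        then show ?thesis using a z by (simp add: e_def)
      qed
    qed
    ultimately show ?thesis unfolding ce_def comp_enumerable_def by blast
  qed
qed

lemma ceI: "computable_fun R \<Longrightarrow> (\<And>x. P x \<longleftrightarrow> (\<exists>y. R (prod_encode (x, y)) = 0)) \<Longrightarrow> ce P"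
  unfolding ce_iff by blast

lemma ceE:
  assumes "ce P"
  obtains R where "computable_fun R" "\<And>x. P x \<longleftrightarrow> (\<exists>y. R (prod_encode (x, y)) = 0)"
  using assms unfolding ce_iff by blast

lemma ce_subst:
  assumes "ce P" "computable_fun f" shows "ce (\<lambda>x. P (f x))"
proof -
  obtain R where R: "computable_fun R" "\<And>x. P x \<longleftrightarrow> (\<exists>y. R (prod_encode (x, y)) = 0)" by (rule ceE[OF
      assms(1)], rule that)
  have "computable_fun (\<lambda>z. R (prod_encode (f (pfst z), psnd z)))"
    by (intro computable_comp[OF R(1)] computable_pair computable_comp[OF assms(2)] computable_intros)
  then show ?thesis by (rule ceI) (simp add: R(2))
qed

lemma ce_conj:
  assumes "ce P" "ce Q" shows "ce (\<lambda>x. P x \<and> Q x)"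
proof -
  obtain R where R: "computable_fun R" "\<And>x. P x \<longleftrightarrow> (\<exists>y. R (prod_encode (x, y)) = 0)" by (rule ceE[OF
      assms(1)], rule that)
  obtain S where S: "computable_fun S" "\<And>x. Q x \<longleftrightarrow> (\<exists>y. S (prod_encode (x, y)) = 0)" by (rule ceE[OF
      assms(2)], rule that)
  have "computable_fun (\<lambda>z. R (prod_encode (pfst z, pfst (psnd z))) + S (prod_encode (pfst z, psnd
      (psnd z))))"
    by (intro computable_add computable_comp[OF R(1)] computable_comp[OF S(1)] computable_intros)
  then show ?thesis
  proof (rule ceI)
    fix x
    show "P x \<and> Q x \<longleftrightarrow> (\<exists>y. R (prod_encode (pfst (prod_encode (x, y)), pfst (psnd (prod_encode (x,
        y))))) +
        S (prod_encode (pfst (prod_encode (x, y)), psnd (psnd (prod_encode (x, y))))) = 0)"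
      unfolding R(2) S(2) by simp (metis pfst_pair psnd_pair)
  qed
qed

lemma ce_disj:
  assumes "ce P" "ce Q" shows "ce (\<lambda>x. P x \<or> Q x)"
proof -
  obtain R where R: "computable_fun R" "\<And>x. P x \<longleftrightarrow> (\<exists>y. R (prod_encode (x, y)) = 0)" by (rule ceE[OF
      assms(1)], rule that)
  obtain S where S: "computable_fun S" "\<And>x. Q x \<longleftrightarrow> (\<exists>y. S (prod_encode (x, y)) = 0)" by (rule ceE[OF
      assms(2)], rule that)
  have "computable_fun (\<lambda>z. R z * S z)" by (intro computable_mult R(1) S(1))
  then show ?thesis by (rule ceI) (auto simp: R(2) S(2))
qed

lemma ce_ex:
  assumes "ce (\<lambda>z. P (pfst z) (psnd z))" shows "ce (\<lambda>x. \<exists>u. P x u)"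
proof -
  obtain R where R: "computable_fun R" "\<And>z. P (pfst z) (psnd z) \<longleftrightarrow> (\<exists>y. R (prod_encode (z, y)) = 0)"
      by (rule ceE[OF assms], rule that)
  have R': "P x u \<longleftrightarrow> (\<exists>y. R (prod_encode (prod_encode (x, u), y)) = 0)" for x u
    using R(2)[of "prod_encode (x, u)"] by simp
  have "computable_fun (\<lambda>z. R (prod_encode (prod_encode (pfst z, pfst (psnd z)), psnd (psnd z))))"
    by (intro computable_comp[OF R(1)] computable_intros)
  then show ?thesis
    by (rule ceI) (simp add: R', metis pfst_pair psnd_pair)
qed

lemma ce_le:
  assumes "computable_fun f" "computable_fun g" shows "ce (\<lambda>x. f x \<le> g x)"
proof (rule ceI)
  show "computable_fun (\<lambda>z. f (pfst z) - g (pfst z))"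
    by (intro computable_diff computable_comp[OF assms(1)] computable_comp[OF assms(2)]
        computable_intros)
qed simp

lemma ce_less: "computable_fun f \<Longrightarrow> computable_fun g \<Longrightarrow> ce (\<lambda>x. f x < g x)"
  using ce_le[OF computable_Suc] by (simp add: Suc_le_eq)

lemma ce_eq: "computable_fun f \<Longrightarrow> computable_fun g \<Longrightarrow> ce (\<lambda>x. f x = g x)"
  using ce_conj[OF ce_le ce_le, of f g g f] by (simp add: order_eq_iff)

lemma ce_neq: "computable_fun f \<Longrightarrow> computable_fun g \<Longrightarrow> ce (\<lambda>x. f x \<noteq> g x)"
  using ce_disj[OF ce_less ce_less, of f g g f] by (simp add: neq_iff)

text \<open>Finitely many witnesses have a common bound b. The sum over i of the products over y < b
  vanishes exactly when every i has a witness below b, so one search for b suffices.\<close>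

lemma ce_all_less:
  assumes P: "ce (\<lambda>z. P (pfst z) (psnd z))" and n: "computable_fun n"
  shows "ce (\<lambda>x. \<forall>i<n x. P x i)"
proof -
  obtain R where R: "computable_fun R" "\<And>z. P (pfst z) (psnd z) \<longleftrightarrow> (\<exists>y. R (prod_encode (z, y)) = 0)"
      by (rule ceE[OF P], rule that)
  have R': "P x u \<longleftrightarrow> (\<exists>y. R (prod_encode (prod_encode (x, u), y)) = 0)" for x u
    using R(2)[of "prod_encode (x, u)"] by simp
  let ?S = "\<lambda>z. \<Sum>i<n (pfst z). \<Prod>y<psnd z. R (prod_encode (prod_encode (pfst z, i), y))"
  have "computable_fun ?S"
    by (intro computable_sum computable_prod computable_comp[OF n] computable_comp[OF R(1)]
        computable_intros)
  then show ?thesis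
  proof (rule ceI)
    fix x
    have "(\<forall>i<n x. P x i) \<longleftrightarrow> (\<exists>b. \<forall>i<n x. \<exists>y<b. R (prod_encode (prod_encode (x, i), y)) = 0)"
    proof
      assume "\<forall>i<n x. P x i"
      then have "\<forall>i\<in>{..<n x}. \<exists>y. R (prod_encode (prod_encode (x, i), y)) = 0" by (simp add: R')
      from bchoice[OF this] obtain w where w: "\<forall>i\<in>{..<n x}. R (prod_encode (prod_encode (x, i), w
          i)) = 0" ..
      have "w i < Suc (\<Sum>i<n x. w i)" if "i < n x" for i
        using member_le_sum[of i "{..<n x}" w] that by simp
      then show "\<exists>b. \<forall>i<n x. \<exists>y<b. R (prod_encode (prod_encode (x, i), y)) = 0"
        using w by (intro exI[of _ "Suc (\<Sum>i<n x. w i)"]) auto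
    qed (use R' in blast)
    then show "(\<forall>i<n x. P x i) \<longleftrightarrow> (\<exists>y. ?S (prod_encode (x, y)) = 0)"
      by (simp add: Ball_def Bex_def)
  qed
qed

section \<open>Coded lists\<close>

definition code_drop :: "nat \<Rightarrow> nat \<Rightarrow> nat" where
  "code_drop i s = rec_nat s (\<lambda>_ r. psnd (r - 1)) i"

definition code_nth :: "nat \<Rightarrow> nat \<Rightarrow> nat" where
  "code_nth s i = pfst (code_drop i s - 1)"

text \<open>A nonempty list has code \<open>Suc\<close> of the pair of its head and the code of its
  tail. The formula is also right at code 0, since 0 - 1 = 0 and 0 codes the pair (0, 0).\<close>

lemma list_decode_tl: "list_decode (psnd (r - 1)) = tl (list_decode r)"
proof (cases r)
  case 0
  have "prod_decode 0 = (0, 0)" using prod_encode_inverse[of "(0, 0)"] by (simp add: prod_encode_def)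
  then show ?thesis using 0 by (simp add: psnd_def)
qed (simp add: psnd_def split: prod.splits)

lemma list_decode_code_drop: "list_decode (code_drop i s) = drop i (list_decode s)"
  by (induction i) (simp_all add: code_drop_def list_decode_tl[unfolded One_nat_def] drop_Suc tl_drop)

lemma list_decode_eq_Nil: "list_decode r = [] \<longleftrightarrow> r = 0"
  by (metis list_decode.simps(1) list_decode_inverse list_encode.simps(1))

text \<open>A computable test for whether a position lies in the list, avoiding a computation of the
  length.\<close>

lemma code_drop_nonzero: "code_drop i s \<noteq> 0 \<longleftrightarrow> i < length (list_decode s)"
  using list_decode_eq_Nil[of "code_drop i s"] by (auto simp: list_decode_code_drop)

lemma code_nth: "i < length (list_decode s) \<Longrightarrow> code_nth s i = list_decode s ! i"
proof -
  assume i: "i < length (list_decode s)"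
  then obtain r where r: "code_drop i s = Suc r" using code_drop_nonzero by (metis not0_implies_Suc)
  have "list_decode (Suc r) = drop i (list_decode s)" using list_decode_code_drop[of i s] r by simp
  then have "hd (list_decode (Suc r)) = list_decode s ! i" using i by (simp add: hd_drop_conv_nth)
  then show ?thesis using r by (simp add: code_nth_def pfst_def split: prod.splits)
qed

lemma length_list_decode: "length (list_decode s) \<le> s"
proof -
  have "length xs \<le> list_encode xs" for xs
    by (induction xs) (auto intro: order_trans[OF _ le_prod_encode_2])
  from this[of "list_decode s"] show ?thesis by simp
qed

lemma computable_code_drop:
  assumes "computable_fun f" "computable_fun g" shows "computable_fun (\<lambda>x. code_drop (f x) (g x))"
  unfolding code_drop_def
  by (rule computable_rec[of g f "\<lambda>k r x. psnd (r - 1)", OF assms(2,1)]) (intro computable_intros)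

lemma computable_code_nth:
  assumes "computable_fun f" "computable_fun g" shows "computable_fun (\<lambda>x. code_nth (f x) (g x))"
  unfolding code_nth_def by (intro computable_intros computable_code_drop assms)

text \<open>A list is no longer than its code, so quantifying over entries becomes bounded
  quantification over positions, with positions past the end exempted.\<close>

lemma ce_list_all:
  assumes P: "ce (\<lambda>z. P (pfst z) (psnd z))" and s: "computable_fun s"
  shows "ce (\<lambda>x. \<forall>j\<in>set (list_decode (s x)). P x j)"
proof -
  have P': "ce (\<lambda>z. P (pfst z) (code_nth (s (pfst z)) (psnd z)))"
    using ce_subst[OF P computable_pair, of pfst "\<lambda>z. code_nth (s (pfst z)) (psnd z)"]
    by (simp add: computable_code_nth computable_comp[OF s] computable_pfst_psnd)
  have "ce (\<lambda>x. \<forall>i<s x. code_drop i (s x) = 0 \<or> P x (code_nth (s x) i))"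
    by (intro ce_all_less s ce_disj ce_eq P' computable_code_drop computable_intros
        computable_comp[OF s])
  moreover have "(\<forall>i<s x. code_drop i (s x) = 0 \<or> P x (code_nth (s x) i)) \<longleftrightarrow> (\<forall>j\<in>set (list_decode (s
      x)). P x j)" for x
  proof
    assume *: "\<forall>i<s x. code_drop i (s x) = 0 \<or> P x (code_nth (s x) i)"
    show "\<forall>j\<in>set (list_decode (s x)). P x j"
    proof
      fix j assume "j \<in> set (list_decode (s x))"
      then obtain i where i: "i < length (list_decode (s x))" "j = list_decode (s x) ! i"
        by (auto simp: in_set_conv_nth)
      then have "i < s x" using length_list_decode[of "s x"] by simp
      then show "P x j" using * i code_drop_nonzero code_nth by metis
    qed
  next
    assume "\<forall>j\<in>set (list_decode (s x)). P x j"
    then show "\<forall>i<s x. code_drop i (s x) = 0 \<or> P x (code_nth (s x) i)"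
      using code_drop_nonzero code_nth by (metis nth_mem)
  qed
  ultimately show ?thesis by simp
qed

lemma ce_list_ex:
  assumes P: "ce (\<lambda>z. P (pfst z) (psnd z))" and s: "computable_fun s"
  shows "ce (\<lambda>x. \<exists>j\<in>set (list_decode (s x)). P x j)"
proof -
  have P': "ce (\<lambda>z. P (pfst z) (code_nth (s (pfst z)) (psnd z)))"
    using ce_subst[OF P computable_pair, of pfst "\<lambda>z. code_nth (s (pfst z)) (psnd z)"]
    by (simp add: computable_code_nth computable_comp[OF s] computable_pfst_psnd)
  have "ce (\<lambda>x. \<exists>i. code_drop i (s x) \<noteq> 0 \<and> P x (code_nth (s x) i))"
    by (intro ce_ex ce_conj ce_neq P' computable_code_drop computable_intros computable_comp[OF s])
  moreover have "(\<exists>i. code_drop i (s x) \<noteq> 0 \<and> P x (code_nth (s x) i)) \<longleftrightarrow> (\<exists>j\<in>set (list_decode (s x)).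
      P x j)" for x
    using code_drop_nonzero code_nth by (metis in_set_conv_nth)
  ultimately show ?thesis by simp
qed

lemma ce_list_member:
  "computable_fun f \<Longrightarrow> computable_fun s \<Longrightarrow> ce (\<lambda>x. f x \<in> set (list_decode (s x)))"
  using ce_list_ex[of "\<lambda>x j. f x = j" s, OF ce_eq]
  by (simp add: computable_comp[of f] computable_pfst_psnd)

lemma ce_False: "ce (\<lambda>x. False)" by (simp add: ce_def comp_enumerable_def)

lemma ce_finite_ex: "finite T \<Longrightarrow> (\<And>t. t \<in> T \<Longrightarrow> ce (P t)) \<Longrightarrow> ce (\<lambda>x. \<exists>t\<in>T. P t x)"
  by (induction T rule: finite_induct) (simp_all add: ce_False ce_disj)

lemma comp_enumerable_seqs_ce: "comp_enumerable_seqs S \<Longrightarrow> ce (\<lambda>s. list_decode s \<in> S)"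
proof -
  assume S: "comp_enumerable_seqs S"
  have "{s. list_decode s \<in> S} = list_encode ` S"
    by (auto simp: image_iff) (metis list_decode_inverse)
  then show ?thesis using S by (simp add: ce_def comp_enumerable_seqs_def)
qed

section \<open>Recognizing covers by balls\<close>

text \<open>Two balls are recognized as disjoint when a single coordinate separates them; beyond the length
  of its code the coordinates of a finitary point are \<open>0\<close>, which is also what \<^const>\<open>code_nth\<close> returns.\<close>

definition coord_below :: "nat \<Rightarrow> nat \<Rightarrow> nat \<Rightarrow> bool" where
  "coord_below k i j \<longleftrightarrow>
     finitary_point (pfst i) k + 2 ^ k * (pos_rat (psnd i) + pos_rat (psnd j)) \<le> finitary_point
         (pfst j) k"

definition apart :: "nat \<Rightarrow> nat \<Rightarrow> bool" where
  "apart i j \<longleftrightarrow> (\<exists>k. coord_below k i j \<or> coord_below k j i)"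

text \<open>Truncated subtraction in the form a - (a - b) computes the minimum of a and b; this is
  the numerator of \<open>unit_rat\<close> after capping at 1.\<close>

definition unit_num :: "nat \<Rightarrow> nat" where
  "unit_num n = pfst n - (pfst n - Suc (psnd n))"

lemma unit_rat_eq: "unit_rat n = real (unit_num n) / real (Suc (psnd n))"
proof -
  obtain a b where ab: "prod_decode n = (a, b)" by fastforce
  then have "unit_num n = min a (Suc b)" by (simp add: unit_num_def pfst_def psnd_def)
  moreover have "unit_rat n = min 1 (real a / real (Suc b))"
    using ab by (simp add: unit_rat_def add.commute)
  moreover have "real (min a (Suc b)) / real (Suc b) = min 1 (real a / real (Suc b))"
  proof (cases "a \<le> Suc b")
    case True
    then have "real a / real (Suc b) \<le> 1" by simp
    then show ?thesis using True by (simp only: min_absorb1 min_absorb2)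
  next
    case False
    then have "1 \<le> real a / real (Suc b)" "Suc b \<le> a" by (simp_all add: le_divide_eq)
    then show ?thesis by (simp add: min_absorb1 min_absorb2 del: of_nat_Suc)
  qed
  ultimately show ?thesis using ab by (simp add: psnd_def)
qed

lemma pos_rat_eq: "pos_rat n = real (Suc (pfst n)) / real (Suc (psnd n))"
  by (simp add: pos_rat_def pfst_def psnd_def split: prod.splits)

lemma code_nth_beyond: "length (list_decode s) \<le> i \<Longrightarrow> code_nth s i = 0"
  using code_drop_nonzero[of i s] le_prod_encode_1[of "pfst 0" "psnd 0"] by (simp add: code_nth_def)

lemma finitary_point_eq: "finitary_point c k = unit_rat (code_nth c k)"
proof (cases "k < length (list_decode c)")
  case False
  have "unit_rat 0 = 0"
    using prod_encode_inverse[of "(0, 0)"] by (simp add: unit_rat_def prod_encode_def)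
  then show ?thesis using False by (simp add: finitary_point_def code_nth_beyond Let_def)
qed (simp add: finitary_point_def code_nth Let_def)

text \<open>Clearing denominators leaves an inequality between computable natural numbers, to which
  \<open>ce_le\<close> applies.\<close>

lemma coord_below_iff:
  "coord_below k i j \<longleftrightarrow>
    (let a = unit_num (code_nth (pfst i) k); b = Suc (psnd (code_nth (pfst i) k));
         a' = unit_num (code_nth (pfst j) k); b' = Suc (psnd (code_nth (pfst j) k));
         p = Suc (pfst (psnd i)); q = Suc (psnd (psnd i));
         p' = Suc (pfst (psnd j)); q' = Suc (psnd (psnd j))
     in a * (q * (q' * b')) + 2 ^ k * ((p * q' + p' * q) * (b * b')) \<le> a' * (b * (q * q')))"
proof -
  have *: "real a / real b + 2 ^ k * (real p / real q + real p' / real q') \<le> real a' / real b' \<longleftrightarrow>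
      a * (q * (q' * b')) + 2 ^ k * ((p * q' + p' * q) * (b * b')) \<le> a' * (b * (q * q'))"
    if "b > 0" "b' > 0" "q > 0" "q' > 0" for a b a' b' p q p' q' :: nat
  proof -
    let ?c = "real b * real b' * real q * real q'"
    have c: "?c > 0" using that by simp
    have 1: "(real a / real b + 2 ^ k * (real p / real q + real p' / real q')) * ?c =
        real (a * (q * (q' * b')) + 2 ^ k * ((p * q' + p' * q) * (b * b')))"
      using that by (simp add: field_simps)
    have 2: "real a' / real b' * ?c = real (a' * (b * (q * q')))"
      using that by (simp add: field_simps)
    have "real a / real b + 2 ^ k * (real p / real q + real p' / real q') \<le> real a' / real b' \<longleftrightarrow>
      (real a / real b + 2 ^ k * (real p / real q + real p' / real q')) * ?c \<le> real a' / real b' * ?c"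
      using c by (rule mult_le_cancel_right_pos[symmetric])
    then show ?thesis unfolding 1 2 of_nat_le_iff .
  qed
  show ?thesis
    unfolding coord_below_def finitary_point_eq unit_rat_eq pos_rat_eq Let_def
    by (rule *) simp_all
qed

lemma ce_coord_below:
  assumes "computable_fun h" "computable_fun f" "computable_fun g"
  shows "ce (\<lambda>x. coord_below (h x) (f x) (g x))"
  unfolding coord_below_iff Let_def unit_num_def
  by (intro ce_le computable_intros computable_code_nth assms)

lemma ce_apart:
  assumes "computable_fun f" "computable_fun g" shows "ce (\<lambda>x. apart (f x) (g x))"
  unfolding apart_def
  by (intro ce_ex ce_disj ce_coord_below computable_comp[OF assms(1)] computable_comp[OF assms(2)]
      computable_intros)

section \<open>Separating and refining balls\<close>

lemma std_ball_eq: "std_ball j = hball (finitary_point (pfst j)) (pos_rat (psnd j))"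
  by (simp add: std_ball_def pfst_def psnd_def split: prod.splits)

lemma finitary_point_cube: "finitary_point c \<in> hilbert_cube"
  using range_finitary_point by (auto simp: finitary_def)

lemma std_ball_subset: "std_ball j \<subseteq> hilbert_cube"
  by (auto simp: std_ball_eq hball_def)

text \<open>Coordinate k has weight 1 / 2^k in \<open>hdist\<close>; this is the source of the
  factor 2^k in \<open>coord_below\<close>.\<close>

lemma coord_dist_le:
  assumes "x \<in> hilbert_cube" "y \<in> hilbert_cube"
  shows "\<bar>x k - y k\<bar> \<le> 2 ^ k * hdist x y"
proof -
  have "(\<Sum>i\<in>{k}. (1 / 2) ^ i * \<bar>x i - y i\<bar>) \<le> hdist x y"
    unfolding hdist_def by (rule sum_le_suminf[OF hdist_summable[OF assms]]) auto
  then show ?thesis by (simp add: field_simps)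
qed

lemma std_ball_coord:
  assumes "y \<in> std_ball j"
  shows "\<bar>finitary_point (pfst j) k - y k\<bar> < 2 ^ k * pos_rat (psnd j)"
proof -
  have y: "y \<in> hilbert_cube" "hdist (finitary_point (pfst j)) y < pos_rat (psnd j)"
    using assms by (auto simp: std_ball_eq hball_def)
  have "\<bar>finitary_point (pfst j) k - y k\<bar> \<le> 2 ^ k * hdist (finitary_point (pfst j)) y"
    by (rule coord_dist_le[OF finitary_point_cube y(1)])
  also have "\<dots> < 2 ^ k * pos_rat (psnd j)" using y(2) by simp
  finally show ?thesis .
qed

lemma apart_disjoint:
  assumes "apart i j" shows "std_ball i \<inter> std_ball j = {}"
proof (rule ccontr)
  assume "std_ball i \<inter> std_ball j \<noteq> {}"
  then obtain y where y: "y \<in> std_ball i" "y \<in> std_ball j" by auto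
  obtain k where "coord_below k i j \<or> coord_below k j i" using assms by (auto simp: apart_def)
  then show False
    using std_ball_coord[OF y(1), of k] std_ball_coord[OF y(2), of k]
    by (auto simp: coord_below_def distrib_left abs_if split: if_splits)
qed

text \<open>A converse of \<open>apart_disjoint\<close> at fine scales. Disjoint balls may fail to
  be separated by any single coordinate, but compactness of the product gives one gap that, suitably
  weighted, every pair of points exhibits in some coordinate.\<close>

lemma compact_disjoint_apart:
  fixes C C' :: "(nat \<Rightarrow> real) set"
  assumes "compact C" "compact C'" "C \<inter> C' = {}"
  obtains \<eta> where "\<eta> > 0"
    "\<And>i j. pos_rat (psnd i) < \<eta> \<Longrightarrow> pos_rat (psnd j) < \<eta> \<Longrightarrow> std_ball i \<inter> C \<noteq> {} \<Longrightarrow>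
       std_ball j \<inter> C' \<noteq> {} \<Longrightarrow> apart i j"
proof -
  define U where "U = (\<lambda>n::nat. \<Union>k. {p :: (nat \<Rightarrow> real) \<times> (nat \<Rightarrow> real). 2 ^ k * (4 / real (Suc n)) <
      \<bar>fst p k - snd p k\<bar>})"
  have cont: "continuous_on UNIV (\<lambda>p :: (nat \<Rightarrow> real) \<times> (nat \<Rightarrow> real). \<bar>fst p k - snd p k\<bar>)" for k
    by (intro continuous_intros continuous_on_product_then_coordinatewise[of UNIV fst]
        continuous_on_product_then_coordinatewise[of UNIV snd])
  have op: "open (U n)" for n
    unfolding U_def by (intro open_UN ballI open_Collect_less cont continuous_on_const)
  have cov: "C \<times> C' \<subseteq> (\<Union>n\<in>UNIV. U n)"
  proof
    fix p assume p: "p \<in> C \<times> C'"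
    then have "fst p \<noteq> snd p" using assms(3) by auto
    then obtain k where "0 < \<bar>fst p k - snd p k\<bar>" by (auto simp: fun_eq_iff)
    then obtain n where "inverse (real (Suc n)) < \<bar>fst p k - snd p k\<bar> / (4 * 2 ^ k)"
      using reals_Archimedean[of "\<bar>fst p k - snd p k\<bar> / (4 * 2 ^ k)"] by auto
    then have "2 ^ k * (4 / real (Suc n)) < \<bar>fst p k - snd p k\<bar>" by (simp add: field_simps)
    then show "p \<in> (\<Union>n\<in>UNIV. U n)" unfolding U_def by blast
  qed
  have mono: "U m \<subseteq> U n" if "m \<le> n" for m n
  proof
    fix p assume "p \<in> U m"
    then obtain k where k: "2 ^ k * (4 / real (Suc m)) < \<bar>fst p k - snd p k\<bar>" unfolding U_def by blast
    have "2 ^ k * (4 / real (Suc n)) \<le> 2 ^ k * (4 / real (Suc m))"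
      using that by (intro mult_left_mono frac_le) auto
    then have "2 ^ k * (4 / real (Suc n)) < \<bar>fst p k - snd p k\<bar>" using k by (rule le_less_trans)
    then show "p \<in> U n" unfolding U_def by blast
  qed
  obtain N where "N \<subseteq> UNIV" and N: "finite N" "C \<times> C' \<subseteq> (\<Union>n\<in>N. U n)"
    by (rule compactE_image[OF compact_Times[OF assms(1,2)] op cov])
  define n where "n = Max (insert 0 N)"
  have n: "C \<times> C' \<subseteq> U n"
  proof
    fix p assume "p \<in> C \<times> C'"
    then obtain m where m: "m \<in> N" "p \<in> U m" using N(2) by blast
    then have "m \<le> n" using N(1) by (simp add: n_def)
    then show "p \<in> U n" using mono m(2) by blast
  qed
  \<comment> \<open>A quarter of the gap: each centre is less than 2^k * \<eta> from its point, and
    the two radii together take less than 2 * \<eta>.\<close>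
  define \<eta> where "\<eta> = 1 / real (Suc n)"
  show thesis
  proof (rule that[of \<eta>])
    show "\<eta> > 0" by (simp add: \<eta>_def)
    fix i j assume r: "pos_rat (psnd i) < \<eta>" "pos_rat (psnd j) < \<eta>" and "std_ball i \<inter> C \<noteq> {}"
        "std_ball j \<inter> C' \<noteq> {}"
    then obtain x y where x: "x \<in> std_ball i" "x \<in> C" and y: "y \<in> std_ball j" "y \<in> C'" by auto
    then have "(x, y) \<in> U n" using n by auto
    then obtain k where k: "2 ^ k * (4 * \<eta>) < \<bar>x k - y k\<bar>" by (auto simp: U_def \<eta>_def)
    define P where "P = (2::real) ^ k"
    have P: "P > 0" by (simp add: P_def)
    have "P * pos_rat (psnd i) < P * \<eta>" "P * pos_rat (psnd j) < P * \<eta>" using r P by simp_all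
    then have "coord_below k i j \<or> coord_below k j i"
      using k std_ball_coord[OF x(1), of k] std_ball_coord[OF y(1), of k]
      unfolding coord_below_def P_def[symmetric] distrib_left
      by (simp add: abs_if split: if_splits)
    then show "apart i j" by (auto simp: apart_def)
  qed
qed

lemma openin_std_ball: "openin (top_of_set hilbert_cube) (std_ball j)"
  unfolding openin_hilbert_cube_iff
proof (intro conjI ballI std_ball_subset)
  fix y assume y: "y \<in> std_ball j"
  let ?c = "finitary_point (pfst j)" and ?r = "pos_rat (psnd j)"
  have yc: "y \<in> hilbert_cube" "hdist ?c y < ?r" using y by (auto simp: std_ball_eq hball_def)
  have "hball y (?r - hdist ?c y) \<subseteq> std_ball j"
  proof
    fix z assume z: "z \<in> hball y (?r - hdist ?c y)"
    then have "hdist ?c z \<le> hdist ?c y + hdist y z"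
      by (intro hdist_triangle finitary_point_cube yc) (simp add: hball_def)
    then show "z \<in> std_ball j" using z by (simp add: std_ball_eq hball_def)
  qed
  then show "\<exists>r>0. hball y r \<subseteq> std_ball j" using yc by (intro exI[of _ "?r - hdist ?c y"]) simp
qed

lemma small_std_ball_exists:
  assumes y: "y \<in> hilbert_cube" and \<eta>: "\<eta> > 0"
  obtains j where "pos_rat (psnd j) < \<eta>" "y \<in> std_ball j"
proof -
  obtain r where r: "r \<in> \<rat>" "0 < r" "r < \<eta>" using Rats_dense_in_real[OF \<eta>] by blast
  then have "r \<in> range pos_rat" by (simp add: range_pos_rat)
  then obtain m where m: "r = pos_rat m" by blast
  \<comment> \<open>The centre approximates the first n coordinates of y to within r / 4 and is 0
    afterwards. The tail costs at most 2 * (1/2)^n < r / 2, and the head at most 2 * (r /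
    4).\<close>
  have lim: "(\<lambda>n. 2 * (1/2::real) ^ n) \<longlonglongrightarrow> 2 * 0" by (intro tendsto_mult LIMSEQ_realpow_zero
      tendsto_const) auto
  have "\<forall>\<^sub>F n in sequentially. 2 * (1/2) ^ n < r / 2"
    by (rule order_tendstoD(2)[OF lim]) (use r in simp)
  then obtain n where n: "2 * (1/2) ^ n < r / 2" by (auto simp: eventually_sequentially)
  have "\<exists>c. c \<in> \<rat> \<inter> {0..1} \<and> \<bar>c - y i\<bar> < r / 4" for i
  proof -
    have yi: "0 \<le> y i" "y i \<le> 1" using y by (auto simp: hilbert_cube_def)
    have "max 0 (y i - r / 4) < min 1 (y i + r / 4)" using yi r by auto
    then obtain c where "c \<in> \<rat>" "max 0 (y i - r / 4) < c" "c < min 1 (y i + r / 4)"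
      using Rats_dense_in_real by blast
    moreover from this have "\<bar>c - y i\<bar> < r / 4" unfolding abs_less_iff by simp
    ultimately show ?thesis by (intro exI[of _ c]) simp
  qed
  then obtain a where a: "\<And>i. a i \<in> \<rat> \<inter> {0..1}" "\<And>i. \<bar>a i - y i\<bar> < r / 4" by metis
  define c where "c = (\<lambda>i. if i < n then a i else 0)"
  have "finitary c"
    using a(1) by (auto simp: finitary_def hilbert_cube_def c_def intro!: exI[of _ n])
  then obtain k where k: "c = finitary_point k" using range_finitary_point by (metis imageE
      mem_Collect_eq)
  have cc: "c \<in> hilbert_cube" using k finitary_point_cube by simp
  let ?f = "\<lambda>i. (1 / 2) ^ i * \<bar>c i - y i\<bar>"
  have sm: "summable ?f" by (rule hdist_summable[OF cc y])
  have geo: "(\<Sum>i. (1/2::real) ^ i) = 2" "summable (\<lambda>i. (1/2::real) ^ i)"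
    by (simp_all add: suminf_geometric summable_geometric)
  have "hdist c y = (\<Sum>i. ?f (i + n)) + (\<Sum>i<n. ?f i)"
    unfolding hdist_def by (rule suminf_split_initial_segment[OF sm])
  also have "(\<Sum>i. ?f (i + n)) \<le> (\<Sum>i. (1/2) ^ n * (1/2) ^ i)"
  proof (rule suminf_le)
    show "?f (i + n) \<le> (1/2) ^ n * (1/2) ^ i" for i
      using hdist_term_le[OF cc y, of "i + n"] by (simp add: power_add mult.commute)
  qed (use sm geo in \<open>auto intro: summable_ignore_initial_segment summable_mult\<close>)
  also have "\<dots> = 2 * (1/2) ^ n" using suminf_mult[OF geo(2), of "(1/2) ^ n"] geo(1) by simp
  also have "(\<Sum>i<n. ?f i) \<le> (\<Sum>i<n. (1/2) ^ i * (r / 4))"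
    using a(2) by (intro sum_mono mult_left_mono) (auto simp: c_def less_imp_le)
  also have "\<dots> = (\<Sum>i<n. (1/2) ^ i) * (r / 4)" by (simp add: sum_distrib_right)
  also have "\<dots> \<le> 2 * (r / 4)"
    using sum_le_suminf[OF geo(2), of "{..<n}"] geo(1) r by (intro mult_right_mono) auto
  finally have "hdist c y < r" using n by simp
  then have "y \<in> std_ball (prod_encode (k, m))"
    using y k m by (simp add: std_ball_eq hball_def)
  then show thesis using that[of "prod_encode (k, m)"] m r by simp
qed

lemma fine_ball_cover:
  assumes E: "compact E" "E \<subseteq> hilbert_cube" and \<eta>: "\<eta> > 0"
  obtains J where "finite J" "E \<subseteq> (\<Union>j\<in>J. std_ball j)"
    "\<And>j. j \<in> J \<Longrightarrow> pos_rat (psnd j) < \<eta> \<and> std_ball j \<inter> E \<noteq> {}"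
proof -
  obtain U where U: "\<And>j. open (U j)" "\<And>j. std_ball j = hilbert_cube \<inter> U j"
    using openin_std_ball unfolding openin_open by metis
  let ?J = "{j. pos_rat (psnd j) < \<eta> \<and> std_ball j \<inter> E \<noteq> {}}"
  have cov: "E \<subseteq> (\<Union>j\<in>?J. U j)"
  proof
    fix y assume y: "y \<in> E"
    then obtain j where "pos_rat (psnd j) < \<eta>" "y \<in> std_ball j"
      using small_std_ball_exists[of y \<eta>] E(2) \<eta> by blast
    then show "y \<in> (\<Union>j\<in>?J. U j)" using y U(2) by blast
  qed
  obtain J where J: "J \<subseteq> ?J" "finite J" "E \<subseteq> (\<Union>j\<in>J. U j)"
    by (rule compactE_image[OF E(1) U(1) cov])
  have "E \<subseteq> (\<Union>j\<in>J. std_ball j)" using J(3) E(2) U(2) by blast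
  then show thesis using that[of J] J by blast
qed

text \<open>The list \<open>u\<close> attaches labels to balls. Together with the ball \<open>i\<close>, the balls with labels in
    \<open>L\<close> belong to
  a cover \<open>s\<close> in \<open>\<S>\<close> and those with labels in \<open>LA\<close> to a cover \<open>t\<close> in \<open>\<A>\<close>; only balls with close
      labels may
  overlap, and a ball with label \<open>l\<close> avoids the fixed balls that \<open>sep\<close> assigns to \<open>l\<close>.\<close>

definition cover_witness ::
  "nat list set \<Rightarrow> nat list set \<Rightarrow> nat \<Rightarrow> nat \<Rightarrow> nat \<Rightarrow> nat \<Rightarrow> nat \<Rightarrow> nat \<Rightarrow> nat \<Rightarrow> nat \<Rightarrow> bool" where
  "cover_witness \<S> \<A> L LA close sep i u s t \<longleftrightarrow>
     list_decode s \<in> \<S> \<and> list_decode t \<in> \<A> \<and>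
     (\<forall>j\<in>set (list_decode s). j = i \<or>
        (\<exists>l\<in>set (list_decode L). prod_encode (j, l) \<in> set (list_decode u))) \<and>
     (\<forall>j\<in>set (list_decode t). j = i \<or>
        (\<exists>l\<in>set (list_decode LA). prod_encode (j, l) \<in> set (list_decode u))) \<and>
     (\<forall>e\<in>set (list_decode u). \<forall>e'\<in>set (list_decode u).
        prod_encode (psnd e, psnd e') \<in> set (list_decode close) \<or> apart (pfst e) (pfst e')) \<and>
     (\<forall>e\<in>set (list_decode u). \<forall>m\<in>set (list_decode sep).
        psnd e \<noteq> pfst m \<or> apart (pfst e) (psnd m))"

text \<open>The atoms are enumerable and the universal quantifiers range over coded lists. L, LA,
  close and sep are constants of the enumeration: the claim holds for each fixed choice, however it
  was obtained.\<close>

lemma ce_cover_witness: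
  assumes "comp_enumerable_seqs \<S>" "comp_enumerable_seqs \<A>"
  shows "ce (\<lambda>i. \<exists>u s t. cover_witness \<S> \<A> L LA close sep i u s t)"
  unfolding cover_witness_def
  by (intro ce_ex ce_conj ce_disj ce_list_all ce_list_ex ce_list_member ce_eq ce_neq ce_apart
      ce_subst[OF comp_enumerable_seqs_ce[OF assms(1)]] ce_subst[OF comp_enumerable_seqs_ce[OF assms(2)]]
      computable_intros)

section \<open>Computable type\<close>

lemma compact_finite_net:
  assumes "compact S" "\<delta> > 0"
  obtains D where "finite D" "D \<subseteq> S" "\<And>x. x \<in> S \<Longrightarrow> \<exists>y\<in>D. dist x y < \<delta>"
proof -
  have "S \<subseteq> (\<Union>y\<in>S. ball y \<delta>)" using assms(2) by auto
  then obtain D where "D \<subseteq> S" "finite D" "S \<subseteq> (\<Union>y\<in>D. ball y \<delta>)"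
    by (rule compactE_image[OF assms(1) open_ball])
  then show thesis using that[of D] by (fastforce simp: dist_commute)
qed

locale embedded_complex =
  fixes K :: "'a::euclidean_space set set" and X' A' :: "(nat \<Rightarrow> real) set"
    and f :: "'a \<Rightarrow> nat \<Rightarrow> real" and \<phi> :: "(nat \<Rightarrow> real) \<Rightarrow> 'a"
  assumes K: "simplicial_complex K" and hom: "homeomorphism (\<Union>K) X' f \<phi>"
    and cube: "X' \<subseteq> hilbert_cube" and A': "A' = f ` \<Union>(odd_subcomplex K)"
begin

lemma f_cont: "continuous_on (\<Union>K) f" and phi_cont: "continuous_on X' \<phi>"
  and phi_f: "x \<in> \<Union>K \<Longrightarrow> \<phi> (f x) = x" and f_phi: "y \<in> X' \<Longrightarrow> f (\<phi> y) = y"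
  and f_img: "f ` \<Union>K = X'" and phi_img: "\<phi> ` X' = \<Union>K"
  using hom unfolding homeomorphism_def by auto

lemma compact_X': "compact X'"
  using compact_continuous_image[OF f_cont compact_Union_subset[OF K order_refl]] f_img by simp

lemma A'_subset: "A' \<subseteq> X'"
  using A' odd_subcomplex_subset[OF K] f_img by blast

text \<open>Balls are open only relative to the cube; pulled back to the complex, a ball is the
  trace of an open set of the Euclidean space.\<close>

lemma ball_preimage:
  obtains V where "open V" "\<And>x. x \<in> \<Union>K \<Longrightarrow> x \<in> V \<longleftrightarrow> f x \<in> std_ball j"
proof -
  obtain U where U: "open U" "std_ball j = hilbert_cube \<inter> U"
    using openin_std_ball unfolding openin_open by metis
  obtain V where V: "open V" "V \<inter> \<Union>K = f -` U \<inter> \<Union>K"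
    using f_cont U(1) unfolding continuous_on_open_invariant by blast
  show thesis
  proof (rule that[OF V(1)])
    fix x assume x: "x \<in> \<Union>K"
    then have "f x \<in> hilbert_cube" using f_img cube by blast
    then show "x \<in> V \<longleftrightarrow> f x \<in> std_ball j" using U(2) V(2) x by blast
  qed
qed

text \<open>A label \<open>l\<close> stands for a pair of points: a ball labelled \<open>l\<close> is meant to be sent near \<open>px l\<close>
    by \<open>\<phi>\<close> and
  near \<open>pw l\<close> by a push.\<close>

lemma coarse_push_if_witness:
  fixes px pw :: "nat \<Rightarrow> 'a"
  assumes wit: "cover_witness {js. X' \<subseteq> (\<Union>j\<in>set js. std_ball j)} {js. A' \<subseteq> (\<Union>j\<in>set js. std_ball j)}
      L LA close sep i u s t"
    and disj: "X' \<inter> std_ball i = {}"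
    and LA: "set (list_decode LA) \<subseteq> set (list_decode L)"
    and lab: "\<And>l. l \<in> set (list_decode L) \<Longrightarrow> pw l \<in> \<Union>(K - {T}) \<and> (\<exists>S\<in>K. px l \<in> S \<and> pw l \<in> S)"
    and labA: "\<And>l. l \<in> set (list_decode LA) \<Longrightarrow> pw l = px l"
    and cl: "\<And>l l'. prod_encode (l, l') \<in> set (list_decode close) \<Longrightarrow> dist (pw l) (pw l') \<le> \<delta> / 2"
    and sp: "\<And>l y. l \<in> set (list_decode L) \<Longrightarrow> y \<in> X' \<Longrightarrow>
       (\<And>m. prod_encode (l, m) \<in> set (list_decode sep) \<Longrightarrow> y \<notin> std_ball m) \<Longrightarrow> dist (\<phi> y) (px l) \<le> \<delta>"
  shows "\<exists>g. coarse_push K T \<delta> g"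
proof -
  let ?u = "set (list_decode u)"
  have w: "X' \<subseteq> (\<Union>j\<in>set (list_decode s). std_ball j)" "A' \<subseteq> (\<Union>j\<in>set (list_decode t). std_ball j)"
    and wu: "\<And>j. j \<in> set (list_decode s) \<Longrightarrow> j \<noteq> i \<Longrightarrow> \<exists>l\<in>set (list_decode L). prod_encode (j, l) \<in> ?u"
    and wt: "\<And>j. j \<in> set (list_decode t) \<Longrightarrow> j \<noteq> i \<Longrightarrow> \<exists>l\<in>set (list_decode LA). prod_encode (j, l) \<in> ?u"
    and we: "\<And>e e'. e \<in> ?u \<Longrightarrow> e' \<in> ?u \<Longrightarrow>
          prod_encode (psnd e, psnd e') \<in> set (list_decode close) \<or> apart (pfst e) (pfst e')"
    and wm: "\<And>e m. e \<in> ?u \<Longrightarrow> m \<in> set (list_decode sep) \<Longrightarrow> psnd e \<noteq> pfst m \<or> apart (pfst e) (psnd m)"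
    using wit unfolding cover_witness_def mem_Collect_eq by blast+
  have ex: "\<exists>e\<in>?u. psnd e \<in> set (list_decode L) \<and> f x \<in> std_ball (pfst e) \<and>
      (x \<in> \<Union>(odd_subcomplex K) \<longrightarrow> psnd e \<in> set (list_decode LA))" if x: "x \<in> \<Union>K" for x
  proof (cases "x \<in> \<Union>(odd_subcomplex K)")
    case True
    then have "f x \<in> A'" using A' by blast
    then obtain j where j: "j \<in> set (list_decode t)" "f x \<in> std_ball j" using w(2) by blast
    have "j \<noteq> i" using j(2) disj x f_img by blast
    then obtain l where "l \<in> set (list_decode LA)" "prod_encode (j, l) \<in> ?u" using wt j(1) by blast
    then show ?thesis using j(2) LA by (intro bexI[of _ "prod_encode (j, l)"]) auto
  next
    case False
    have "f x \<in> X'" using x f_img by blast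
    then obtain j where j: "j \<in> set (list_decode s)" "f x \<in> std_ball j" using w(1) by blast
    have "j \<noteq> i" using j(2) disj x f_img by blast
    then obtain l where "l \<in> set (list_decode L)" "prod_encode (j, l) \<in> ?u" using wu j(1) by blast
    then show ?thesis using j(2) False by (intro bexI[of _ "prod_encode (j, l)"]) auto
  qed
  from bchoice[OF ballI[OF ex[unfolded Bex_def]]] obtain ent where
    ent: "\<forall>x\<in>\<Union>K. ent x \<in> ?u \<and> psnd (ent x) \<in> set (list_decode L) \<and> f x \<in> std_ball (pfst (ent x)) \<and>
      (x \<in> \<Union>(odd_subcomplex K) \<longrightarrow> psnd (ent x) \<in> set (list_decode LA))" ..
  have entD: "ent x \<in> ?u" "psnd (ent x) \<in> set (list_decode L)" "f x \<in> std_ball (pfst (ent x))"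
    if "x \<in> \<Union>K" for x
    using bspec[OF ent that] by blast+
  have entA: "psnd (ent x) \<in> set (list_decode LA)" if "x \<in> \<Union>K" "x \<in> \<Union>(odd_subcomplex K)" for x
    using bspec[OF ent that(1)] that(2) by blast
  define lb where "lb = (\<lambda>x. psnd (ent x))"
  define g where "g = (\<lambda>x. pw (lb x))"
  have cls: "dist (pw (psnd e)) (pw (psnd e')) \<le> \<delta> / 2"
    if "e \<in> ?u" "e' \<in> ?u" "y \<in> std_ball (pfst e)" "y \<in> std_ball (pfst e')" for e e' y
    using we[OF that(1,2)] apart_disjoint[of "pfst e" "pfst e'"] that(3,4) cl by blast
  have px: "dist x (px (lb x)) \<le> \<delta>" if x: "x \<in> \<Union>K" for x
  proof -
    have "dist (\<phi> (f x)) (px (lb x)) \<le> \<delta>"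
    proof (rule sp)
      show "lb x \<in> set (list_decode L)" unfolding lb_def by (rule entD(2)[OF x])
      show "f x \<in> X'" using x f_img by blast
      fix m assume "prod_encode (lb x, m) \<in> set (list_decode sep)"
      moreover have "ent x \<in> ?u" by (rule entD(1)[OF x])
      ultimately have "apart (pfst (ent x)) m" using wm[of "ent x" "prod_encode (lb x, m)"] by (simp
          add: lb_def)
      then show "f x \<notin> std_ball m" using apart_disjoint entD(3)[OF x] by blast
    qed
    then show ?thesis using phi_f[OF x] by simp
  qed
  have "\<forall>j. \<exists>V. open V \<and> (\<forall>x\<in>\<Union>K. x \<in> V \<longleftrightarrow> f x \<in> std_ball j)"
    using ball_preimage by metis
  from choice[OF this] obtain V where
    V: "\<forall>j. open (V j) \<and> (\<forall>x\<in>\<Union>K. x \<in> V j \<longleftrightarrow> f x \<in> std_ball j)" ..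
  have "\<Union>K \<subseteq> \<Union>((\<lambda>e. V (pfst e)) ` ?u)"
  proof
    fix x assume x: "x \<in> \<Union>K"
    then have "x \<in> V (pfst (ent x))" "ent x \<in> ?u" using V entD by blast+
    then show "x \<in> \<Union>((\<lambda>e. V (pfst e)) ` ?u)" by blast
  qed
  moreover have "open G" if "G \<in> (\<lambda>e. V (pfst e)) ` ?u" for G using that V by blast
  \<comment> \<open>A Lebesgue number of the cover by labelled balls: points closer than \<eta>
    share a ball, and both their labels are within \<delta> / 2 of the label of that ball.\<close>
  ultimately obtain \<eta> where \<eta>: "\<eta> > 0" "\<forall>x\<in>\<Union>K. \<exists>G\<in>(\<lambda>e. V (pfst e)) ` ?u. ball x \<eta> \<subseteq> G"
    using Heine_Borel_lemma[OF compact_Union_subset[OF K order_refl]] by metis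
  have "coarse_push K T \<delta> g"
    unfolding coarse_push_def
  proof (intro conjI ballI exI[of _ \<eta>] \<eta>(1) impI)
    fix x assume x: "x \<in> \<Union>K"
    have lx: "lb x \<in> set (list_decode L)" unfolding lb_def by (rule entD(2)[OF x])
    show "g x \<in> \<Union>(K - {T})" using lab[OF lx] by (simp add: g_def)
    show "\<exists>y. dist x y \<le> \<delta> \<and> (\<exists>S\<in>K. y \<in> S \<and> g x \<in> S)"
      using px[OF x] lab[OF lx] unfolding g_def by blast
    fix x' assume x': "x' \<in> \<Union>K" and d: "dist x x' < \<eta>"
    obtain e where e: "e \<in> ?u" "ball x \<eta> \<subseteq> V (pfst e)" using \<eta> x by blast
    have "x \<in> V (pfst e)" "x' \<in> V (pfst e)" using e(2) d \<eta>(1) by auto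
    then have fe: "f x \<in> std_ball (pfst e)" "f x' \<in> std_ball (pfst e)" using V x x' by blast+
    have "dist (g x) (pw (psnd e)) \<le> \<delta> / 2" "dist (g x') (pw (psnd e)) \<le> \<delta> / 2"
      unfolding g_def lb_def
      by (rule cls[OF entD(1)[OF x] e(1) entD(3)[OF x] fe(1)],
          rule cls[OF entD(1)[OF x'] e(1) entD(3)[OF x'] fe(2)])
    then show "dist (g x) (g x') \<le> \<delta>"
      using dist_triangle2[of "g x" "g x'" "pw (psnd e)"] by linarith
  next
    fix x assume xA: "x \<in> \<Union>(odd_subcomplex K)"
    then have x: "x \<in> \<Union>K" using odd_subcomplex_subset[OF K] by blast
    have "g x = px (lb x)" unfolding g_def lb_def by (rule labA[OF entA[OF x xA]])
    then show "dist (g x) x \<le> \<delta>" using px[OF x] by (simp add: dist_commute)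
  qed
  then show ?thesis by blast
qed

text \<open>Soundness is \<open>no_coarse_push\<close>; for the other direction, radial projection
  from q labels the part of \<open>X'\<close> outside the ball. It suffices to catch balls that meet
  the image of the interior of T, since these interiors are jointly dense.\<close>

lemma detect_maximal_simplex:
  assumes T: "maximal_simplex K T" "T \<noteq> {}"
    and sc: "semicomputable X'" "semicomputable A'"
  shows "\<exists>P. ce P \<and> (\<forall>i. P i \<longrightarrow> X' \<inter> std_ball i \<noteq> {}) \<and>
    (\<forall>i q. q \<in> rel_interior T \<longrightarrow> f q \<in> std_ball i \<longrightarrow> P i)"
proof -
  let ?X = "{js. X' \<subseteq> (\<Union>j\<in>set js. std_ball j)}" and ?A = "{js. A' \<subseteq> (\<Union>j\<in>set js. std_ball j)}"
  have enum: "comp_enumerable_seqs ?X" "comp_enumerable_seqs ?A"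
    using sc by (auto simp: semicomputable_def)
  obtain \<delta> where \<delta>: "\<delta> > 0" and no: "\<And>g. \<not> coarse_push K T \<delta> g"
    using no_coarse_push[OF K T] by metis
  \<comment> \<open>Two labels used near one point have their pw within 2 * \<delta>' = \<delta> /
    2, the tolerance for close labels; and \<delta>' < \<delta> keeps C apart from E.\<close>
  define \<delta>' where "\<delta>' = \<delta> / 4"
  have \<delta>': "\<delta>' > 0" using \<delta> by (simp add: \<delta>'_def)
  define W where "W = \<Union>(K - {T})"
  define A where "A = \<Union>(odd_subcomplex K)"
  have AW: "A \<subseteq> W" unfolding A_def W_def by (rule odd_subcomplex_subset_Union[OF K T(1)])
  have cW: "compact W" unfolding W_def by (rule compact_Union_subset[OF K]) blast
  have cA: "compact A" unfolding A_def using odd_subcomplex_subset[OF K] by (intro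
      compact_Union_subset[OF K]) blast
  \<comment> \<open>All pairs that a point and its projection can form, whatever q is; so a finite
    net of this set provides labels independent of i.\<close>
  define \<Lambda> where "\<Lambda> = (\<Union>S\<in>K. S \<times> (S \<inter> W))"
  have "compact \<Lambda>" unfolding \<Lambda>_def
    by (intro compact_UN compact_Times compact_Int cW complex_finite[OF K] complex_compact[OF K])
  then obtain D where D: "finite D" "D \<subseteq> \<Lambda>" "\<And>p. p \<in> \<Lambda> \<Longrightarrow> \<exists>p'\<in>D. dist p p' < \<delta>'"
    using compact_finite_net[OF _ \<delta>'] by metis
  obtain DA where DA: "finite DA" "DA \<subseteq> A" "\<And>x. x \<in> A \<Longrightarrow> \<exists>y\<in>DA. dist x y < \<delta>'"
    using compact_finite_net[OF cA \<delta>'] by metis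
  have DA\<Lambda>: "(\<lambda>a. (a, a)) ` DA \<subseteq> \<Lambda>"
    using DA(2) AW odd_subcomplex_subset[OF K] unfolding \<Lambda>_def A_def by blast
  \<comment> \<open>Labels are positions in this list. A net of \<Lambda> may lack diagonal pairs,
    so they are added over DA: points of the odd subcomplex need a label with px equal to
    pw.\<close>
  obtain ls where ls: "set ls = D \<union> (\<lambda>a. (a, a)) ` DA"
    using finite_list[of "D \<union> (\<lambda>a. (a, a)) ` DA"] D(1) DA(1) by auto
  define N where "N = length ls"
  define px where "px = (\<lambda>l. fst (ls ! l))"
  define pw where "pw = (\<lambda>l. snd (ls ! l))"
  have ls\<Lambda>: "(px l, pw l) \<in> \<Lambda>" if "l < N" for l
    using nth_mem[of l ls] that ls D(2) DA\<Lambda> by (auto simp: N_def px_def pw_def)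
  define NA where "NA = {l. l < N \<and> pw l = px l}"
  have fNA: "finite NA" by (simp add: NA_def)

  \<comment> \<open>Balls labelled l must avoid E and will cover pieces of C. Both sets are
    independent of i, hence so are the threshold \<eta>1 and the balls M that enter the constant
    sep.\<close>
  define E where "E = (\<lambda>l. {y \<in> X'. \<phi> y \<in> - ball (px l) \<delta>})"
  define C where "C = (\<lambda>l. {y \<in> X'. \<phi> y \<in> cball (px l) \<delta>'})"
  have clo: "compact {y \<in> X'. \<phi> y \<in> B}" if "closed B" for B
  proof -
    have "closedin (top_of_set X') (X' \<inter> \<phi> -` B)"
      by (rule continuous_closedin_preimage[OF phi_cont that])
    moreover have "X' \<inter> \<phi> -` B = {y \<in> X'. \<phi> y \<in> B}" by auto
    ultimately show ?thesis using closedin_compact[OF compact_X'] by simp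
  qed
  have cE: "compact (E l)" and cC: "compact (C l)" for l
    unfolding E_def C_def by (intro clo closed_Compl open_ball closed_cball)+
  have EC: "C l \<inter> E l = {}" for l
    using \<delta>' by (auto simp: E_def C_def \<delta>'_def)
  have "\<exists>\<eta>>0. \<forall>i j. pos_rat (psnd i) < \<eta> \<longrightarrow> pos_rat (psnd j) < \<eta> \<longrightarrow> std_ball i \<inter> C l \<noteq> {} \<longrightarrow>
       std_ball j \<inter> E l \<noteq> {} \<longrightarrow> apart i j" for l
    by (rule compact_disjoint_apart[OF cC cE EC]) blast
  then obtain \<eta>1 where \<eta>1: "\<And>l. \<eta>1 l > 0"
    and \<eta>1a: "\<And>l i j. pos_rat (psnd i) < \<eta>1 l \<Longrightarrow> pos_rat (psnd j) < \<eta>1 l \<Longrightarrow> std_ball i \<inter> C l \<noteq> {} \<Longrightarrow>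
       std_ball j \<inter> E l \<noteq> {} \<Longrightarrow> apart i j"
    by metis
  have "\<exists>M. finite M \<and> E l \<subseteq> (\<Union>j\<in>M. std_ball j) \<and>
     (\<forall>j\<in>M. pos_rat (psnd j) < \<eta>1 l \<and> std_ball j \<inter> E l \<noteq> {})" for l
  proof -
    have "E l \<subseteq> hilbert_cube" using cube by (auto simp: E_def)
    from fine_ball_cover[OF cE this \<eta>1] show ?thesis by metis
  qed
  then obtain M where M: "\<And>l. finite (M l)" "\<And>l. E l \<subseteq> (\<Union>j\<in>M l. std_ball j)"
     "\<And>l j. j \<in> M l \<Longrightarrow> pos_rat (psnd j) < \<eta>1 l \<and> std_ball j \<inter> E l \<noteq> {}"
    by metis
  obtain L where L: "set (list_decode L) = {..<N}"
    using finite_list[of "{..<N}"] by (metis finite_lessThan list_encode_inverse)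
  obtain LA where LA: "set (list_decode LA) = NA"
    using finite_list[OF fNA] by (metis list_encode_inverse)
  define cset where "cset = {prod_encode (l, l') |l l'. l < N \<and> l' < N \<and> dist (pw l) (pw l') \<le> \<delta> / 2}"
  have "cset \<subseteq> prod_encode ` ({..<N} \<times> {..<N})" by (auto simp: cset_def)
  then have "finite cset" by (rule finite_subset) simp
  then obtain close where close: "set (list_decode close) = cset"
    using finite_list by (metis list_encode_inverse)
  define sset where "sset = (\<Union>l<N. (\<lambda>m. prod_encode (l, m)) ` M l)"
  have "finite sset" using M(1) by (simp add: sset_def)
  then obtain sep where sep: "set (list_decode sep) = sset"
    using finite_list by (metis list_encode_inverse)

  let ?P = "\<lambda>i. \<exists>u s t. cover_witness ?X ?A L LA close sep i u s t"
  have "ce ?P" by (rule ce_cover_witness[OF enum])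
  moreover have "X' \<inter> std_ball i \<noteq> {}" if wi: "?P i" for i
  proof
    assume disj: "X' \<inter> std_ball i = {}"
    obtain u s t where wit: "cover_witness ?X ?A L LA close sep i u s t" using wi by blast
    have "\<exists>g. coarse_push K T \<delta> g"
    proof (rule coarse_push_if_witness[OF wit disj, of pw T px \<delta>])
      show "set (list_decode LA) \<subseteq> set (list_decode L)" by (auto simp: L LA NA_def)
      show "pw l \<in> \<Union>(K - {T}) \<and> (\<exists>S\<in>K. px l \<in> S \<and> pw l \<in> S)" if "l \<in> set (list_decode L)" for l
      proof -
        have "(px l, pw l) \<in> \<Lambda>" using ls\<Lambda>[of l] that L by simp
        then show ?thesis unfolding \<Lambda>_def W_def by blast
      qed
      show "pw l = px l" if "l \<in> set (list_decode LA)" for l using that by (simp add: LA NA_def)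
      show "dist (pw l) (pw l') \<le> \<delta> / 2" if "prod_encode (l, l') \<in> set (list_decode close)" for l l'
        using that by (auto simp: close cset_def)
      show "dist (\<phi> y) (px l) \<le> \<delta>" if l: "l \<in> set (list_decode L)" and y: "y \<in> X'"
        and m: "\<And>m. prod_encode (l, m) \<in> set (list_decode sep) \<Longrightarrow> y \<notin> std_ball m" for l y
      proof -
        have "y \<notin> std_ball m" if "m \<in> M l" for m
          using m[of m] l that by (auto simp: sep sset_def L)
        then have "y \<notin> E l" using M(2)[of l] by blast
        then show ?thesis using y by (simp add: E_def dist_commute)
      qed
    qed
    then show False using no by blast
  qed
  moreover have "?P i" if q: "q \<in> rel_interior T" and fq: "f q \<in> std_ball i" for i q
  proof -
    obtain p where p: "continuous_on (\<Union>K - {q}) p" "p ` (\<Union>K - {q}) \<subseteq> W"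
      "\<And>x. x \<in> W \<Longrightarrow> p x = x"
      "\<And>x. x \<in> \<Union>K \<Longrightarrow> x \<noteq> q \<Longrightarrow> \<exists>S\<in>K. x \<in> S \<and> p x \<in> S"
      unfolding W_def by (rule maximal_simplex_push[OF K T(1) q]) blast
    define Y where "Y = X' - std_ball i"
    obtain U where U: "open U" "std_ball i = hilbert_cube \<inter> U"
      using openin_std_ball unfolding openin_open by metis
    have "Y = X' - U" using U(2) cube by (auto simp: Y_def)
    then have cY: "compact Y" using compact_diff[OF compact_X' U(1)] by simp
    have YK: "\<phi> y \<in> \<Union>K - {q}" if "y \<in> Y" for y
    proof -
      have "y \<in> X'" "y \<notin> std_ball i" using that by (auto simp: Y_def)
      moreover from this have "\<phi> y \<noteq> q" using fq f_phi by metis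
      ultimately show ?thesis using phi_img by blast
    qed
    have phiY: "continuous_on Y \<phi>" by (rule continuous_on_subset[OF phi_cont]) (auto simp: Y_def)
    have gY: "continuous_on Y (\<lambda>y. p (\<phi> y))"
      by (rule continuous_on_compose2[OF p(1) phiY]) (use YK in blast)
    \<comment> \<open>The pieces to be labelled l for the given ball i. Fine covers of them form u;
      pieces whose labels are not close are disjoint compact sets, so fine enough balls on them are
      apart.\<close>
    define G where "G = (\<lambda>l. {y \<in> Y. (\<phi> y, p (\<phi> y)) \<in> cball (px l) \<delta>' \<times> cball (pw l) \<delta>'})"
    have cG: "compact (G l)" for l
    proof -
      have "closedin (top_of_set Y) (Y \<inter> (\<lambda>y. (\<phi> y, p (\<phi> y))) -` (cball (px l) \<delta>' \<times> cball (pw l) \<delta>'))"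
        by (intro continuous_closedin_preimage continuous_on_Pair phiY gY closed_Times closed_cball)
      moreover have "Y \<inter> (\<lambda>y. (\<phi> y, p (\<phi> y))) -` (cball (px l) \<delta>' \<times> cball (pw l) \<delta>') = G l"
        by (auto simp: G_def)
      ultimately show ?thesis using closedin_compact[OF cY] by simp
    qed
    have GC: "G l \<subseteq> C l" for l by (auto simp: G_def C_def Y_def)
    have far: "G l \<inter> G l' = {}" if "\<not> dist (pw l) (pw l') \<le> \<delta> / 2" for l l'
    proof (rule ccontr)
      assume "G l \<inter> G l' \<noteq> {}"
      then obtain y where "dist (pw l) (p (\<phi> y)) \<le> \<delta>'" "dist (pw l') (p (\<phi> y)) \<le> \<delta>'" by (auto simp:
          G_def)
      then have "dist (pw l) (pw l') \<le> \<delta>' + \<delta>'"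
        using dist_triangle2[of "pw l" "pw l'" "p (\<phi> y)"] by linarith
      then show False using that by (simp add: \<delta>'_def)
    qed
    have "\<exists>\<eta>>0. \<not> dist (pw l) (pw l') \<le> \<delta> / 2 \<longrightarrow> (\<forall>i j. pos_rat (psnd i) < \<eta> \<longrightarrow> pos_rat (psnd j) < \<eta> \<longrightarrow>
       std_ball i \<inter> G l \<noteq> {} \<longrightarrow> std_ball j \<inter> G l' \<noteq> {} \<longrightarrow> apart i j)" for l l'
    proof (cases "dist (pw l) (pw l') \<le> \<delta> / 2")
      case False
      show ?thesis by (rule compact_disjoint_apart[OF cG cG far[OF False]]) blast
    qed (auto intro: exI[of _ 1])
    then obtain \<eta>2 where \<eta>2: "\<And>l l'. \<eta>2 l l' > 0"
      and \<eta>2a: "\<And>l l' i j. \<not> dist (pw l) (pw l') \<le> \<delta> / 2 \<Longrightarrow> pos_rat (psnd i) < \<eta>2 l l' \<Longrightarrow> pos_rat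
          (psnd j) < \<eta>2 l l' \<Longrightarrow>
       std_ball i \<inter> G l \<noteq> {} \<Longrightarrow> std_ball j \<inter> G l' \<noteq> {} \<Longrightarrow> apart i j"
      by metis
    define R where "R = insert 1 (\<eta>1 ` {..<N} \<union> (\<lambda>(l, l'). \<eta>2 l l') ` ({..<N} \<times> {..<N}))"
    define \<eta> where "\<eta> = Min R"
    have fR: "finite R" "R \<noteq> {}" by (auto simp: R_def)
    have \<eta>: "\<eta> > 0" unfolding \<eta>_def Min_gr_iff[OF fR] using \<eta>1 \<eta>2 by (auto simp: R_def)
    have \<eta>le1: "\<eta> \<le> \<eta>1 l" if "l < N" for l
      unfolding \<eta>_def by (rule Min_le[OF fR(1)]) (use that in \<open>simp add: R_def\<close>)
    have \<eta>le2: "\<eta> \<le> \<eta>2 l l'" if "l < N" "l' < N" for l l'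
      unfolding \<eta>_def by (rule Min_le[OF fR(1)]) (use that in \<open>force simp: R_def\<close>)
    have "\<exists>J. finite J \<and> G l \<subseteq> (\<Union>j\<in>J. std_ball j) \<and>
       (\<forall>j\<in>J. pos_rat (psnd j) < \<eta> \<and> std_ball j \<inter> G l \<noteq> {})" for l
    proof -
      have "G l \<subseteq> hilbert_cube" using cube by (auto simp: G_def Y_def)
      from fine_ball_cover[OF cG this \<eta>] show ?thesis by metis
    qed
    then obtain J where J: "\<And>l. finite (J l)" "\<And>l. G l \<subseteq> (\<Union>j\<in>J l. std_ball j)"
       "\<And>l j. j \<in> J l \<Longrightarrow> pos_rat (psnd j) < \<eta> \<and> std_ball j \<inter> G l \<noteq> {}"
      by metis
    define uset where "uset = (\<Union>l<N. (\<lambda>j. prod_encode (j, l)) ` J l)"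
    have "finite uset" using J(1) by (simp add: uset_def)
    then obtain u where u: "set (list_decode u) = uset" using finite_list by (metis list_encode_inverse)
    have "finite (insert i (\<Union>l<N. J l))" using J(1) by simp
    then obtain s where s: "set (list_decode s) = insert i (\<Union>l<N. J l)"
      using finite_list by (metis list_encode_inverse)
    have "finite (insert i (\<Union>l\<in>NA. J l))" using J(1) fNA by simp
    then obtain t where t: "set (list_decode t) = insert i (\<Union>l\<in>NA. J l)"
      using finite_list by (metis list_encode_inverse)
    have inG: "y \<in> G l" if "y \<in> Y" "dist (\<phi> y) (px l) < \<delta>'" "dist (p (\<phi> y)) (pw l) < \<delta>'" for y l
      using that by (simp add: G_def dist_commute less_imp_le)
    have "cover_witness ?X ?A L LA close sep i u s t"
      unfolding cover_witness_def mem_Collect_eq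
    proof (intro conjI ballI)
      show "X' \<subseteq> (\<Union>j\<in>set (list_decode s). std_ball j)"
      proof
        fix y assume y: "y \<in> X'"
        show "y \<in> (\<Union>j\<in>set (list_decode s). std_ball j)"
        proof (cases "y \<in> std_ball i")
          case False
          then have yY: "y \<in> Y" using y by (simp add: Y_def)
          have "\<exists>S\<in>K. \<phi> y \<in> S \<and> p (\<phi> y) \<in> S" "p (\<phi> y) \<in> W" using p(2,4) YK[OF yY] by blast+
          then have "(\<phi> y, p (\<phi> y)) \<in> \<Lambda>" by (auto simp: \<Lambda>_def)
          then obtain d where d: "d \<in> D" "dist (\<phi> y, p (\<phi> y)) d < \<delta>'" using D(3) by blast
          obtain l where l: "l < N" "ls ! l = d"
            using d(1) ls by (metis N_def UnCI in_set_conv_nth)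
          have "dist (\<phi> y) (px l) < \<delta>'" "dist (p (\<phi> y)) (pw l) < \<delta>'"
            using d(2) l(2) dist_fst_le[of "(\<phi> y, p (\<phi> y))" d] dist_snd_le[of "(\<phi> y, p (\<phi> y))" d]
            by (auto simp: px_def pw_def)
          then have "y \<in> G l" using inG yY by blast
          then show ?thesis using J(2) l(1) unfolding s by blast
        qed (simp add: s)
      qed
      show "A' \<subseteq> (\<Union>j\<in>set (list_decode t). std_ball j)"
      proof
        fix y assume y: "y \<in> A'"
        show "y \<in> (\<Union>j\<in>set (list_decode t). std_ball j)"
        proof (cases "y \<in> std_ball i")
          case False
          then have yY: "y \<in> Y" using y A'_subset by (auto simp: Y_def)
          obtain x where x: "x \<in> A" "y = f x" using y A' A_def by blast
          have "x \<in> \<Union>K" using x(1) odd_subcomplex_subset[OF K] unfolding A_def by blast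
          then have py: "\<phi> y = x" "p (\<phi> y) = x" using x phi_f p(3) AW by auto
          obtain a where a: "a \<in> DA" "dist x a < \<delta>'" using DA(3) x(1) by blast
          then have "(a, a) \<in> set ls" using ls by blast
          then obtain l where l: "l < N" "ls ! l = (a, a)" by (metis N_def in_set_conv_nth)
          have "y \<in> G l" by (rule inG[OF yY]) (use py a l in \<open>simp_all add: px_def pw_def\<close>)
          moreover have "l \<in> NA" using l by (simp add: NA_def px_def pw_def)
          ultimately show ?thesis using J(2) unfolding t by blast
        qed (simp add: t)
      qed
      show "j = i \<or> (\<exists>l\<in>set (list_decode L). prod_encode (j, l) \<in> set (list_decode u))"
        if "j \<in> set (list_decode s)" for j
        using that unfolding s L u uset_def by blast
      show "j = i \<or> (\<exists>l\<in>set (list_decode LA). prod_encode (j, l) \<in> set (list_decode u))"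
        if "j \<in> set (list_decode t)" for j
        using that unfolding t LA u uset_def NA_def by blast
    next
      fix e e' assume "e \<in> set (list_decode u)" "e' \<in> set (list_decode u)"
      then obtain l j l' j' where e: "l < N" "e = prod_encode (j, l)" "j \<in> J l"
          "l' < N" "e' = prod_encode (j', l')" "j' \<in> J l'"
        unfolding u uset_def by blast
      show "prod_encode (psnd e, psnd e') \<in> set (list_decode close) \<or> apart (pfst e) (pfst e')"
      proof (cases "dist (pw l) (pw l') \<le> \<delta> / 2")
        case True
        then show ?thesis using e unfolding close cset_def by auto
      next
        case False
        have "apart j j'"
          by (rule \<eta>2a[OF False]) (use J(3)[OF e(3)] J(3)[OF e(6)] \<eta>le2[OF e(1,4)] in auto)
        then show ?thesis using e by simp
      qed
    next
      fix e m assume "e \<in> set (list_decode u)" "m \<in> set (list_decode sep)"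
      then obtain l j l' n where e: "l < N" "e = prod_encode (j, l)" "j \<in> J l"
          "l' < N" "m = prod_encode (l', n)" "n \<in> M l'"
        unfolding u uset_def sep sset_def by blast
      show "psnd e \<noteq> pfst m \<or> apart (pfst e) (psnd m)"
      proof (cases "l = l'")
        case True
        have "apart j n"
        proof (rule \<eta>1a[of _ l])
          show "pos_rat (psnd j) < \<eta>1 l" using J(3)[OF e(3)] \<eta>le1[OF e(1)] by simp
          show "std_ball j \<inter> C l \<noteq> {}" using J(3)[OF e(3)] GC by blast
          show "pos_rat (psnd n) < \<eta>1 l" "std_ball n \<inter> E l \<noteq> {}" using M(3)[OF e(6)] True by auto
        qed
        then show ?thesis using e by simp
      qed (use e in simp)
    qed
    then show ?thesis by blast
  qed
  ultimately show ?thesis by blast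
qed

text \<open>A ball meeting \<open>X'\<close> pulls back to a nonempty open part of the complex and
  so contains the image of an interior point of a maximal simplex. The finite disjunction of the
  detecting predicates is therefore exact.\<close>

theorem computable_compact_X':
  assumes sc: "semicomputable X'" "semicomputable A'"
  shows "computable_compact X'"
proof -
  let ?M = "{T. maximal_simplex K T \<and> T \<noteq> {}}"
  have fin: "finite ?M" using complex_finite[OF K] by (rule finite_subset[rotated]) (auto simp:
      maximal_simplex_def)
  have "\<forall>T\<in>?M. \<exists>P. ce P \<and> (\<forall>i. P i \<longrightarrow> X' \<inter> std_ball i \<noteq> {}) \<and>
    (\<forall>i q. q \<in> rel_interior T \<longrightarrow> f q \<in> std_ball i \<longrightarrow> P i)"
    using detect_maximal_simplex[OF _ _ sc] by blast
  from bchoice[OF this] obtain P where P: "\<forall>T\<in>?M. ce (P T) \<and> (\<forall>i. P T i \<longrightarrow> X' \<inter> std_ball i \<noteq> {}) \<and>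
    (\<forall>i q. q \<in> rel_interior T \<longrightarrow> f q \<in> std_ball i \<longrightarrow> P T i)" ..
  have "X' \<inter> std_ball i \<noteq> {} \<longleftrightarrow> (\<exists>T\<in>?M. P T i)" for i
  proof
    assume "X' \<inter> std_ball i \<noteq> {}"
    then obtain x where x: "x \<in> \<Union>K" "f x \<in> std_ball i" using f_img by blast
    obtain V where V: "open V" "\<And>x. x \<in> \<Union>K \<Longrightarrow> x \<in> V \<longleftrightarrow> f x \<in> std_ball i" using ball_preimage by metis
    then obtain e where e: "e > 0" "ball x e \<subseteq> V" using x openE by metis
    obtain T q where T: "maximal_simplex K T" "q \<in> rel_interior T" "dist q x < e"
      by (rule rel_interior_maximal_dense[OF K x(1) e(1)])
    have "q \<in> T" using T(2) rel_interior_subset by blast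
    then have "q \<in> \<Union>K" "T \<noteq> {}" using T(1) by (auto simp: maximal_simplex_def)
    moreover have "q \<in> V" using e(2) T(3) by (auto simp: dist_commute)
    ultimately show "\<exists>T\<in>?M. P T i" using P T V(2) by blast
  qed (use P in blast)
  moreover have "ce (\<lambda>i. \<exists>T\<in>?M. P T i)"
    by (rule ce_finite_ex[OF fin]) (use P in blast)
  ultimately have "ce (\<lambda>i. X' \<inter> std_ball i \<noteq> {})" by simp
  then show ?thesis using sc by (simp add: computable_compact_def ce_def)
qed

end

theorem odd_subcomplex_computable_type:
  fixes K :: "'a::euclidean_space set set"
  assumes K: "simplicial_complex K"
  shows "computable_type (\<Union>K) (\<Union>(odd_subcomplex K))"
  unfolding computable_type_def
proof (intro conjI allI impI; (elim conjE)?)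
  show "compact (\<Union>K)" by (rule compact_Union_subset[OF K order_refl])
  show "compact (\<Union>(odd_subcomplex K))" "\<Union>(odd_subcomplex K) \<subseteq> \<Union>K"
    using odd_subcomplex_subset[OF K] by (blast intro: compact_Union_subset[OF K])+
  fix X' A' assume c: "copy_in_cube (\<Union>K) (\<Union>(odd_subcomplex K)) X' A'"
    and sc: "semicomputable X'" "semicomputable A'"
  obtain f \<phi> where "homeomorphism (\<Union>K) X' f \<phi>" "f ` \<Union>(odd_subcomplex K) = A'" "X' \<subseteq> hilbert_cube"
    using c by (auto simp: copy_in_cube_def)
  then interpret embedded_complex K X' A' f \<phi> by unfold_locales (use K in auto)
  show "computable_compact X'" by (rule computable_compact_X'[OF sc])
qed

theorem theorem6p2:
  fixes K :: "'a::euclidean_space set set"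
  assumes "simplicial_complex K"
  shows "(\<forall>d. compatible_metric (\<Union>K) d \<longrightarrow>
            (\<exists>\<epsilon>>0. eps_surjection_property d \<epsilon> (\<Union>K) (\<Union>(odd_subcomplex K))))
         \<and> computable_type (\<Union>K) (\<Union>(odd_subcomplex K))"
  using odd_subcomplex_eps_surjection[OF assms] odd_subcomplex_computable_type[OF assms] by blast

end
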